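(* Let $\omega\in\Omega^1(\mathcal F)$ be a universal 1-form on the algebra $\mathcal F$ of finite energy functions on the Sierpinski gasket $K$, and let $\gamma$ be an (oriented) elementary path in $K$. Then: (i) the integral $\int_\gamma\omega$ is well defined, i.e. the limit $\lim_{n\to\infty} I_n(\gamma)(\omega)$ exists; (ii) the integral is a bimodule trace, namely $\int_\gamma h\,\omega=\int_\gamma\omega\,h$ for every $h\in\mathcal F$; (iii) for every $h\in\mathcal F$, $\displaystyle\int_\gamma h\,\omega=\lim_{n\to\infty}\sum_{e\in E_n(\gamma)}h(e_+)\int_e\omega$; (iv) if $e$ is an (oriented) edge in $K$ and $f,g$ are finite energy functions on $K$, then $\displaystyle\int_e f\,dg=(f,Dg)_e$.
   Context: Sierpinski gasket: $p_0=(0,0)$, $p_1=(\frac12,\frac{\sqrt3}2)$, $p_2=(1,0)$, $w_i(x)=p_i+\frac12(x-p_i)$, and $K\subset\mathbb R^2$ is the unique nonempty compact set with $K=\bigcup_{i=0}^2w_i(K)$. $\Sigma_m=\{0,1,2\}^m$ is the set of words of length $m$, $|\sigma|$ is the length of $\sigma$, $w_\sigma=w_{\sigma_1}\circ\dots\circ w_{\sigma_m}$. $V_0=\{p_0,p_1,p_2\}$, $E_0=\{e_0,e_1,e_2\}$ are the sides of the triangle $p_0p_1p_2$ ($e_i$ opposite to $p_i$), $V_m=\bigcup_{|\sigma|=m}w_\sigma(V_0)$, $E_m=\bigcup_{|\sigma|=m}w_\sigma(E_0)$ (edges of level $m$), $E_*=\bigcup_mE_m$. An oriented edge $e$ has source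 $e_-$ and target $e_+$. Energy: for $f\in C(K)$, $\mathcal E[f]=\lim_{m\to\infty}(5/3)^m\sum_{e\in E_m}|f(e_+)-f(e_-)|^2\in[0,+\infty]$ (each edge arbitrarily oriented), and $\mathcal F=\{f\in C(K):\mathcal E[f]<\infty\}$, which is an involutive subalgebra of $C(K)$; its elements are the finite energy functions. Universal 1-forms: for $f\in\mathcal F$ put $df=f\otimes1-1\otimes f\in\mathcal F\otimes\mathcal F$ (algebraic tensor product); $\Omega^1(\mathcal F)\subset\mathcal F\otimes\mathcal F$ is the sub-$\mathcal F$-bimodule generated by the elements $f\,dg$, with $f\,dg=fg\otimes1-f\otimes g$ and $dg\,f=d(gf)-g\,df=g\otimes f-1\otimes gf$. Elements of $\mathcal F\otimes\mathcal F$ are paired with oriented edges by linear extension of $(f\otimes g)(e)=f(e_+)g(e_-)$; thus $(f\,dg)(e)=f(e_+)(g(e_+)-g(e_-))$ and $(dg\,f)(e)=f(e_-)(g(e_+)-g(e_-))$. Integral: an elementary path is a path in $K$ given by a finite union of consecutive oriented edges in $E_*$. For such an oriented path $\gamma$ and $n\in\mathbb N$, $E_n(\gamma)$ is the set of oriented edges of level $n$ contained in $\gamma$, $I_n(\gamma)(\omega)=\sum_{e\in E_n(\gamma)}\omega(e)$, and $\int_\gamma\omega:=\lim_{n\to\infty}I_n(\gamma)(\omega)$. The form $(f,Dg)_e$: identify the edge $e\in E_*$ with $[0,1]$. $(f,Dg)_e$ denotes the bilinear form given by $\int_0^1f(x)g'(x)\,dx$ for smooth functions $f,g$, taken to extend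 naturally to a bounded form on the fractional Sobolev space $H^{1/2}(e)$; it hence makes sense also for $f,g\in\mathcal F$ since, by results of Jonsson, traces on edges $e\in E_*$ of finite energy functions belong to the fractional Sobolev space $H^\alpha(e)$ for $\alpha\le\alpha_0$, $\alpha_0=\frac{\log(10/3)}{\log4}\sim0.87$.
   Formalization: In (iv), (f,Dg)_e is the bounded extension of ∫fg' to H^α(e) for every 1/2<α≤α_0, not to H^{1/2}(e): no bounded extension to H^{1/2}(e) exists, since for f=1 the form is g(1)-g(0), which the H^{1/2} norm does not control. *)

theory Defs
  imports "HOL-Analysis.Analysis" "HOL-Library.Poly_Mapping"
begin

section \<open>The gasket\<close>

type_synonym point = "real \<times> real"

definition vertex :: "nat \<Rightarrow> point"
  where "vertex i = (if i = 0 then (0, 0) else if i = 1 then (1/2, sqrt 3 / 2) else (1, 0))"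

definition contr :: "nat \<Rightarrow> point \<Rightarrow> point"
  where "contr i x = vertex i + (1/2) *\<^sub>R (x - vertex i)"

definition is_gasket :: "point set \<Rightarrow> bool"
  where "is_gasket K \<longleftrightarrow> K \<noteq> {} \<and> compact K \<and> K = (\<Union>i<3. contr i ` K)"

definition gasket :: "point set"
  where "gasket = (THE K. is_gasket K)"

lemma contr_eq: "contr i x = (1/2) *\<^sub>R vertex i + (1/2) *\<^sub>R x"
  by (simp add: contr_def algebra_simps scaleR_half_double[symmetric] del: scaleR_half_double)
    (simp add: scaleR_left_distrib[symmetric])

lemma dist_contr: "dist (contr i x) (contr i y) = dist x y / 2"
proof -
  have "contr i x - contr i y = (1/2) *\<^sub>R (x - y)"
    by (simp add: contr_eq algebra_simps)
  then show ?thesis by (simp add: dist_norm)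
qed

lemma inj_contr: "inj (contr i)"
  by (rule injI) (simp add: contr_eq)

lemma continuous_on_contr: "continuous_on S (contr i)"
  unfolding contr_eq[abs_def] by (intro continuous_intros)

lemma is_gasketD:
  assumes "is_gasket K"
  shows "compact K" "K \<noteq> {}" "i < 3 \<Longrightarrow> x \<in> K \<Longrightarrow> contr i x \<in> K"
    "x \<in> K \<Longrightarrow> \<exists>i<3. \<exists>y\<in>K. x = contr i y"
  using assms unfolding is_gasket_def by blast+

lemma is_gasket_subset:
  assumes A: "is_gasket A" and B: "is_gasket B"
  shows "A \<subseteq> B"
proof -
  have neB: "B \<noteq> {}" and cB: "closed B" and neA: "A \<noteq> {}" and kA: "compact A"
    using is_gasketD[OF A] is_gasketD[OF B] by (auto simp: compact_imp_closed)
  have "continuous_on A (\<lambda>x. infdist x B)" by (intro continuous_intros)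
  from continuous_attains_sup[OF kA neA this]
  obtain a where a: "a \<in> A" and amax': "\<forall>x\<in>A. infdist x B \<le> infdist a B" ..
  have amax: "infdist x B \<le> infdist a B" if "x \<in> A" for x using amax' that ..
  obtain i a' where i: "i < 3" and a': "a' \<in> A" "a = contr i a'"
    using is_gasketD(4)[OF A a] by blast
  obtain b where b: "b \<in> B" "infdist a' B = dist a' b"
    using infdist_attains_inf[OF cB neB] by metis
  have "contr i b \<in> B" using is_gasketD(3)[OF B i b(1)] .
  then have "infdist a B \<le> dist a (contr i b)" by (rule infdist_le)
  also have "\<dots> = infdist a' B / 2" using a' b by (simp add: dist_contr)
  also have "\<dots> \<le> infdist a B / 2" using amax a' by simp
  finally have "infdist a B \<le> 0" by simp
  then have "infdist x B = 0" if "x \<in> A" for x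
    using amax[OF that] infdist_nonneg[of x B] by linarith
  then show ?thesis using in_closed_iff_infdist_zero[OF cB neB] by blast
qed

lemma is_gasket_exists: "\<exists>K. is_gasket K"
proof -
  define W where "W = (\<lambda>S. \<Union>i<3::nat. contr i ` S)"
  define T where "T = convex hull (vertex ` {..<3})"
  define k where "k = (\<lambda>n. (W ^^ n) T)"
  have W_mono: "A \<subseteq> B \<Longrightarrow> W A \<subseteq> W B" for A B by (auto simp: W_def)
  have T: "compact T" "T \<noteq> {}"
    by (auto simp: T_def finite_imp_compact_convex_hull lessThan_empty_iff)
  have WT: "W T \<subseteq> T"
  proof -
    have "contr i x \<in> T" if "i < 3" "x \<in> T" for i x
    proof -
      have "vertex i \<in> T" using that by (auto simp: T_def hull_inc)
      then show ?thesis unfolding contr_eq using that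
        by (intro convexD) (auto simp: T_def)
    qed
    then show ?thesis by (auto simp: W_def)
  qed
  have k_Suc: "k (Suc n) = W (k n)" for n by (simp add: k_def)
  have k_dec: "k (Suc n) \<subseteq> k n" for n
  proof (induction n)
    case 0 then show ?case using WT by (simp add: k_def)
  next
    case (Suc n) then show ?case using W_mono by (simp add: k_Suc)
  qed
  then have k_anti: "m \<le> n \<Longrightarrow> k n \<subseteq> k m" for m n
    by (rule lift_Suc_antimono_le)
  have kc: "compact (k n) \<and> k n \<noteq> {}" for n
  proof (induction n)
    case 0 then show ?case using T by (simp add: k_def)
  next
    case (Suc n)
    then have "compact (W (k n))" unfolding W_def
      by (intro compact_UN) (auto intro: compact_continuous_image continuous_on_contr)
    moreover obtain z where "z \<in> k n" using Suc by blast
    then have "contr 0 z \<in> W (k n)" unfolding W_def by (intro UN_I[of 0] imageI) simp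
    ultimately show ?case unfolding k_Suc by blast
  qed
  define K where "K = (\<Inter>n. k n)"
  have "K \<noteq> {}" unfolding K_def using kc k_anti by (intro compact_nest) auto
  moreover have "compact K" unfolding K_def using kc
    by (intro compact_Inter) auto
  moreover have "W K \<subseteq> K"
  proof -
    have "W K \<subseteq> k n" for n
      using W_mono[of K "k n"] k_dec[of n] k_Suc[of n] by (auto simp: K_def)
    then show ?thesis by (auto simp: K_def)
  qed
  moreover have "K \<subseteq> W K"
  proof
    fix x assume x: "x \<in> K"
    have "\<exists>i<3. x \<in> contr i ` k n" for n
    proof -
      have "x \<in> k (Suc n)" using x unfolding K_def by blast
      then show ?thesis unfolding k_Suc W_def by blast
    qed
    then obtain c where c: "\<And>n. c n < (3::nat) \<and> x \<in> contr (c n) ` k n" by metis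
    have "range c \<subseteq> {..<3}" using c by auto
    then have "finite (range c)" by (rule finite_subset) simp
    then obtain n0 where inf: "infinite {n. c n = c n0}"
      using pigeonhole_infinite[of "UNIV::nat set" c] by auto
    obtain y where y: "x = contr (c n0) y" using c by blast
    have "y \<in> k n" for n
    proof -
      obtain m where m: "m \<ge> n" "c m = c n0"
        using inf unfolding infinite_nat_iff_unbounded_le by auto
      then have "contr (c n0) y \<in> contr (c n0) ` k m" using c[of m] y by simp
      then have "y \<in> k m" by (simp add: inj_image_mem_iff[OF inj_contr])
      then show ?thesis using k_anti m by blast
    qed
    then have "y \<in> K" unfolding K_def by blast
    moreover have "c n0 < 3" using c by blast
    ultimately show "x \<in> W K" unfolding W_def y by blast
  qed
  ultimately have "is_gasket K" unfolding is_gasket_def W_def by blast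
  then show ?thesis ..
qed

lemma is_gasket_gasket: "is_gasket gasket"
proof -
  obtain K where K: "is_gasket K" using is_gasket_exists ..
  have "\<exists>!K. is_gasket K"
  proof
    show "is_gasket K" by (rule K)
    show "K' = K" if "is_gasket K'" for K'
      using is_gasket_subset[OF that K] is_gasket_subset[OF K that] by (rule equalityI)
  qed
  then show ?thesis unfolding gasket_def by (rule theI')
qed

lemma compact_gasket: "compact gasket" and gasket_nonempty: "gasket \<noteq> {}"
  and contr_gasket: "\<And>i x. i < 3 \<Longrightarrow> x \<in> gasket \<Longrightarrow> contr i x \<in> gasket"
  using is_gasketD[OF is_gasket_gasket] by auto

lemma vertex_in_gasket:
  assumes "i < 3" shows "vertex i \<in> gasket"
proof -
  obtain x where x: "x \<in> gasket" using gasket_nonempty by blast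
  define s where "s n = (contr i ^^ n) x" for n
  have s: "s n \<in> gasket" for n
    by (induction n) (auto simp: s_def x assms contr_gasket)
  have d: "dist (s n) (vertex i) = (1/2)^n * dist x (vertex i)" for n
  proof (induction n)
    case (Suc n)
    have "vertex i = contr i (vertex i)" by (simp add: contr_def)
    then have "dist (s (Suc n)) (vertex i) = dist (s n) (vertex i) / 2"
      using dist_contr[of i "s n" "vertex i"] by (simp add: s_def)
    then show ?case using Suc by simp
  qed (simp add: s_def)
  have "(\<lambda>n. dist (s n) (vertex i)) \<longlonglongrightarrow> 0"
    unfolding d by (intro tendsto_mult_left_zero LIMSEQ_power_zero) simp
  then have "s \<longlonglongrightarrow> vertex i" by (simp add: tendsto_dist_iff[symmetric])
  then show ?thesis
    using s by (rule closed_sequentially[OF compact_imp_closed[OF compact_gasket], rotated])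
qed

section \<open>Edges\<close>

definition words :: "nat \<Rightarrow> nat list set"
  where "words m = {\<sigma>. length \<sigma> = m \<and> set \<sigma> \<subseteq> {..<3}}"

definition contr_word :: "nat list \<Rightarrow> point \<Rightarrow> point"
  where "contr_word \<sigma> = foldr (\<lambda>i g. contr i \<circ> g) \<sigma> id"

text \<open>An oriented edge is the pair \<open>(e\<^sub>-, e\<^sub>+)\<close> of its source and its target.
  The set \<open>edges m\<close> contains every edge of level \<open>m\<close> exactly once, in the orientation
  inherited from the cyclic order of the vertices; \<open>oriented_edges m\<close> contains it in
  both orientations.\<close>

type_synonym oedge = "point \<times> point"

abbreviation source :: "oedge \<Rightarrow> point" where "source \<equiv> fst"
abbreviation target :: "oedge \<Rightarrow> point" where "target \<equiv> snd"

definition edges :: "nat \<Rightarrow> oedge set"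
  where "edges m = {(contr_word \<sigma> (vertex i), contr_word \<sigma> (vertex ((i + 1) mod 3))) |\<sigma> i.
    \<sigma> \<in> words m \<and> i < 3}"

definition oriented_edges :: "nat \<Rightarrow> oedge set"
  where "oriented_edges m = edges m \<union> prod.swap ` edges m"

definition all_oriented_edges :: "oedge set"
  where "all_oriented_edges = (\<Union>m. oriented_edges m)"

lemma words_Suc: "words (Suc m) = (\<Union>i<3. (#) i ` words m)"
  by (auto simp: words_def length_Suc_conv)

lemma contr_word_Cons: "contr_word (i # \<sigma>) x = contr i (contr_word \<sigma> x)"
  by (simp add: contr_word_def)

lemma words_0: "words 0 = {[]}"
  by (auto simp: words_def)

lemma edges_0: "edges 0 = {(vertex 0, vertex 1), (vertex 1, vertex 2), (vertex 2, vertex 0)}"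
proof -
  have "{i. i < (3::nat)} = {0, 1, 2}" by auto
  moreover have "edges 0 = (\<lambda>i. (vertex i, vertex ((i + 1) mod 3))) ` {i. i < 3}"
    by (auto simp: edges_def words_0 contr_word_def)
  ultimately show ?thesis by (simp add: numeral_2_eq_2)
qed

lemma edges_Suc: "edges (Suc m) = (\<Union>i<3. map_prod (contr i) (contr i) ` edges m)"
proof (intro equalityI subsetI)
  fix e assume "e \<in> edges (Suc m)"
  then obtain i \<sigma> j where i: "i < 3" and "\<sigma> \<in> words m" "j < 3"
    and e: "e = (contr_word (i # \<sigma>) (vertex j), contr_word (i # \<sigma>) (vertex ((j + 1) mod 3)))"
    by (auto simp: edges_def words_Suc)
  then have "(contr_word \<sigma> (vertex j), contr_word \<sigma> (vertex ((j + 1) mod 3))) \<in> edges m"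
    unfolding edges_def by blast
  then have "e \<in> map_prod (contr i) (contr i) ` edges m"
    unfolding e contr_word_Cons by (rule rev_image_eqI) simp
  then show "e \<in> (\<Union>i<3. map_prod (contr i) (contr i) ` edges m)" using i by blast
next
  fix e assume "e \<in> (\<Union>i<3. map_prod (contr i) (contr i) ` edges m)"
  then obtain i \<sigma> j where "i < 3" "\<sigma> \<in> words m" "j < 3"
    "e = (contr_word (i # \<sigma>) (vertex j), contr_word (i # \<sigma>) (vertex ((j + 1) mod 3)))"
    by (auto simp: edges_def contr_word_Cons)
  moreover from this have "i # \<sigma> \<in> words (Suc m)" by (auto simp: words_Suc)
  ultimately show "e \<in> edges (Suc m)" unfolding edges_def by blast
qed

lemma finite_edges: "finite (edges m)"
  by (induction m) (auto simp: edges_0 edges_Suc)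

definition bary :: "nat \<Rightarrow> point \<Rightarrow> real"
  where "bary i x = (if i = 0 then 1 - fst x - snd x / sqrt 3
    else if i = 1 then 2 * snd x / sqrt 3 else fst x - snd x / sqrt 3)"

lemma less_3: "i < (3::nat) \<longleftrightarrow> i = 0 \<or> i = 1 \<or> i = 2"
  by auto

lemma bary_contr: "i < 3 \<Longrightarrow> j < 3 \<Longrightarrow>
    bary j (contr i x) = (bary j x + (if i = j then 1 else 0)) / 2"
  unfolding less_3 by (auto simp: bary_def contr_eq vertex_def field_simps)

lemma bary_vertex: "i < 3 \<Longrightarrow> j < 3 \<Longrightarrow> bary j (vertex i) = (if i = j then 1 else 0)"
  unfolding less_3 by (auto simp: bary_def vertex_def)

lemma bary_sum: "bary 0 x + bary 1 x + bary 2 x = 1"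
  by (simp add: bary_def)

lemma bary_eqI: "bary 1 x = bary 1 y \<Longrightarrow> bary 2 x = bary 2 y \<Longrightarrow> x = y"
  by (auto simp: bary_def prod_eq_iff)

lemma edges_bary: "(a, b) \<in> edges m \<Longrightarrow>
    a \<noteq> b \<and> a \<in> gasket \<and> b \<in> gasket \<and> (\<forall>j<3. bary j a \<ge> 0 \<and> bary j b \<ge> 0)"
proof (induction m arbitrary: a b)
  case 0
  have "vertex 0 \<noteq> vertex 1" "vertex 1 \<noteq> vertex 2" "vertex 2 \<noteq> vertex 0"
    by (auto simp: vertex_def)
  with 0 show ?case by (auto simp: edges_0 bary_vertex vertex_in_gasket)
next
  case (Suc m)
  then obtain i a' b' where i: "i < 3" and "(a', b') \<in> edges m"
    and "a = contr i a'" "b = contr i b'" by (auto simp: edges_Suc)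
  with Suc.IH[of a' b'] show ?case
    using inj_contr[of i] by (auto simp: bary_contr contr_gasket dest: injD)
qed

lemma edges_disjoint:
  assumes "i < 3" "j < 3" "i \<noteq> j"
  shows "map_prod (contr i) (contr i) ` edges m \<inter> map_prod (contr j) (contr j) ` edges m = {}"
proof (rule ccontr)
  assume "\<not> ?thesis"
  then obtain u where "u \<in> map_prod (contr i) (contr i) ` edges m"
    "u \<in> map_prod (contr j) (contr j) ` edges m"
    unfolding disjoint_iff not_all not_imp not_not by (elim exE conjE)
  then obtain s t where st: "s \<in> edges m" "t \<in> edges m"
    and st_eq: "map_prod (contr i) (contr i) s = map_prod (contr j) (contr j) t"
    by (elim imageE) simp
  obtain a b where s: "s = (a, b)" by (rule prod.exhaust)
  obtain a' b' where t: "t = (a', b')" by (rule prod.exhaust)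
  have e: "(a, b) \<in> edges m" "(a', b') \<in> edges m"
    and eq: "contr i a = contr j a'" "contr i b = contr j b'"
    using st st_eq unfolding s t by simp_all
  have *: "bary i (contr i c) = 1/2 \<and> bary j (contr i c) = 1/2"
    if "\<forall>k<3. bary k c \<ge> 0" "\<forall>k<3. bary k c' \<ge> 0" "contr i c = contr j c'" for c c'
  proof -
    have pos: "bary k (contr i c) \<ge> 0" if "k < 3" for k
      using \<open>\<forall>k<3. bary k c \<ge> 0\<close> that assms by (simp add: bary_contr)
    have "bary i (contr i c) \<ge> 1/2" using that(1) assms by (simp add: bary_contr)
    moreover have "bary j (contr j c') \<ge> 1/2" using that(2) assms by (simp add: bary_contr)
    ultimately show ?thesis
      using that(3) bary_sum[of "contr i c"] pos[of 0] pos[of 1] pos[of 2] assms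
      unfolding less_3 by auto
  qed
  have "bary i (contr i a) = bary i (contr i b)" "bary j (contr i a) = bary j (contr i b)"
    using *[of a a'] *[of b b'] edges_bary[OF e(1)] edges_bary[OF e(2)] eq by auto
  then have "contr i a = contr i b"
    using assms bary_sum[of "contr i a"] bary_sum[of "contr i b"]
    unfolding less_3 by (intro bary_eqI) auto
  then show False using edges_bary[OF e(1)] inj_contr[of i] by (auto dest: injD)
qed

section \<open>Energy\<close>

definition edge_energy :: "nat \<Rightarrow> (point \<Rightarrow> complex) \<Rightarrow> real"
  where "edge_energy m f = (\<Sum>e\<in>edges m. (cmod (f (target e) - f (source e)))\<^sup>2)"

definition energy :: "(point \<Rightarrow> complex) \<Rightarrow> ennreal"
  where "energy f = lim (\<lambda>m. ennreal ((5/3) ^ m * edge_energy m f))"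

lemma edge_energy_nonneg: "0 \<le> edge_energy m f"
  by (simp add: edge_energy_def sum_nonneg)

lemma edge_energy_Suc: "edge_energy (Suc m) f = (\<Sum>i<3. edge_energy m (f \<circ> contr i))"
proof -
  have "edge_energy (Suc m) f =
      (\<Sum>i<3. \<Sum>e\<in>map_prod (contr i) (contr i) ` edges m. (cmod (f (target e) - f (source e)))\<^sup>2)"
    unfolding edge_energy_def edges_Suc
    by (rule sum.UNION_disjoint) (auto simp: finite_edges edges_disjoint simp del: Int_iff)
  also have "\<dots> = (\<Sum>i<3. edge_energy m (f \<circ> contr i))"
  proof (rule sum.cong[OF refl])
    fix i :: nat
    have "inj (map_prod (contr i) (contr i))" using inj_contr by (intro prod.inj_map) auto
    then show "(\<Sum>e\<in>map_prod (contr i) (contr i) ` edges m. (cmod (f (target e) - f (source e)))\<^sup>2) =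
        edge_energy m (f \<circ> contr i)"
      by (subst sum.reindex) (auto intro: inj_on_subset simp: edge_energy_def)
  qed
  finally show ?thesis .
qed

lemma edge_energy_0: "edge_energy 0 f = (cmod (f (vertex 1) - f (vertex 0)))\<^sup>2 +
    (cmod (f (vertex 2) - f (vertex 1)))\<^sup>2 + (cmod (f (vertex 0) - f (vertex 2)))\<^sup>2"
proof -
  have "vertex 0 \<noteq> vertex 1" "vertex 1 \<noteq> vertex 2" "vertex 2 \<noteq> vertex 0"
    by (auto simp: vertex_def)
  then show ?thesis by (simp add: edge_energy_def edges_0)
qed

lemma renormalization_real:
  fixes a b c x y z :: real
  shows "(b - a)\<^sup>2 + (c - b)\<^sup>2 + (a - c)\<^sup>2 \<le> 5/3 * (
    ((z - a)\<^sup>2 + (y - z)\<^sup>2 + (a - y)\<^sup>2) +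
    ((b - z)\<^sup>2 + (x - b)\<^sup>2 + (z - x)\<^sup>2) +
    ((x - y)\<^sup>2 + (c - x)\<^sup>2 + (y - c)\<^sup>2))"
proof -
  define u v w where "u = x - (a + 2*b + 2*c)/5" and "v = y - (b + 2*a + 2*c)/5"
    and "w = z - (c + 2*b + 2*a)/5"
  have e: "x = u + (a + 2*b + 2*c)/5" "y = v + (b + 2*a + 2*c)/5" "z = w + (c + 2*b + 2*a)/5"
    by (simp_all add: u_def v_def w_def)
  have "5/3 * (
    ((z - a)\<^sup>2 + (y - z)\<^sup>2 + (a - y)\<^sup>2) +
    ((b - z)\<^sup>2 + (x - b)\<^sup>2 + (z - x)\<^sup>2) +
    ((x - y)\<^sup>2 + (c - x)\<^sup>2 + (y - c)\<^sup>2)) = (b - a)\<^sup>2 + (c - b)\<^sup>2 + (a - c)\<^sup>2 +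
    5/3 * ((u - v)\<^sup>2 + (v - w)\<^sup>2 + (w - u)\<^sup>2 + 2 * (u\<^sup>2 + v\<^sup>2 + w\<^sup>2))"
    unfolding e by (simp add: power2_eq_square field_simps)
  then show ?thesis by simp
qed

lemma edge_energy_mono_0: "edge_energy 0 f \<le> 5/3 * edge_energy 1 f"
proof -
  have s: "{..<3::nat} = {0, 1, 2}" by auto
  have v: "contr 0 (vertex 0) = vertex 0" "contr 1 (vertex 1) = vertex 1"
    "contr 2 (vertex 2) = vertex 2" "contr 1 (vertex 0) = contr 0 (vertex 1)"
    "contr 2 (vertex 0) = contr 0 (vertex 2)" "contr 2 (vertex 1) = contr 1 (vertex 2)"
    by (auto simp: contr_def vertex_def)
  show ?thesis
    using renormalization_real[where a = "Re (f (vertex 0))" and b = "Re (f (vertex 1))"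
        and c = "Re (f (vertex 2))" and x = "Re (f (contr 1 (vertex 2)))"
        and y = "Re (f (contr 0 (vertex 2)))" and z = "Re (f (contr 0 (vertex 1)))"]
      renormalization_real[where a = "Im (f (vertex 0))" and b = "Im (f (vertex 1))"
        and c = "Im (f (vertex 2))" and x = "Im (f (contr 1 (vertex 2)))"
        and y = "Im (f (contr 0 (vertex 2)))" and z = "Im (f (contr 0 (vertex 1)))"]
    unfolding One_nat_def edge_energy_Suc s
    by (simp add: edge_energy_0 v[simplified] cmod_power2)
qed

lemma edge_energy_mono: "edge_energy m f \<le> 5/3 * edge_energy (Suc m) f"
proof (induction m arbitrary: f)
  case 0 then show ?case using edge_energy_mono_0 by simp
next
  case (Suc m)
  have "edge_energy (Suc m) f = (\<Sum>i<3. edge_energy m (f \<circ> contr i))"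
    by (rule edge_energy_Suc)
  also have "\<dots> \<le> (\<Sum>i<3. 5/3 * edge_energy (Suc m) (f \<circ> contr i))"
    by (intro sum_mono Suc)
  also have "\<dots> = 5/3 * edge_energy (Suc (Suc m)) f"
    by (simp only: edge_energy_Suc[of "Suc m" f] sum_distrib_left)
  finally show ?case .
qed

lemma incseq_energy: "incseq (\<lambda>m. (5/3) ^ m * edge_energy m f)"
proof (rule incseq_SucI)
  fix m
  have "(5/3) ^ m * edge_energy m f \<le> (5/3) ^ m * (5/3 * edge_energy (Suc m) f)"
    by (intro mult_left_mono edge_energy_mono) auto
  then show "(5/3) ^ m * edge_energy m f \<le> (5/3) ^ Suc m * edge_energy (Suc m) f"
    by (simp add: mult_ac)
qed

lemma energy_tendsto: "(\<lambda>m. ennreal ((5/3) ^ m * edge_energy m f)) \<longlonglongrightarrow> energy f"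
  and energy_SUP: "energy f = (SUP m. ennreal ((5/3) ^ m * edge_energy m f))"
proof -
  have "incseq (\<lambda>m. ennreal ((5/3) ^ m * edge_energy m f))"
    using incseq_energy[of f] by (auto simp: incseq_def intro: ennreal_leI)
  from LIMSEQ_SUP[OF this]
  show "(\<lambda>m. ennreal ((5/3) ^ m * edge_energy m f)) \<longlonglongrightarrow> energy f"
    and "energy f = (SUP m. ennreal ((5/3) ^ m * edge_energy m f))"
    unfolding energy_def by (auto simp: limI)
qed

lemma energy_finite_iff: "energy f < \<infinity> \<longleftrightarrow> (\<exists>C. \<forall>m. (5/3) ^ m * edge_energy m f \<le> C)"
proof
  assume fin: "energy f < \<infinity>"
  have "(5/3) ^ m * edge_energy m f \<le> enn2real (energy f)" for m
  proof -
    have "ennreal ((5/3) ^ m * edge_energy m f) \<le> energy f"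
      unfolding energy_SUP by (rule SUP_upper) simp
    then show ?thesis using fin
      by (metis edge_energy_nonneg enn2real_ennreal enn2real_mono infinity_ennreal_def
          mult_nonneg_nonneg zero_le_divide_iff zero_le_numeral zero_le_power)
  qed
  then show "\<exists>C. \<forall>m. (5/3) ^ m * edge_energy m f \<le> C" by blast
next
  assume "\<exists>C. \<forall>m. (5/3) ^ m * edge_energy m f \<le> C"
  then obtain C where C: "\<And>m. (5/3) ^ m * edge_energy m f \<le> C" by blast
  have "energy f \<le> ennreal C" unfolding energy_SUP
    using C by (intro SUP_least ennreal_leI) auto
  also have "\<dots> < \<infinity>" by simp
  finally show "energy f < \<infinity>" .
qed

lemma energy_finite_dominated:
  assumes "energy f < \<infinity>" "energy g < \<infinity>"
    and le: "\<And>x y. x \<in> gasket \<Longrightarrow> y \<in> gasket \<Longrightarrow>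
      (cmod (h x - h y))\<^sup>2 \<le> A * (cmod (f x - f y))\<^sup>2 + B * (cmod (g x - g y))\<^sup>2"
    and "0 \<le> A" "0 \<le> B"
  shows "energy h < \<infinity>"
proof -
  obtain C D where C: "\<And>m. (5/3) ^ m * edge_energy m f \<le> C"
    and D: "\<And>m. (5/3) ^ m * edge_energy m g \<le> D"
    using assms(1,2) unfolding energy_finite_iff by blast
  have "(5/3) ^ m * edge_energy m h \<le> A * C + B * D" for m
  proof -
    have "edge_energy m h \<le> A * edge_energy m f + B * edge_energy m g"
      unfolding edge_energy_def sum_distrib_left sum.distrib[symmetric]
      using edges_bary by (intro sum_mono le) (metis prod.collapse)+
    then have "(5/3) ^ m * edge_energy m h
        \<le> (5/3) ^ m * (A * edge_energy m f + B * edge_energy m g)"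
      by (intro mult_left_mono) auto
    also have "\<dots> = A * ((5/3) ^ m * edge_energy m f) + B * ((5/3) ^ m * edge_energy m g)"
      by (simp add: algebra_simps)
    also have "\<dots> \<le> A * C + B * D"
      using C D assms by (intro add_mono mult_left_mono) auto
    finally show ?thesis .
  qed
  then show ?thesis unfolding energy_finite_iff by blast
qed

section \<open>The algebra of finite energy functions\<close>

text \<open>A function on the gasket is represented by its extension by zero to the plane.\<close>

definition finite_energy :: "(point \<Rightarrow> complex) \<Rightarrow> bool"
  where "finite_energy f \<longleftrightarrow>
    continuous_on gasket f \<and> (\<forall>x. x \<notin> gasket \<longrightarrow> f x = 0) \<and> energy f < \<infinity>"

lemma finite_energy_const: "finite_energy (\<lambda>x. if x \<in> gasket then c else 0)"
proof -
  have "edge_energy m (\<lambda>x. if x \<in> gasket then c else 0) = 0" for m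
    unfolding edge_energy_def using edges_bary
    by (intro sum.neutral) fastforce
  then have "energy (\<lambda>x. if x \<in> gasket then c else 0) < \<infinity>"
    unfolding energy_finite_iff by auto
  moreover have "continuous_on gasket (\<lambda>x. if x \<in> gasket then c else 0)"
    by (rule continuous_on_eq[OF continuous_on_const]) simp
  ultimately show ?thesis by (simp add: finite_energy_def)
qed

lemma finite_energy_0: "finite_energy (\<lambda>x. 0)"
  using finite_energy_const[of 0] by simp

lemma finite_energy_scale:
  assumes "finite_energy f"
  shows "finite_energy (\<lambda>x. c * f x)"
proof -
  have "energy (\<lambda>x. c * f x) < \<infinity>"
    by (rule energy_finite_dominated[of f f _ "(cmod c)\<^sup>2" 0])
      (use assms in \<open>simp_all add: finite_energy_def right_diff_distrib[symmetric] norm_mult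
        power_mult_distrib\<close>)
  then show ?thesis using assms by (auto simp: finite_energy_def intro!: continuous_on_mult_left)
qed

lemma norm_sum_squared_le: "(cmod (a + b))\<^sup>2 \<le> 2 * (cmod a)\<^sup>2 + 2 * (cmod b)\<^sup>2"
proof -
  have "(cmod (a + b))\<^sup>2 \<le> (cmod a + cmod b)\<^sup>2"
    by (intro power_mono norm_triangle_ineq) simp
  also have "\<dots> \<le> 2 * (cmod a)\<^sup>2 + 2 * (cmod b)\<^sup>2"
    using zero_le_power2[of "cmod a - cmod b"] by (simp add: power2_eq_square algebra_simps)
  finally show ?thesis .
qed

lemma finite_energy_add:
  assumes "finite_energy f" "finite_energy g"
  shows "finite_energy (\<lambda>x. f x + g x)"
proof -
  have "energy (\<lambda>x. f x + g x) < \<infinity>"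
  proof (rule energy_finite_dominated[of f g _ 2 2])
    show "(cmod (f x + g x - (f y + g y)))\<^sup>2 \<le> 2 * (cmod (f x - f y))\<^sup>2 + 2 * (cmod (g x - g y))\<^sup>2"
      for x y
      using norm_sum_squared_le[of "f x - f y" "g x - g y"] by (simp add: algebra_simps)
  qed (use assms in \<open>auto simp: finite_energy_def\<close>)
  then show ?thesis using assms by (auto simp: finite_energy_def intro!: continuous_intros)
qed

lemma finite_energy_bounded:
  assumes "finite_energy f" obtains M where "\<And>x. x \<in> gasket \<Longrightarrow> cmod (f x) \<le> M"
proof -
  have "bounded (f ` gasket)"
    using assms compact_gasket compact_continuous_image compact_imp_bounded
    unfolding finite_energy_def by blast
  then show ?thesis using that unfolding bounded_iff by blast
qed

lemma finite_energy_mult: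
  assumes f: "finite_energy f" and g: "finite_energy g"
  shows "finite_energy (\<lambda>x. f x * g x)"
proof -
  obtain M where M: "\<And>x. x \<in> gasket \<Longrightarrow> cmod (f x) \<le> M" using finite_energy_bounded[OF f] by blast
  obtain N where N: "\<And>x. x \<in> gasket \<Longrightarrow> cmod (g x) \<le> N" using finite_energy_bounded[OF g] by blast
  have "energy (\<lambda>x. f x * g x) < \<infinity>"
  proof (rule energy_finite_dominated[of f g _ "2 * N\<^sup>2" "2 * M\<^sup>2"])
    fix x y assume xy: "x \<in> gasket" "y \<in> gasket"
    have "(cmod (f x * g x - f y * g y))\<^sup>2 = (cmod ((f x - f y) * g x + f y * (g x - g y)))\<^sup>2"
      by (simp add: algebra_simps)
    also have "\<dots> \<le> 2 * (cmod ((f x - f y) * g x))\<^sup>2 + 2 * (cmod (f y * (g x - g y)))\<^sup>2"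
      by (rule norm_sum_squared_le)
    also have "(cmod ((f x - f y) * g x))\<^sup>2 \<le> N\<^sup>2 * (cmod (f x - f y))\<^sup>2"
      using N[OF xy(1)] by (simp add: norm_mult power_mult_distrib mult.commute[of "N\<^sup>2"])
        (intro mult_left_mono power_mono, auto)
    also have "(cmod (f y * (g x - g y)))\<^sup>2 \<le> M\<^sup>2 * (cmod (g x - g y))\<^sup>2"
      using M[OF xy(2)] by (simp add: norm_mult power_mult_distrib)
        (intro mult_right_mono power_mono, auto)
    finally show "(cmod (f x * g x - f y * g y))\<^sup>2
        \<le> 2 * N\<^sup>2 * (cmod (f x - f y))\<^sup>2 + 2 * M\<^sup>2 * (cmod (g x - g y))\<^sup>2" by simp
  qed (use f g in \<open>auto simp: finite_energy_def\<close>)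
  then show ?thesis using f g by (auto simp: finite_energy_def intro!: continuous_intros)
qed

typedef fe = "{f. finite_energy f}"
  morphisms fe_apply Abs_fe
  using finite_energy_0 by blast

setup_lifting type_definition_fe

instantiation fe :: comm_ring_1
begin

lift_definition zero_fe :: fe is "\<lambda>x. 0" by (rule finite_energy_0)
lift_definition one_fe :: fe is "\<lambda>x. if x \<in> gasket then 1 else 0" by (rule finite_energy_const)
lift_definition plus_fe :: "fe \<Rightarrow> fe \<Rightarrow> fe" is "\<lambda>f g x. f x + g x" by (rule finite_energy_add)
lift_definition times_fe :: "fe \<Rightarrow> fe \<Rightarrow> fe" is "\<lambda>f g x. f x * g x" by (rule finite_energy_mult)
lift_definition uminus_fe :: "fe \<Rightarrow> fe" is "\<lambda>f x. - f x"
  using finite_energy_scale[of _ "-1"] by simp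
lift_definition minus_fe :: "fe \<Rightarrow> fe \<Rightarrow> fe" is "\<lambda>f g x. f x - g x"
  using finite_energy_add[of _ "\<lambda>x. -1 * _ x", OF _ finite_energy_scale] by simp

instance
proof
  show "1 * a = a" for a :: fe
    by transfer (auto simp: finite_energy_def fun_eq_iff)
  show "(0::fe) \<noteq> 1"
    using gasket_nonempty by transfer (auto simp: fun_eq_iff)
qed (transfer; simp add: algebra_simps)+

end

lift_definition scale_fe :: "complex \<Rightarrow> fe \<Rightarrow> fe" is "\<lambda>c f x. c * f x"
  by (rule finite_energy_scale)

lemma mult_scale_fe: "h * scale_fe c f = scale_fe c (h * f)" "scale_fe c f * h = scale_fe c (f * h)"
  by (transfer; simp add: algebra_simps)+

lifting_forget fe.lifting

section \<open>The algebraic tensor product\<close>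

text \<open>The tensor product over the complex numbers is the free vector space on pairs modulo
  the bilinearity relations. As the relations below are imposed for all coefficients \<open>d\<close>,
  the additive subgroup they generate is a complex subspace.\<close>

inductive_set tensor_null :: "(fe \<times> fe \<Rightarrow>\<^sub>0 complex) set"
  where
    zero: "0 \<in> tensor_null"
  | diff: "s \<in> tensor_null \<Longrightarrow> t \<in> tensor_null \<Longrightarrow> s - t \<in> tensor_null"
  | add_left: "Poly_Mapping.single (f + f', g) d - Poly_Mapping.single (f, g) d
      - Poly_Mapping.single (f', g) d \<in> tensor_null"
  | add_right: "Poly_Mapping.single (f, g + g') d - Poly_Mapping.single (f, g) d
      - Poly_Mapping.single (f, g') d \<in> tensor_null"
  | scale_left: "Poly_Mapping.single (scale_fe c f, g) d
      - Poly_Mapping.single (f, g) (c * d) \<in> tensor_null"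
  | scale_right: "Poly_Mapping.single (f, scale_fe c g) d
      - Poly_Mapping.single (f, g) (c * d) \<in> tensor_null"

lemma tensor_null_uminus: "t \<in> tensor_null \<Longrightarrow> - t \<in> tensor_null"
  using tensor_null.diff[OF tensor_null.zero] by fastforce

lemma tensor_null_add: "s \<in> tensor_null \<Longrightarrow> t \<in> tensor_null \<Longrightarrow> s + t \<in> tensor_null"
  using tensor_null.diff[OF _ tensor_null_uminus] by fastforce

definition tensor_rel :: "(fe \<times> fe \<Rightarrow>\<^sub>0 complex) \<Rightarrow> (fe \<times> fe \<Rightarrow>\<^sub>0 complex) \<Rightarrow> bool"
  where "tensor_rel s t \<longleftrightarrow> s - t \<in> tensor_null"

quotient_type tensor = "fe \<times> fe \<Rightarrow>\<^sub>0 complex" / tensor_rel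
proof (rule equivpI)
  show "reflp tensor_rel"
    by (rule reflpI) (simp add: tensor_rel_def tensor_null.zero)
  show "symp tensor_rel"
  proof (rule sympI)
    fix s t assume "tensor_rel s t"
    then show "tensor_rel t s" using tensor_null_uminus[of "s - t"] by (simp add: tensor_rel_def)
  qed
  show "transp tensor_rel"
  proof (rule transpI)
    fix s t u assume "tensor_rel s t" "tensor_rel t u"
    then show "tensor_rel s u"
      using tensor_null_add[of "s - t" "t - u"] by (simp add: tensor_rel_def)
  qed
qed

instantiation tensor :: ab_group_add
begin

lift_definition zero_tensor :: tensor is 0 .
lift_definition plus_tensor :: "tensor \<Rightarrow> tensor \<Rightarrow> tensor" is "(+)"
  using tensor_null_add by (fastforce simp: tensor_rel_def algebra_simps)
lift_definition uminus_tensor :: "tensor \<Rightarrow> tensor" is uminus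
  using tensor_null_uminus by (fastforce simp: tensor_rel_def)
lift_definition minus_tensor :: "tensor \<Rightarrow> tensor \<Rightarrow> tensor" is "(-)"
  using tensor_null.diff by (fastforce simp: tensor_rel_def algebra_simps)

instance
  by standard (transfer; simp add: tensor_rel_def tensor_null.zero algebra_simps)+

end

lift_definition pure_tensor :: "fe \<Rightarrow> fe \<Rightarrow> tensor"  (infixl "\<otimes>\<^sub>F" 75)
  is "\<lambda>f g. Poly_Mapping.single (f, g) 1" .

definition extend :: "('k \<Rightarrow> 'c \<Rightarrow> 'b) \<Rightarrow> ('k \<Rightarrow>\<^sub>0 'c::zero) \<Rightarrow> 'b::comm_monoid_add"
  where "extend \<phi> t = (\<Sum>k\<in>Poly_Mapping.keys t. \<phi> k (Poly_Mapping.lookup t k))"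

lemma extend_single: "\<phi> k 0 = 0 \<Longrightarrow> extend \<phi> (Poly_Mapping.single k c) = \<phi> k c"
  by (simp add: extend_def)

lemma extend_diff:
  fixes \<phi> :: "'k \<Rightarrow> 'c::ab_group_add \<Rightarrow> 'b::ab_group_add"
  assumes "\<And>k c d. \<phi> k (c - d) = \<phi> k c - \<phi> k d"
  shows "extend \<phi> (s - t) = extend \<phi> s - extend \<phi> t"
proof -
  let ?A = "Poly_Mapping.keys s \<union> Poly_Mapping.keys t"
  have 0: "\<phi> k 0 = 0" for k using assms[of k 0 0] by simp
  have e: "extend \<phi> u = (\<Sum>k\<in>?A. \<phi> k (Poly_Mapping.lookup u k))"
    if "Poly_Mapping.keys u \<subseteq> ?A" for u
    unfolding extend_def using that
    by (intro sum.mono_neutral_left) (auto simp: 0 in_keys_iff)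
  have "Poly_Mapping.keys (s - t) \<subseteq> ?A" by (auto simp: in_keys_iff lookup_minus)
  then show ?thesis by (simp add: e lookup_minus assms sum_subtractf)
qed

definition formal_lmult :: "fe \<Rightarrow> (fe \<times> fe \<Rightarrow>\<^sub>0 complex) \<Rightarrow> (fe \<times> fe \<Rightarrow>\<^sub>0 complex)"
  where "formal_lmult h = extend (\<lambda>(f, g) c. Poly_Mapping.single (h * f, g) c)"

definition formal_rmult :: "(fe \<times> fe \<Rightarrow>\<^sub>0 complex) \<Rightarrow> fe \<Rightarrow> (fe \<times> fe \<Rightarrow>\<^sub>0 complex)"
  where "formal_rmult t h = extend (\<lambda>(f, g) c. Poly_Mapping.single (f, g * h) c) t"

definition formal_pair :: "oedge \<Rightarrow> (fe \<times> fe \<Rightarrow>\<^sub>0 complex) \<Rightarrow> complex"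
  where "formal_pair e = extend (\<lambda>(f, g) c. c * (fe_apply f (target e) * fe_apply g (source e)))"

lemma formal_diff:
  "formal_lmult h (s - t) = formal_lmult h s - formal_lmult h t"
  "formal_rmult (s - t) h = formal_rmult s h - formal_rmult t h"
  "formal_pair e (s - t) = formal_pair e s - formal_pair e t"
  unfolding formal_lmult_def formal_rmult_def formal_pair_def
  by (rule extend_diff; simp add: split_beta single_diff algebra_simps)+

lemma formal_single:
  "formal_lmult h (Poly_Mapping.single (f, g) c) = Poly_Mapping.single (h * f, g) c"
  "formal_rmult (Poly_Mapping.single (f, g) c) h = Poly_Mapping.single (f, g * h) c"
  "formal_pair e (Poly_Mapping.single (f, g) c) = c * (fe_apply f (target e) * fe_apply g (source e))"
  unfolding formal_lmult_def formal_rmult_def formal_pair_def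
  by (simp_all add: extend_single)

lemma formal_lmult_null: "t \<in> tensor_null \<Longrightarrow> formal_lmult h t \<in> tensor_null"
proof (induction rule: tensor_null.induct)
  case zero
  then show ?case by (simp add: formal_lmult_def extend_def tensor_null.zero)
qed (simp_all add: formal_diff formal_single mult_scale_fe distrib_left tensor_null.intros)

lemma formal_rmult_null: "t \<in> tensor_null \<Longrightarrow> formal_rmult t h \<in> tensor_null"
proof (induction rule: tensor_null.induct)
  case zero
  then show ?case by (simp add: formal_rmult_def extend_def tensor_null.zero)
qed (simp_all add: formal_diff formal_single mult_scale_fe distrib_right tensor_null.intros)

lemma formal_pair_null: "t \<in> tensor_null \<Longrightarrow> formal_pair e t = 0"
proof (induction rule: tensor_null.induct)
  case zero
  then show ?case by (simp add: formal_pair_def extend_def)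
qed (simp_all add: formal_diff formal_single plus_fe.rep_eq scale_fe.rep_eq ring_distribs)

lift_definition lmult :: "fe \<Rightarrow> tensor \<Rightarrow> tensor"  (infixr "\<cdot>\<^sub>L" 72) is formal_lmult
  using formal_lmult_null by (simp add: tensor_rel_def formal_diff[symmetric])

lift_definition rmult :: "tensor \<Rightarrow> fe \<Rightarrow> tensor"  (infixl "\<cdot>\<^sub>R" 72) is formal_rmult
  using formal_rmult_null by (simp add: tensor_rel_def formal_diff[symmetric])

text \<open>The pairing \<open>\<omega>(e)\<close> of a tensor with an oriented edge.\<close>

lift_definition pairing :: "tensor \<Rightarrow> oedge \<Rightarrow> complex" is "\<lambda>t e. formal_pair e t"
  using formal_pair_null by (fastforce simp: tensor_rel_def formal_diff)

section \<open>Universal 1-forms\<close>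

definition der :: "fe \<Rightarrow> tensor"
  where "der f = f \<otimes>\<^sub>F 1 - 1 \<otimes>\<^sub>F f"

inductive_set Omega1 :: "tensor set"
  where
    form: "f \<cdot>\<^sub>L der g \<in> Omega1"
  | zero: "0 \<in> Omega1"
  | add: "\<omega> \<in> Omega1 \<Longrightarrow> \<eta> \<in> Omega1 \<Longrightarrow> \<omega> + \<eta> \<in> Omega1"
  | lmult: "\<omega> \<in> Omega1 \<Longrightarrow> h \<cdot>\<^sub>L \<omega> \<in> Omega1"
  | rmult: "\<omega> \<in> Omega1 \<Longrightarrow> \<omega> \<cdot>\<^sub>R h \<in> Omega1"

lemma lmult_pure: "h \<cdot>\<^sub>L (f \<otimes>\<^sub>F g) = (h * f) \<otimes>\<^sub>F g"
  and rmult_pure: "(f \<otimes>\<^sub>F g) \<cdot>\<^sub>R h = f \<otimes>\<^sub>F (g * h)"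
  and pairing_pure: "pairing (f \<otimes>\<^sub>F g) e = fe_apply f (target e) * fe_apply g (source e)"
  by (transfer; simp add: formal_single tensor_rel_def tensor_null.zero)+

lemma lmult_diff: "h \<cdot>\<^sub>L (s - t) = h \<cdot>\<^sub>L s - h \<cdot>\<^sub>L t"
  and rmult_diff: "(s - t) \<cdot>\<^sub>R h = s \<cdot>\<^sub>R h - t \<cdot>\<^sub>R h"
  and pairing_diff: "pairing (s - t) e = pairing s e - pairing t e"
  by (transfer; simp add: formal_diff tensor_rel_def tensor_null.zero)+

lemma lmult_der: "f \<cdot>\<^sub>L der g = (f * g) \<otimes>\<^sub>F 1 - f \<otimes>\<^sub>F g"
  and rmult_der: "der g \<cdot>\<^sub>R f = der (g * f) - g \<cdot>\<^sub>L der f"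
  by (simp_all add: der_def lmult_diff rmult_diff lmult_pure rmult_pure)

section \<open>Elementary paths and integrals\<close>

text \<open>An elementary path is given by the list of its consecutive oriented edges, which may
  have different levels.\<close>

definition elementary_path :: "oedge list \<Rightarrow> bool"
  where "elementary_path \<gamma> \<longleftrightarrow> \<gamma> \<noteq> [] \<and> set \<gamma> \<subseteq> all_oriented_edges \<and>
    (\<forall>i. Suc i < length \<gamma> \<longrightarrow> target (\<gamma> ! i) = source (\<gamma> ! Suc i))"

definition edge_segment :: "oedge \<Rightarrow> point set"
  where "edge_segment e = closed_segment (source e) (target e)"

definition same_direction :: "oedge \<Rightarrow> oedge \<Rightarrow> bool"
  where "same_direction e e' \<longleftrightarrow> (\<exists>c>0. target e' - source e' = c *\<^sub>R (target e - source e))"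

text \<open>An oriented edge is contained in \<open>\<gamma>\<close> if it is covered by those edges of \<open>\<gamma>\<close> which are
  traversed in its direction.\<close>

definition path_edges :: "nat \<Rightarrow> oedge list \<Rightarrow> oedge set"
  where "path_edges n \<gamma> = {e \<in> oriented_edges n.
    edge_segment e \<subseteq> (\<Union>e'\<in>{e' \<in> set \<gamma>. same_direction e e'}. edge_segment e')}"

definition riemann_sum :: "nat \<Rightarrow> oedge list \<Rightarrow> tensor \<Rightarrow> complex"
  where "riemann_sum n \<gamma> \<omega> = (\<Sum>e\<in>path_edges n \<gamma>. pairing \<omega> e)"

definition path_integral :: "oedge list \<Rightarrow> tensor \<Rightarrow> complex"
  where "path_integral \<gamma> \<omega> = lim (\<lambda>n. riemann_sum n \<gamma> \<omega>)"

section \<open>Fractional Sobolev spaces on an edge\<close>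

text \<open>Functions on an edge are regarded as functions on \<open>[0,1]\<close> by means of \<open>edge_trace\<close>. The
  values of \<open>u\<close> outside \<open>[0,1]\<close> play no role below.\<close>

definition edge_trace :: "oedge \<Rightarrow> fe \<Rightarrow> real \<Rightarrow> complex"
  where "edge_trace e f x = fe_apply f (source e + x *\<^sub>R (target e - source e))"

definition sobolev_sq :: "real \<Rightarrow> (real \<Rightarrow> complex) \<Rightarrow> ennreal"
  where "sobolev_sq \<alpha> u =
    (\<integral>\<^sup>+x\<in>{0..1}. ennreal ((cmod (u x))\<^sup>2) \<partial>lborel) +
    (\<integral>\<^sup>+x\<in>{0..1}. (\<integral>\<^sup>+y\<in>{0..1}.
      ennreal ((cmod (u x - u y))\<^sup>2 / \<bar>x - y\<bar> powr (1 + 2 * \<alpha>)) \<partial>lborel) \<partial>lborel)"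

definition sobolev :: "real \<Rightarrow> (real \<Rightarrow> complex) set"
  where "sobolev \<alpha> = {u. set_borel_measurable borel {0..1} u \<and> sobolev_sq \<alpha> u < \<infinity>}"

definition sobolev_norm :: "real \<Rightarrow> (real \<Rightarrow> complex) \<Rightarrow> real"
  where "sobolev_norm \<alpha> u = sqrt (enn2real (sobolev_sq \<alpha> u))"

definition smooth_unit :: "(real \<Rightarrow> complex) \<Rightarrow> bool"
  where "smooth_unit u \<longleftrightarrow> (\<exists>D :: nat \<Rightarrow> real \<Rightarrow> complex. (\<forall>x\<in>{0..1}. D 0 x = u x) \<and>
    (\<forall>k. \<forall>x\<in>{0..1}. (D k has_vector_derivative D (Suc k) x) (at x within {0..1})))"

definition bounded_extension :: "real \<Rightarrow> ((real \<Rightarrow> complex) \<Rightarrow> (real \<Rightarrow> complex) \<Rightarrow> complex) \<Rightarrow> bool"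
  where "bounded_extension \<alpha> B \<longleftrightarrow>
    (\<forall>u\<in>sobolev \<alpha>. \<forall>v\<in>sobolev \<alpha>. \<forall>w\<in>sobolev \<alpha>.
      B (\<lambda>x. u x + v x) w = B u w + B v w \<and> B w (\<lambda>x. u x + v x) = B w u + B w v) \<and>
    (\<forall>c. \<forall>u\<in>sobolev \<alpha>. \<forall>v\<in>sobolev \<alpha>.
      B (\<lambda>x. c * u x) v = c * B u v \<and> B u (\<lambda>x. c * v x) = c * B u v) \<and>
    (\<exists>C. \<forall>u\<in>sobolev \<alpha>. \<forall>v\<in>sobolev \<alpha>.
      cmod (B u v) \<le> C * sobolev_norm \<alpha> u * sobolev_norm \<alpha> v) \<and>
    (\<forall>u v. smooth_unit u \<longrightarrow> smooth_unit v \<longrightarrow>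
      B u v = integral {0..1} (\<lambda>x. u x * vector_derivative v (at x within {0..1})))"

text \<open>\<open>edge_form \<alpha> e f g\<close> is \<open>(f, Dg)\<^sub>e\<close>, obtained from the bounded extension of the smooth
  form to the Sobolev space of order \<open>\<alpha>\<close>. No bounded extension exists for \<open>\<alpha> = 1/2\<close>: already
  for \<open>u = 1\<close> the form is the difference of the boundary values of \<open>v\<close>, which is not
  controlled by the norm of order \<open>1/2\<close>. The relevant orders are \<open>1/2 < \<alpha> \<le> alpha0\<close>.\<close>

definition edge_form :: "real \<Rightarrow> oedge \<Rightarrow> fe \<Rightarrow> fe \<Rightarrow> complex"
  where "edge_form \<alpha> e f g = (THE c. \<exists>B. bounded_extension \<alpha> B \<and> c = B (edge_trace e f) (edge_trace e g))"

definition alpha0 :: real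
  where "alpha0 = ln (10/3) / ln 4"

end

theory Submission
  imports Defs
begin

text \<open>
  On an edge, the level-\<open>n\<close> sums of \<open>f dg\<close> change from level \<open>n\<close> to level \<open>n + 1\<close> by a sum of
  products of increments of \<open>f\<close> and \<open>g\<close>. The sums of squared increments over the edges of level \<open>n\<close>
  are \<open>O((3/5)\<^sup>n)\<close> by finiteness of the energy, so the sums converge geometrically, uniformly enough
  to give the trace property and the refinement formula.

  For the identification with \<open>(f, Dg)\<^sub>e\<close>, let \<open>D n\<close> be the sum of the squared increments at level
  \<open>n\<close> along a single edge. The energy \<open>A n\<close> of the strip of cells of level \<open>n\<close> touching the edge
  satisfies \<open>A (n + 1) \<le> \<theta> (3/5) A n + C \<delta> n\<close> with \<open>\<theta> < 1\<close>, where \<open>(5/3)\<^sup>n \<delta> n\<close> is a summable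
  increment of the total energy; hence \<open>\<Sum> (5/3)\<^sup>n D n < \<infinity>\<close>, which by dyadic chaining bounds the
  fractional Sobolev norm of the trace up to the critical order. A bounded extension of the form exists
  as a limit of trapezoid sums of dyadic averages. It is unique on traces because their \<open>C\<^sup>1\<close> dyadic
  interpolants converge to them in the Sobolev norm; on interpolants the form is exactly a trapezoid
  sum, which differs from the sum defining the path integral by a vanishing amount.
\<close>

text \<open>The bound O((3/5)^n) for the squared increments would give the Sobolev norm only below
  the critical order: \<open>2 powr (2 * alpha0 - 1)\<close> is exactly 5/3, and at that ratio a
  convergent series is needed, not a bounded sequence. The gain comes from the harmonic extension of
  three vertex values. In the two subcells along one side it has at most 14/25 of the energy of the
  parent cell, and 14/25 < 3/5; the deviation from the harmonic extension is charged to the energy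
  increment. The form on an edge is given as the value common to all bounded extensions, so two
  opposite obstacles arise. A bounded form on the whole Sobolev space is blind to null sets, hence
  cannot be built from point values. An arbitrary extension, on the other hand, is prescribed on
  smooth functions only, and traces have to be reached from there through C^1 functions, with errors
  small in the Lipschitz sense because uniform smallness does not control the norm. Quadratic
  splines are used as interpolants: piecewise linear ones have kinks.\<close>

lemma sum_two_power_Suc:
  fixes F :: "nat \<Rightarrow> 'a::comm_monoid_add"
  shows "(\<Sum>k<2 ^ Suc n. F k) = (\<Sum>k<2 ^ n. F (2 * k) + F (2 * k + 1))"
  using sum.nat_group[of F 2 "2 ^ n"] by (simp add: numeral_2_eq_2 mult.commute)

lemma real_Suc_le_two_power: "k < 2 ^ n \<Longrightarrow> real (Suc k) \<le> 2 ^ n"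
  by (metis Suc_leI of_nat_le_iff of_nat_numeral of_nat_power)

lemma mult_le_half_squares: "a * b \<le> (a\<^sup>2 + b\<^sup>2) / 2" for a b :: real
  using zero_le_power2[of "a - b"] by (simp add: power2_eq_square algebra_simps)

section \<open>Subdivision of edges\<close>

text \<open>Pieces are given by the affine parameter and not by words, so the orientation of
  \<open>e\<close> is inherited and iterated subdivision becomes arithmetic on indices. Only
  \<open>k < 2 ^ j\<close> gives pieces of \<open>e\<close>.\<close>

definition subedge :: "oedge \<Rightarrow> nat \<Rightarrow> nat \<Rightarrow> oedge"
  where "subedge e j k = (source e + (real k / 2 ^ j) *\<^sub>R (target e - source e),
    source e + (real (Suc k) / 2 ^ j) *\<^sub>R (target e - source e))"

lemma source_subedge: "source (subedge e j k) = source e + (real k / 2 ^ j) *\<^sub>R (target e - source e)"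
  and target_subedge: "target (subedge e j k) = source e + (real (Suc k) / 2 ^ j) *\<^sub>R (target e - source e)"
  by (simp_all add: subedge_def)

lemma subedge_direction:
  "target (subedge e j k) - source (subedge e j k) = (1 / 2 ^ j) *\<^sub>R (target e - source e)"
  by (simp add: subedge_def scaleR_left_diff_distrib[symmetric] diff_divide_distrib[symmetric])

lemma subedge_0: "subedge e 0 0 = e"
  by (simp add: subedge_def)

lemma subedge_subedge: "subedge (subedge e i k) j l = subedge e (i + j) (k * 2 ^ j + l)"
proof -
  have *: "s + (real k / 2 ^ i) *\<^sub>R v + (x / 2 ^ j) *\<^sub>R (1 / 2 ^ i) *\<^sub>R v =
      s + ((real k * 2 ^ j + x) / 2 ^ (i + j)) *\<^sub>R v" for s v :: point and x
    by (simp add: scaleR_add_left[symmetric] add.assoc power_add add_divide_distrib mult.commute)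
  have "real (Suc (k * 2 ^ j + l)) = real k * 2 ^ j + real (Suc l)"
    "real (k * 2 ^ j + l) = real k * 2 ^ j + real l" by simp_all
  then show ?thesis
    unfolding prod_eq_iff[of "subedge _ _ _"] source_subedge[of _ j] target_subedge[of _ j]
      source_subedge[of _ "i + j"] target_subedge[of _ "i + j"] subedge_direction
    by (simp only: source_subedge * simp_thms)
qed

lemma contr_affine: "contr l (s + x *\<^sub>R v) = contr l s + (x / 2) *\<^sub>R v"
  by (simp add: contr_eq scaleR_add_right)

lemma contr_diff: "contr l y - contr l x = (1/2) *\<^sub>R (y - x)"
  by (simp add: contr_eq scaleR_right_diff_distrib)

lemma subedge_contr:
  "subedge (map_prod (contr l) (contr l) e) j k = map_prod (contr l) (contr l) (subedge e j k)"
  by (simp add: prod_eq_iff[of "subedge _ _ _"] source_subedge target_subedge contr_diff contr_affine)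

lemma subedge_swap:
  assumes "k < 2 ^ j"
  shows "subedge (prod.swap e) j k = prod.swap (subedge e j (2 ^ j - Suc k))"
proof -
  have *: "t + (x / 2 ^ j) *\<^sub>R (s - t) = s + ((2 ^ j - x) / 2 ^ j) *\<^sub>R (t - s)" for s t :: point and x
    by (simp add: diff_divide_distrib algebra_simps)
  have "real (2 ^ j - Suc k) = 2 ^ j - real (Suc k)" "real (Suc (2 ^ j - Suc k)) = 2 ^ j - real k"
    using assms by (simp_all add: of_nat_diff)
  then show ?thesis
    by (simp only: prod_eq_iff[of "subedge _ _ _"] source_subedge target_subedge fst_swap snd_swap
        *[of "target e" _ "source e"] simp_thms)
qed

text \<open>The half of an edge next to an end vertex is the image of the whole edge under the
  contraction fixing that vertex, with the same orientation. This settles level 0; the induction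
  strips the outermost contraction.\<close>

lemma half_edges: "e \<in> edges m \<Longrightarrow> k < 2 \<Longrightarrow> subedge e 1 k \<in> edges (Suc m)"
proof (induction m arbitrary: e)
  case 0
  have k: "k = 0 \<or> k = 1" using 0 by auto
  have "\<exists>i<3. \<exists>f\<in>edges 0. subedge e 1 k = map_prod (contr i) (contr i) f"
  proof -
    have H: "\<exists>i<3. \<exists>f\<in>edges 0. subedge (vertex a, vertex b) 1 k = map_prod (contr i) (contr i) f"
      if "(vertex a, vertex b) \<in> edges 0" "a < 3" "b < 3" for a b
    proof (cases "k = 0")
      case True
      then have "subedge (vertex a, vertex b) 1 k = map_prod (contr a) (contr a) (vertex a, vertex b)"
        by (simp add: subedge_def contr_def)
      then show ?thesis using that by blast
    next
      case False
      then have "k = 1" using k by simp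
      then have "subedge (vertex a, vertex b) 1 k = map_prod (contr b) (contr b) (vertex a, vertex b)"
        by (simp add: subedge_def contr_eq algebra_simps flip: scaleR_add_left)
      then show ?thesis using that by blast
    qed
    have "e = (vertex 0, vertex 1) \<or> e = (vertex 1, vertex 2) \<or> e = (vertex 2, vertex 0)"
      using 0 by (auto simp: edges_0)
    then show ?thesis using H[of 0 1] H[of 1 2] H[of 2 0] by (auto simp: edges_0)
  qed
  then show ?case unfolding edges_Suc by auto
next
  case (Suc m)
  then obtain i f where i: "i < 3" "f \<in> edges m" "e = map_prod (contr i) (contr i) f"
    by (auto simp: edges_Suc[of m])
  then have "subedge f 1 k \<in> edges (Suc m)" using Suc by blast
  then show ?case unfolding edges_Suc[of "Suc m"] i(3) subedge_contr using i(1) by blast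
qed

lemma half_oriented: 
  assumes "e \<in> oriented_edges m" "k < 2" shows "subedge e 1 k \<in> oriented_edges (Suc m)"
proof (cases "e \<in> edges m")
  case True
  then show ?thesis using half_edges[OF True assms(2)] by (simp add: oriented_edges_def)
next
  case False
  then obtain f where f: "f \<in> edges m" "e = prod.swap f" using assms by (auto simp: oriented_edges_def)
  then have "subedge e 1 k = prod.swap (subedge f 1 (2 ^ 1 - Suc k))"
    using assms(2) by (simp add: subedge_swap[of k 1, simplified])
  then show ?thesis using half_edges[OF f(1), of "2 ^ 1 - Suc k"] by (auto simp: oriented_edges_def)
qed

lemma subedge_oriented:
  "e \<in> oriented_edges m \<Longrightarrow> k < 2 ^ j \<Longrightarrow> subedge e j k \<in> oriented_edges (m + j)"
proof (induction j arbitrary: k)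
  case 0 then show ?case by (simp add: subedge_0)
next
  case (Suc j)
  have "k div 2 < 2 ^ j" using Suc.prems by auto
  then have "subedge e j (k div 2) \<in> oriented_edges (m + j)" using Suc by blast
  then have "subedge (subedge e j (k div 2)) 1 (k mod 2) \<in> oriented_edges (Suc (m + j))"
    by (rule half_oriented) simp
  then show ?case by (simp add: subedge_subedge)
qed

section \<open>Integrality of barycentric coordinates and the position of edges\<close>

definition pow_lattice :: "nat \<Rightarrow> point \<Rightarrow> bool"
  where "pow_lattice n x \<longleftrightarrow> (\<forall>l<3. 2 ^ n * bary l x \<in> \<int>)"

lemma pow_lattice_mono:
  assumes "pow_lattice m x" "m \<le> n"
  shows "pow_lattice n x"
proof -
  have "2 ^ n * bary l x = 2 ^ (n - m) * (2 ^ m * bary l x)" for l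
    using assms(2) by (simp add: power_add[symmetric] mult.assoc[symmetric] del: mult_cancel_right)
  moreover have "2 ^ (n - m) * (2 ^ m * bary l x) \<in> \<int>" if "l < 3" for l
    by (rule Ints_mult) (use assms(1) that in \<open>auto simp: pow_lattice_def intro: Ints_power\<close>)
  ultimately show ?thesis unfolding pow_lattice_def by metis
qed

text \<open>The last clause is what transfers integrality to a parameter: some barycentric
  coordinate changes along the edge by exactly the length of the edge. A contraction halves
  coordinates and adds 1/2 to one of them, which keeps all clauses.\<close>

lemma edges_lattice: "(a, b) \<in> edges m \<Longrightarrow>
  pow_lattice m a \<and> pow_lattice m b \<and> dist a b = 1 / 2 ^ m \<and> (\<exists>l<3. \<bar>bary l b - bary l a\<bar> = 1 / 2 ^ m)"
proof (induction m arbitrary: a b)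
  case 0
  have v: "i < 3 \<Longrightarrow> pow_lattice 0 (vertex i)" for i
    by (auto simp: pow_lattice_def bary_vertex)
  have b: "\<exists>l<3. \<bar>bary l (vertex j) - bary l (vertex i)\<bar> = 1" if "i < 3" "j < 3" "i \<noteq> j" for i j
    using that by (intro exI[of _ i]) (auto simp: bary_vertex)
  have d: "dist (vertex 0) (vertex 1) = 1" "dist (vertex 1) (vertex 2) = 1" "dist (vertex 2) (vertex 0) = 1"
    by (auto simp: dist_prod_def vertex_def dist_real_def power_divide)
  show ?case using 0 d b[of 0 1] b[of 1 2] b[of 2 0] by (auto simp: edges_0 v)
next
  case (Suc m)
  then obtain i a' b' where i: "i < 3" and e: "(a', b') \<in> edges m"
    and ab: "a = contr i a'" "b = contr i b'" by (auto simp: edges_Suc)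
  have "pow_lattice (Suc m) (contr i x)" if x: "pow_lattice m x" for x
  proof -
    have "2 ^ Suc m * bary l (contr i x) = 2 ^ m * bary l x + (if i = l then 2 ^ m else 0)" if "l < 3" for l
      unfolding bary_contr[OF i that] by (simp add: algebra_simps)
    then show ?thesis using x by (auto simp: pow_lattice_def)
  qed
  moreover from Suc.IH[OF e] obtain l where l: "l < 3" "\<bar>bary l b' - bary l a'\<bar> = 1 / 2 ^ m" by blast
  then have "\<bar>bary l b - bary l a\<bar> = 1 / 2 ^ Suc m"
    unfolding ab bary_contr[OF i l(1)] by (simp add: diff_divide_distrib[symmetric] abs_divide)
  ultimately show ?case using Suc.IH[OF e] ab l(1) by (auto simp: dist_contr)
qed

lemma oriented_edges_lattice:
  assumes "e \<in> oriented_edges m"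
  shows "pow_lattice m (source e)" "pow_lattice m (target e)" "norm (target e - source e) = 1 / 2 ^ m"
    "\<exists>l<3. \<bar>bary l (target e) - bary l (source e)\<bar> = 1 / 2 ^ m"
    "source e \<in> gasket" "target e \<in> gasket" "source e \<noteq> target e"
  using assms edges_lattice[of "fst e" "snd e" m] edges_lattice[of "snd e" "fst e" m]
    edges_bary[of "fst e" "snd e" m] edges_bary[of "snd e" "fst e" m]
  by (auto simp: oriented_edges_def dist_norm norm_minus_commute abs_minus_commute)

lemma bary_line: "bary l (s + x *\<^sub>R (t - s)) = bary l s + x * (bary l t - bary l s)"
  by (simp add: bary_def algebra_simps add_divide_distrib diff_divide_distrib)

text \<open>Up to sign, coordinate \<open>l\<close> moves by \<open>\<tau> / 2 ^ m\<close> from the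
  source to \<open>x\<close>, and both points lie in the lattice of level \<open>n\<close>.\<close>

lemma lattice_on_edge:
  assumes e: "e \<in> oriented_edges m" and "m \<le> n"
    and "pow_lattice n x" "x = source e + \<tau> *\<^sub>R (target e - source e)"
  shows "2 ^ (n - m) * \<tau> \<in> \<int>"
proof -
  obtain l where l: "l < 3" "\<bar>bary l (target e) - bary l (source e)\<bar> = 1 / 2 ^ m"
    using oriented_edges_lattice(4)[OF e] by blast
  have "2 ^ n * bary l x - 2 ^ n * bary l (source e) \<in> \<int>"
    using assms(3) pow_lattice_mono[OF oriented_edges_lattice(1)[OF e] assms(2)] l(1)
    by (intro Ints_diff) (auto simp: pow_lattice_def)
  also have "2 ^ n * bary l x - 2 ^ n * bary l (source e) =
      2 ^ n * (\<tau> * (bary l (target e) - bary l (source e)))"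
    unfolding assms(4) bary_line by (simp add: algebra_simps)
  finally have I: "2 ^ n * (\<tau> * (bary l (target e) - bary l (source e))) \<in> \<int>" .
  have "2 ^ n * (\<tau> * (bary l (target e) - bary l (source e))) = 2 ^ (n - m) * \<tau> \<or>
      2 ^ n * (\<tau> * (bary l (target e) - bary l (source e))) = - (2 ^ (n - m) * \<tau>)"
  proof -
    have "bary l (target e) - bary l (source e) = 1 / 2 ^ m \<or> bary l (target e) - bary l (source e) = - (1 / 2 ^ m)"
      using l(2) by linarith
    then show ?thesis using assms(2) by (auto simp: power_diff)
  qed
  then show ?thesis using I by (metis minus_in_Ints_iff)
qed

lemma same_direction_levels:
  assumes "e \<in> oriented_edges n" "e' \<in> oriented_edges m" "m \<le> n" "same_direction e e'"
  shows "target e - source e = (1 / 2 ^ (n - m)) *\<^sub>R (target e' - source e')"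
proof -
  obtain c where c: "c > 0" "target e' - source e' = c *\<^sub>R (target e - source e)"
    using assms by (auto simp: same_direction_def)
  then have "1 / 2 ^ m = c * (1 / 2 ^ n)"
    using oriented_edges_lattice(3)[OF assms(1)] oriented_edges_lattice(3)[OF assms(2)] by simp
  then have "c = 2 ^ (n - m)" using assms(3) by (simp add: power_diff field_simps)
  then show ?thesis using c(2) by simp
qed

text \<open>Rigidity: an edge cannot straddle the end of a parallel edge of coarser level. Equal
  directions fix the vector of \<open>e\<close>, and the lattice places its source at a division
  point of \<open>e'\<close>.\<close>

lemma subedge_of_midpoint:
  assumes e: "e \<in> oriented_edges n" and e': "e' \<in> oriented_edges m" and "m \<le> n"
    and sd: "same_direction e e'" and mid: "midpoint (source e) (target e) \<in> edge_segment e'"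
  obtains k where "k < 2 ^ (n - m)" "e = subedge e' (n - m) k"
proof -
  define h :: real where "h = 1 / 2 ^ (n - m)"
  define V where "V = target e' - source e'"
  have h: "h > 0" and V: "target e - source e = h *\<^sub>R V"
    using same_direction_levels[OF e e' \<open>m \<le> n\<close> sd] by (auto simp: h_def V_def)
  obtain \<tau> where \<tau>: "0 \<le> \<tau>" "\<tau> \<le> 1" "midpoint (source e) (target e) = source e' + \<tau> *\<^sub>R V"
    using mid by (auto simp: edge_segment_def in_segment V_def algebra_simps)
  have se: "source e = source e' + (\<tau> - h / 2) *\<^sub>R V"
  proof -
    have "midpoint (source e) (target e) = source e + (1/2) *\<^sub>R (target e - source e)"
      by (simp add: midpoint_def algebra_simps flip: scaleR_add_left)
    then show ?thesis using \<tau>(3) unfolding V by (simp add: algebra_simps)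
  qed
  have "2 ^ (n - m) * (\<tau> - h / 2) \<in> \<int>"
    by (rule lattice_on_edge[OF e' \<open>m \<le> n\<close> oriented_edges_lattice(1)[OF e]]) (simp add: se V_def)
  then obtain z where z: "2 ^ (n - m) * (\<tau> - h / 2) = of_int z" by (elim Ints_cases)
  \<comment> \<open>The source sits half a step before the midpoint, so
    \<open>0 \<le> \<tau> \<le> 1\<close> leaves a margin of 1/2 and the integer \<open>z\<close>
    falls inside the index range. An endpoint in place of the midpoint would still allow the pieces
    just outside \<open>e'\<close>.\<close>
  then have z': "of_int z = 2 ^ (n - m) * \<tau> - 1 / 2" by (simp add: h_def algebra_simps)
  have "0 \<le> 2 ^ (n - m) * \<tau>" "2 ^ (n - m) * \<tau> \<le> 2 ^ (n - m)" using \<tau> by simp_all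
  then have "real_of_int z > -1" "real_of_int z < 2 ^ (n - m)" unfolding z' by linarith+
  then have z1: "0 \<le> z" "z < 2 ^ (n - m)" by (linarith, metis of_int_less_iff of_int_numeral of_int_power)
  define k where "k = nat z"
  have k: "real k = 2 ^ (n - m) * (\<tau> - h / 2)" using z z1 by (simp add: k_def)
  then have kh: "real k / 2 ^ (n - m) = \<tau> - h / 2" by simp
  have "real (Suc k) / 2 ^ (n - m) = \<tau> + h / 2"
  proof -
    have "real (Suc k) / 2 ^ (n - m) = real k / 2 ^ (n - m) + h" by (simp add: h_def add_divide_distrib)
    then show ?thesis using kh by simp
  qed
  moreover have "target e = source e' + (\<tau> + h / 2) *\<^sub>R V"
  proof -
    have "target e = source e + h *\<^sub>R V" using V by (metis add_diff_cancel_left' diff_add_cancel add.commute)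
    also have "\<dots> = source e' + ((\<tau> - h / 2) + h) *\<^sub>R V" unfolding se by (simp only: scaleR_add_left add.assoc)
    finally show ?thesis by simp
  qed
  ultimately have "e = subedge e' (n - m) k"
    using se kh unfolding prod_eq_iff source_subedge target_subedge by (simp add: V_def)
  moreover have "k < 2 ^ (n - m)" using z1 by (simp add: k_def nat_less_iff)
  ultimately show thesis using that by blast
qed

definition subedges :: "nat \<Rightarrow> oedge \<Rightarrow> oedge set"
  where "subedges j e = subedge e j ` {..<2 ^ j}"

lemma finite_subedges: "finite (subedges j e)"
  by (simp add: subedges_def)

lemma same_direction_subedge: "same_direction (subedge e j k) e"
  unfolding same_direction_def subedge_direction by (rule exI[of _ "2 ^ j"]) simp

lemma edge_segment_subedge:
  assumes "k < 2 ^ j" shows "edge_segment (subedge e j k) \<subseteq> edge_segment e"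
proof -
  have *: "source e + x *\<^sub>R (target e - source e) \<in> closed_segment (source e) (target e)"
    if "0 \<le> x" "x \<le> 1" for x
    using that by (auto simp: in_segment algebra_simps intro!: exI[of _ x])
  have k: "real (Suc k) \<le> 2 ^ j" by (rule real_Suc_le_two_power[OF assms])
  show ?thesis unfolding edge_segment_def source_subedge target_subedge
    using k assms by (intro closed_segment_subset * convex_closed_segment) auto
qed

text \<open>A segment may be covered by several edges of the path jointly, but its midpoint lies in
  one of them, and \<open>subedge_of_midpoint\<close> then puts the whole edge there. This replaces
  the geometric covering condition by finite index sets.\<close>

lemma path_edges_eq:
  assumes lev: "\<And>e'. e' \<in> set \<gamma> \<Longrightarrow> e' \<in> oriented_edges (lev e') \<and> lev e' \<le> n"
  shows "path_edges n \<gamma> = (\<Union>e'\<in>set \<gamma>. subedges (n - lev e') e')"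
proof (intro equalityI subsetI)
  fix e assume e: "e \<in> path_edges n \<gamma>"
  have "midpoint (source e) (target e) \<in> edge_segment e" by (simp add: edge_segment_def)
  then obtain e' where e': "e' \<in> set \<gamma>" "same_direction e e'" "midpoint (source e) (target e) \<in> edge_segment e'"
    using e unfolding path_edges_def by blast
  have "e \<in> oriented_edges n" using e by (simp add: path_edges_def)
  then obtain k where "k < 2 ^ (n - lev e')" "e = subedge e' (n - lev e') k"
    using subedge_of_midpoint[OF _ _ _ e'(2,3)] lev[OF e'(1)] by blast
  then have "e \<in> subedges (n - lev e') e'" by (simp add: subedges_def)
  then show "e \<in> (\<Union>e'\<in>set \<gamma>. subedges (n - lev e') e')" using e'(1) by blast
next
  fix e assume "e \<in> (\<Union>e'\<in>set \<gamma>. subedges (n - lev e') e')"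
  then obtain e' k where e': "e' \<in> set \<gamma>" "k < 2 ^ (n - lev e')" "e = subedge e' (n - lev e') k"
    by (auto simp: subedges_def)
  then have "e \<in> oriented_edges n"
    using subedge_oriented[of e' "lev e'" k "n - lev e'"] lev[OF e'(1)] by simp
  moreover have "edge_segment e \<subseteq> edge_segment e'" "same_direction e e'"
    using e' edge_segment_subedge same_direction_subedge by auto
  ultimately show "e \<in> path_edges n \<gamma>" using e'(1) unfolding path_edges_def by blast
qed

lemma path_edges_edge: "e \<in> oriented_edges m \<Longrightarrow> path_edges (m + j) [e] = subedges j e"
  by (subst path_edges_eq[of _ "\<lambda>_. m"]) auto

lemma path_edges_subset: "path_edges n \<gamma> \<subseteq> oriented_edges n"
  by (auto simp: path_edges_def)

lemma subedges_subedges: "subedges (i + j) e = (\<Union>d\<in>subedges i e. subedges j d)"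
proof (intro equalityI subsetI)
  fix d assume "d \<in> subedges (i + j) e"
  then obtain k where k: "k < 2 ^ (i + j)" "d = subedge e (i + j) k" by (auto simp: subedges_def)
  then have "d = subedge (subedge e i (k div 2 ^ j)) j (k mod 2 ^ j)" by (simp only: subedge_subedge div_mult_mod_eq)
  moreover have "k div 2 ^ j < 2 ^ i" using k(1) by (simp add: less_mult_imp_div_less power_add)
  moreover have "k mod 2 ^ j < 2 ^ j" by simp
  ultimately show "d \<in> (\<Union>d\<in>subedges i e. subedges j d)" unfolding subedges_def by blast
next
  fix d assume "d \<in> (\<Union>d\<in>subedges i e. subedges j d)"
  then obtain k l where kl: "k < 2 ^ i" "l < 2 ^ j" "d = subedge e (i + j) (k * 2 ^ j + l)"
    by (auto simp: subedges_def subedge_subedge)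
  have "k * 2 ^ j + l < Suc k * 2 ^ j" using kl(2) by simp
  also have "\<dots> \<le> 2 ^ i * 2 ^ j" using kl(1) by (intro mult_right_mono) auto
  finally show "d \<in> subedges (i + j) e" using kl(3) by (auto simp: subedges_def power_add)
qed

lemma elementary_path_levels:
  assumes "elementary_path \<gamma>"
  obtains lev N where "\<And>e. e \<in> set \<gamma> \<Longrightarrow> e \<in> oriented_edges (lev e) \<and> lev e \<le> N"
proof -
  have "\<forall>e\<in>set \<gamma>. \<exists>m. e \<in> oriented_edges m"
    using assms by (auto simp: elementary_path_def all_oriented_edges_def)
  then obtain lev where lev: "\<forall>e\<in>set \<gamma>. e \<in> oriented_edges (lev e)" by metis
  show thesis
    by (rule that[of lev "Max (lev ` set \<gamma>)"]) (use lev in auto)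
qed

text \<open>Past a common level \<open>N\<close> all edge sets arise by subdividing the fixed finite
  set \<open>path_edges N \<gamma>\<close>, which reduces limits along a path to limits on single
  edges.\<close>

lemma path_edges_refine:
  assumes lev: "\<And>e. e \<in> set \<gamma> \<Longrightarrow> e \<in> oriented_edges (lev e) \<and> lev e \<le> N"
  shows "path_edges (N + j) \<gamma> = (\<Union>d\<in>path_edges N \<gamma>. subedges j d)"
proof -
  have "path_edges (N + j) \<gamma> = (\<Union>e\<in>set \<gamma>. subedges (N + j - lev e) e)"
    using lev by (intro path_edges_eq) (auto intro: trans_le_add1)
  also have "\<dots> = (\<Union>e\<in>set \<gamma>. subedges (N - lev e + j) e)" using lev by (intro SUP_cong) auto
  also have "\<dots> = (\<Union>d\<in>(\<Union>e\<in>set \<gamma>. subedges (N - lev e) e). subedges j d)"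
    by (simp add: subedges_subedges)
  also have "(\<Union>e\<in>set \<gamma>. subedges (N - lev e) e) = path_edges N \<gamma>"
    using lev by (intro path_edges_eq[symmetric]) auto
  finally show ?thesis .
qed

text \<open>A common piece forces equal vectors, and sources that differ by
  \<open>(k - k') / 2 ^ j\<close> times this vector. That factor is an integer by the lattice and
  less than 1 in modulus, hence 0.\<close>

lemma subedges_disjoint:
  assumes e: "e \<in> oriented_edges n" "e' \<in> oriented_edges n" and "e \<noteq> e'"
  shows "subedges j e \<inter> subedges j e' = {}"
proof (rule ccontr)
  assume "subedges j e \<inter> subedges j e' \<noteq> {}"
  then obtain k k' where k: "k < 2 ^ j" "k' < 2 ^ j" and eq: "subedge e j k = subedge e' j k'"
    by (fastforce simp: subedges_def)
  define V where "V = target e - source e"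
  have V: "target e' - source e' = V"
    using arg_cong[OF eq, of "\<lambda>d. target d - source d"] by (simp add: subedge_direction V_def)
  have "source e' = source e + ((real k - real k') / 2 ^ j) *\<^sub>R V"
    using arg_cong[OF eq, of source] V
    by (simp add: source_subedge V_def[symmetric] diff_divide_distrib algebra_simps)
  from lattice_on_edge[OF e(1) order_refl oriented_edges_lattice(1)[OF e(2)], folded V_def, OF this]
  have I: "(real k - real k') / 2 ^ j \<in> \<int>" by simp
  have "real k < 2 ^ j" "real k' < 2 ^ j" using k by simp_all
  then have "\<bar>real k - real k'\<bar> < 2 ^ j" by linarith
  then have "\<bar>(real k - real k') / 2 ^ j\<bar> < 1" by simp
  with I have "(real k - real k') / 2 ^ j = 0" using Ints_nonzero_abs_less1 by blast
  with \<open>source e' = _\<close> have "source e' = source e" by simp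
  moreover have "target e' = target e" using V \<open>source e' = source e\<close> by (simp add: V_def)
  ultimately show False using \<open>e \<noteq> e'\<close> by (simp add: prod_eq_iff)
qed

lemma finite_oriented_edges: "finite (oriented_edges n)"
  by (simp add: oriented_edges_def finite_edges)

lemma sum_subedges_UN:
  fixes \<phi> :: "oedge \<Rightarrow> 'a::comm_monoid_add"
  assumes "A \<subseteq> oriented_edges n"
  shows "(\<Sum>d\<in>(\<Union>e\<in>A. subedges j e). \<phi> d) = (\<Sum>e\<in>A. \<Sum>d\<in>subedges j e. \<phi> d)"
proof (rule sum.UNION_disjoint)
  show "finite A" using assms finite_oriented_edges finite_subset by blast
qed (use assms subedges_disjoint finite_subedges in blast)+

lemma sum_subedges:
  fixes \<phi> :: "oedge \<Rightarrow> 'a::comm_monoid_add"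
  assumes "source e \<noteq> target e"
  shows "(\<Sum>d\<in>subedges j e. \<phi> d) = (\<Sum>k<2 ^ j. \<phi> (subedge e j k))"
  unfolding subedges_def
proof (rule sum.reindex_cong[OF _ refl refl])
  show "inj_on (subedge e j) {..<2 ^ j}"
    using assms by (auto intro!: inj_onI simp: subedge_def)
qed

section \<open>Convergence of the integral\<close>

lemma formal_zero: "formal_lmult h 0 = 0" "formal_rmult 0 h = 0" "formal_pair e 0 = 0"
  by (simp_all add: formal_lmult_def formal_rmult_def formal_pair_def extend_def)

lemma formal_add:
  "formal_lmult h (s + t) = formal_lmult h s + formal_lmult h t"
  "formal_rmult (s + t) h = formal_rmult s h + formal_rmult t h"
  "formal_pair e (s + t) = formal_pair e s + formal_pair e t"
  using formal_diff(1)[of h "s + t" t] formal_diff(2)[of "s + t" t h] formal_diff(3)[of e "s + t" t]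
  by simp_all

lemma poly_mapping_add_induct [case_names zero single add]:
  fixes P :: "('k \<Rightarrow>\<^sub>0 'c::comm_monoid_add) \<Rightarrow> bool"
  assumes zero: "P 0" and single: "\<And>k c. P (Poly_Mapping.single k c)"
    and add: "\<And>s t. P s \<Longrightarrow> P t \<Longrightarrow> P (s + t)"
  shows "P t"
proof -
  have "P (\<Sum>k\<in>A. Poly_Mapping.single k (Poly_Mapping.lookup t k))" if "finite A" for A
    using that by (induction A rule: finite_induct) (auto intro: assms)
  moreover have "(\<Sum>k\<in>Poly_Mapping.keys t. Poly_Mapping.single k (Poly_Mapping.lookup t k)) = t"
    by (rule poly_mapping_eqI) (auto simp: lookup_sum lookup_single when_def in_keys_iff)
  ultimately show ?thesis using finite_keys[of t] by metis
qed

lemma formal_pair_mult: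
  "formal_pair e (formal_lmult h t) = fe_apply h (target e) * formal_pair e t"
  "formal_pair e (formal_rmult t h) = formal_pair e t * fe_apply h (source e)"
  by (induction t rule: poly_mapping_add_induct;
      auto simp: formal_zero formal_add formal_single times_fe.rep_eq algebra_simps)+

lemma pairing_lmult: "pairing (h \<cdot>\<^sub>L \<omega>) e = fe_apply h (target e) * pairing \<omega> e"
  and pairing_rmult: "pairing (\<omega> \<cdot>\<^sub>R h) e = pairing \<omega> e * fe_apply h (source e)"
  and pairing_add: "pairing (\<omega> + \<eta>) e = pairing \<omega> e + pairing \<eta> e"
  and pairing_zero: "pairing 0 e = 0"
  by (transfer; simp add: formal_pair_mult formal_add formal_zero)+

lemma fe_apply_one: "fe_apply 1 x = (if x \<in> gasket then 1 else 0)"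
  by (simp add: one_fe.rep_eq)

text \<open>The unit of \<open>fe\<close> is the indicator of the gasket, so the term
  \<open>(f * g) \<otimes>\<^sub>F 1\<close> has the expected value when the source lies
  there.\<close>

lemma pairing_form:
  "source e \<in> gasket \<Longrightarrow> pairing (f \<cdot>\<^sub>L der g) e =
    fe_apply f (target e) * (fe_apply g (target e) - fe_apply g (source e))"
  by (simp add: lmult_der pairing_diff pairing_pure times_fe.rep_eq fe_apply_one algebra_simps)

lemma fe_bounded: "\<exists>M\<ge>0. \<forall>x. cmod (fe_apply f x) \<le> M"
proof -
  have f: "finite_energy (fe_apply f)" using fe_apply[of f] by simp
  then obtain M where "\<And>x. x \<in> gasket \<Longrightarrow> cmod (fe_apply f x) \<le> M"
    by (rule finite_energy_bounded) blast
  then have "cmod (fe_apply f x) \<le> \<bar>M\<bar>" for x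
    using f abs_ge_self[of M] abs_ge_zero[of M] unfolding finite_energy_def
    by (metis norm_zero order_trans)
  then show ?thesis by (intro exI[of _ "\<bar>M\<bar>"]) simp
qed

section \<open>Edge functions with controlled defect of additivity\<close>

definition sqdiff :: "fe \<Rightarrow> oedge \<Rightarrow> real"
  where "sqdiff f e = (cmod (fe_apply f (target e) - fe_apply f (source e)))\<^sup>2"

text \<open>The rate 3/5 is the inverse of the renormalisation factor of the energy. Summing over
  both orientations costs a factor 2 and covers paths running either way.\<close>

definition decaying :: "(oedge \<Rightarrow> real) \<Rightarrow> bool"
  where "decaying \<mu> \<longleftrightarrow> (\<forall>e. 0 \<le> \<mu> e) \<and>
    (\<exists>K. \<forall>n. (\<Sum>e\<in>oriented_edges n. \<mu> e) \<le> K * (3/5) ^ n)"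

lemma decayingE:
  assumes "decaying \<mu>"
  obtains K where "K \<ge> 0" "\<And>n. (\<Sum>e\<in>oriented_edges n. \<mu> e) \<le> K * (3/5) ^ n"
proof -
  obtain K where K: "\<And>n. (\<Sum>e\<in>oriented_edges n. \<mu> e) \<le> K * (3/5) ^ n"
    using assms by (auto simp: decaying_def)
  have "0 \<le> (\<Sum>e\<in>oriented_edges 0. \<mu> e)" using assms by (auto simp: decaying_def intro: sum_nonneg)
  also have "\<dots> \<le> K" using K[of 0] by simp
  finally show ?thesis using K that by blast
qed

lemma decaying_nonneg: "decaying \<mu> \<Longrightarrow> 0 \<le> \<mu> e"
  unfolding decaying_def by blast

lemma decaying_lincomb:
  assumes "decaying \<mu>" "decaying \<nu>" "0 \<le> a" "0 \<le> b"
  shows "decaying (\<lambda>e. a * \<mu> e + b * \<nu> e)"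
proof -
  obtain K where K: "\<And>n. (\<Sum>e\<in>oriented_edges n. \<mu> e) \<le> K * (3/5) ^ n" using decayingE[OF assms(1)] by blast
  obtain L where L: "\<And>n. (\<Sum>e\<in>oriented_edges n. \<nu> e) \<le> L * (3/5) ^ n" using decayingE[OF assms(2)] by blast
  have "(\<Sum>e\<in>oriented_edges n. a * \<mu> e + b * \<nu> e) \<le> (a * K + b * L) * (3/5) ^ n" for n
  proof -
    have "(\<Sum>e\<in>oriented_edges n. a * \<mu> e + b * \<nu> e)
        = a * (\<Sum>e\<in>oriented_edges n. \<mu> e) + b * (\<Sum>e\<in>oriented_edges n. \<nu> e)"
      by (simp add: sum.distrib sum_distrib_left)
    also have "\<dots> \<le> a * (K * (3/5) ^ n) + b * (L * (3/5) ^ n)"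
      using K L assms by (intro add_mono mult_left_mono) auto
    finally show ?thesis by (simp add: algebra_simps)
  qed
  moreover have "\<forall>e. 0 \<le> a * \<mu> e + b * \<nu> e" using assms by (simp add: decaying_def)
  ultimately show ?thesis unfolding decaying_def by blast
qed

lemma decaying_sqdiff: "decaying (sqdiff f)"
proof -
  have "energy (fe_apply f) < \<infinity>" using fe_apply[of f] by (simp add: finite_energy_def)
  then obtain C where C: "\<And>m. (5/3) ^ m * edge_energy m (fe_apply f) \<le> C"
    unfolding energy_finite_iff by blast
  have "(\<Sum>e\<in>oriented_edges n. sqdiff f e) \<le> 2 * C * (3/5) ^ n" for n
  proof -
    have "(\<Sum>e\<in>oriented_edges n. sqdiff f e) \<le> (\<Sum>e\<in>edges n. sqdiff f e) + (\<Sum>e\<in>prod.swap ` edges n. sqdiff f e)"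
      unfolding oriented_edges_def
      by (simp add: sum_Un finite_edges sum_nonneg sqdiff_def)
    also have "(\<Sum>e\<in>prod.swap ` edges n. sqdiff f e) = (\<Sum>e\<in>edges n. sqdiff f e)"
      by (subst sum.reindex) (auto simp: sqdiff_def norm_minus_commute)
    also have "(\<Sum>e\<in>edges n. sqdiff f e) = edge_energy n (fe_apply f)"
      by (simp add: edge_energy_def sqdiff_def)
    also have "edge_energy n (fe_apply f) \<le> C * (3/5) ^ n"
      using C[of n] by (simp add: power_divide field_simps)
    finally show ?thesis by simp
  qed
  then show ?thesis unfolding decaying_def sqdiff_def by auto
qed

text \<open>The second condition bounds the defect of additivity under subdivision of an edge. The
  first one is what makes it stable under multiplication by functions.\<close>

definition controlled :: "(oedge \<Rightarrow> real) \<Rightarrow> (oedge \<Rightarrow> complex) \<Rightarrow> bool"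
  where "controlled \<mu> \<phi> \<longleftrightarrow>
    (\<forall>a\<in>gasket. \<forall>b\<in>gasket. (cmod (\<phi> (a, b)))\<^sup>2 \<le> \<mu> (a, b)) \<and>
    (\<forall>a\<in>gasket. \<forall>y\<in>gasket. \<forall>b\<in>gasket.
      cmod (\<phi> (a, y) + \<phi> (y, b) - \<phi> (a, b)) \<le> \<mu> (a, y) + \<mu> (y, b))"

text \<open>Passing through \<open>y\<close> changes the value by minus the increment of
  \<open>f\<close> from \<open>y\<close> to \<open>b\<close> times the increment of \<open>g\<close>
  from \<open>a\<close> to \<open>y\<close>: a product of two increments.\<close>

lemma controlled_form: "\<exists>\<mu>. decaying \<mu> \<and> controlled \<mu> (pairing (f \<cdot>\<^sub>L der g))"
proof -
  obtain M where M: "M \<ge> 0" "\<And>x. cmod (fe_apply f x) \<le> M" using fe_bounded by blast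
  \<comment> \<open>The part \<open>M\<^sup>2\<close> serves the bound on squares, where
    \<open>f\<close> is only known to be bounded; the rest absorbs the product of
    increments.\<close>
  define \<mu> where "\<mu> e = 1 * sqdiff f e + (M\<^sup>2 + 1) * sqdiff g e" for e
  have "decaying \<mu>" unfolding \<mu>_def by (intro decaying_lincomb decaying_sqdiff) auto
  moreover have "(cmod (pairing (f \<cdot>\<^sub>L der g) (a, b)))\<^sup>2 \<le> \<mu> (a, b)" if "a \<in> gasket" for a b
  proof -
    have "(cmod (pairing (f \<cdot>\<^sub>L der g) (a, b)))\<^sup>2 = (cmod (fe_apply f b))\<^sup>2 * sqdiff g (a, b)"
      using that by (simp add: pairing_form norm_mult power_mult_distrib sqdiff_def)
    also have "\<dots> \<le> M\<^sup>2 * sqdiff g (a, b)"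
      using M by (intro mult_right_mono power_mono) (auto simp: sqdiff_def)
    also have "\<dots> \<le> \<mu> (a, b)" by (simp add: \<mu>_def algebra_simps sqdiff_def)
    finally show ?thesis .
  qed
  moreover have "cmod (pairing (f \<cdot>\<^sub>L der g) (a, y) + pairing (f \<cdot>\<^sub>L der g) (y, b) - pairing (f \<cdot>\<^sub>L der g) (a, b))
      \<le> \<mu> (a, y) + \<mu> (y, b)" if "a \<in> gasket" "y \<in> gasket" for a y b
  proof -
    have "pairing (f \<cdot>\<^sub>L der g) (a, y) + pairing (f \<cdot>\<^sub>L der g) (y, b) - pairing (f \<cdot>\<^sub>L der g) (a, b)
        = - (fe_apply f b - fe_apply f y) * (fe_apply g y - fe_apply g a)"
      using that by (simp add: pairing_form algebra_simps)
    also have "cmod \<dots> \<le> (sqdiff f (y, b) + sqdiff g (a, y)) / 2"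
      using mult_le_half_squares by (simp add: norm_mult norm_minus_commute sqdiff_def)
    also have "\<dots> \<le> \<mu> (a, y) + \<mu> (y, b)"
    proof -
      have "0 \<le> sqdiff h e" "0 \<le> M\<^sup>2 * sqdiff h e" for h e by (simp_all add: sqdiff_def)
      from this(1)[of f "(a, y)"] this(1)[of f "(y, b)"] this(1)[of g "(a, y)"] this(1)[of g "(y, b)"]
        this(2)[of g "(a, y)"] this(2)[of g "(y, b)"]
      show ?thesis unfolding \<mu>_def by (simp add: algebra_simps)
    qed
    finally show ?thesis .
  qed
  ultimately show ?thesis unfolding controlled_def by blast
qed

lemma controlled_add:
  assumes "decaying \<mu>" "decaying \<nu>" "controlled \<mu> \<phi>" "controlled \<nu> \<psi>"
  shows "controlled (\<lambda>e. 2 * \<mu> e + 2 * \<nu> e) (\<lambda>e. \<phi> e + \<psi> e)"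
  unfolding controlled_def
proof (intro conjI ballI)
  fix a b assume ab: "a \<in> gasket" "b \<in> gasket"
  have "(cmod (\<phi> (a, b) + \<psi> (a, b)))\<^sup>2 \<le> 2 * (cmod (\<phi> (a, b)))\<^sup>2 + 2 * (cmod (\<psi> (a, b)))\<^sup>2"
    by (rule norm_sum_squared_le)
  also have "\<dots> \<le> 2 * \<mu> (a, b) + 2 * \<nu> (a, b)"
    using ab assms(3,4) by (intro add_mono mult_left_mono) (auto simp: controlled_def)
  finally show "(cmod (\<phi> (a, b) + \<psi> (a, b)))\<^sup>2 \<le> 2 * \<mu> (a, b) + 2 * \<nu> (a, b)" .
next
  fix a y b assume ab: "a \<in> gasket" "y \<in> gasket" "b \<in> gasket"
  have "\<phi> (a, y) + \<psi> (a, y) + (\<phi> (y, b) + \<psi> (y, b)) - (\<phi> (a, b) + \<psi> (a, b))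
     = (\<phi> (a, y) + \<phi> (y, b) - \<phi> (a, b)) + (\<psi> (a, y) + \<psi> (y, b) - \<psi> (a, b))" by simp
  also have "cmod \<dots> \<le> (\<mu> (a, y) + \<mu> (y, b)) + (\<nu> (a, y) + \<nu> (y, b))"
    using ab assms(3,4) by (intro order_trans[OF norm_triangle_ineq] add_mono) (auto simp: controlled_def)
  also have "\<dots> \<le> 2 * \<mu> (a, y) + 2 * \<nu> (a, y) + (2 * \<mu> (y, b) + 2 * \<nu> (y, b))"
    using decaying_nonneg[OF assms(1), of "(a, y)"] decaying_nonneg[OF assms(1), of "(y, b)"]
      decaying_nonneg[OF assms(2), of "(a, y)"] decaying_nonneg[OF assms(2), of "(y, b)"] by linarith
  finally show "cmod (\<phi> (a, y) + \<psi> (a, y) + (\<phi> (y, b) + \<psi> (y, b)) - (\<phi> (a, b) + \<psi> (a, b)))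
    \<le> 2 * \<mu> (a, y) + 2 * \<nu> (a, y) + (2 * \<mu> (y, b) + 2 * \<nu> (y, b))" .
qed

text \<open>A discrete Leibniz rule: multiplication by \<open>h\<close> at one end turns a defect
  \<open>D\<close> into a value of \<open>h\<close> times \<open>D\<close>, plus an increment of
  \<open>h\<close> times a value of \<open>\<phi>\<close>.\<close>

lemma controlled_mult:
  assumes "decaying \<mu>" "controlled \<mu> \<phi>"
    and \<psi>: "(\<forall>e. \<psi> e = fe_apply h (target e) * \<phi> e) \<or> (\<forall>e. \<psi> e = \<phi> e * fe_apply h (source e))"
  shows "\<exists>\<nu>. decaying \<nu> \<and> controlled \<nu> \<psi>"
proof -
  obtain M where M: "M \<ge> 0" "\<And>x. cmod (fe_apply h x) \<le> M" using fe_bounded by blast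
  \<comment> \<open>\<open>M\<^sup>2\<close> pays for the squares of \<open>\<psi>\<close>,
    \<open>M\<close> for the multiplied defect, and the remaining unit together with
    \<open>sqdiff h\<close> for the cross term.\<close>
  define \<nu> where "\<nu> e = (M\<^sup>2 + M + 1) * \<mu> e + 1 * sqdiff h e" for e
  note nn = decaying_nonneg[OF assms(1)]
  have M2: "0 \<le> M\<^sup>2 * \<mu> e" "0 \<le> M * \<mu> e" "0 \<le> \<mu> e" "0 \<le> sqdiff h e" for e
    using M(1) nn by (simp_all add: sqdiff_def)
  have "decaying \<nu>" unfolding \<nu>_def using M by (intro decaying_lincomb decaying_sqdiff assms) auto
  moreover have "(cmod (\<psi> (a, b)))\<^sup>2 \<le> \<nu> (a, b)" if "a \<in> gasket" "b \<in> gasket" for a b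
  proof -
    have "cmod (\<psi> (a, b)) \<le> M * cmod (\<phi> (a, b))"
    proof -
      have "\<psi> (a, b) = fe_apply h b * \<phi> (a, b) \<or> \<psi> (a, b) = fe_apply h a * \<phi> (a, b)"
        using \<psi> by (metis fst_conv snd_conv mult.commute)
      then show ?thesis using M(2)[of a] M(2)[of b] by (elim disjE) (simp_all add: norm_mult mult_right_mono)
    qed
    then have "(cmod (\<psi> (a, b)))\<^sup>2 \<le> (M * cmod (\<phi> (a, b)))\<^sup>2" by (intro power_mono) auto
    also have "\<dots> \<le> M\<^sup>2 * \<mu> (a, b)" unfolding power_mult_distrib
      using assms(2) that by (intro mult_left_mono) (auto simp: controlled_def)
    also have "\<dots> \<le> \<nu> (a, b)"
      using M2[of "(a, b)"] by (simp add: \<nu>_def algebra_simps)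
    finally show ?thesis .
  qed
  moreover have "cmod (\<psi> (a, y) + \<psi> (y, b) - \<psi> (a, b)) \<le> \<nu> (a, y) + \<nu> (y, b)"
    if g: "a \<in> gasket" "y \<in> gasket" "b \<in> gasket" for a y b
  proof -
    define D where "D = \<phi> (a, y) + \<phi> (y, b) - \<phi> (a, b)"
    have D: "cmod D \<le> \<mu> (a, y) + \<mu> (y, b)" using assms(2) g by (auto simp: controlled_def D_def)
    have \<phi>: "(cmod (\<phi> (a, y)))\<^sup>2 \<le> \<mu> (a, y)" "(cmod (\<phi> (y, b)))\<^sup>2 \<le> \<mu> (y, b)"
      using assms(2) g by (auto simp: controlled_def)
    \<comment> \<open>Both sides lead to this shape: \<open>c\<close> is the shared target
      \<open>b\<close> for left multiplication and the shared source \<open>a\<close> for right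
      multiplication.\<close>
    have "\<exists>c R. \<psi> (a, y) + \<psi> (y, b) - \<psi> (a, b) = fe_apply h c * D + R \<and>
      cmod R \<le> (\<mu> (a, y) + \<mu> (y, b) + sqdiff h (a, y) + sqdiff h (y, b)) / 2"
      using \<psi>
    proof
      assume "\<forall>e. \<psi> e = fe_apply h (target e) * \<phi> e"
      then have *: "\<psi> (p, q) = fe_apply h q * \<phi> (p, q)" for p q by (metis snd_conv)
      have "\<psi> (a, y) + \<psi> (y, b) - \<psi> (a, b) =
          fe_apply h b * D + - ((fe_apply h b - fe_apply h y) * \<phi> (a, y))"
        by (simp add: * D_def algebra_simps)
      moreover have "cmod (- ((fe_apply h b - fe_apply h y) * \<phi> (a, y))) \<le>
          (sqdiff h (y, b) + \<mu> (a, y)) / 2"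
        using mult_le_half_squares[of "cmod (fe_apply h b - fe_apply h y)" "cmod (\<phi> (a, y))"] \<phi>
        by (simp add: norm_mult sqdiff_def)
      ultimately show ?thesis using M2[of "(a, y)"] M2[of "(y, b)"]
        by (intro exI[of _ b] exI[of _ "- ((fe_apply h b - fe_apply h y) * \<phi> (a, y))"]) simp
    next
      assume "\<forall>e. \<psi> e = \<phi> e * fe_apply h (source e)"
      then have *: "\<psi> (p, q) = \<phi> (p, q) * fe_apply h p" for p q by (metis fst_conv)
      have "\<psi> (a, y) + \<psi> (y, b) - \<psi> (a, b) =
          fe_apply h a * D + (fe_apply h y - fe_apply h a) * \<phi> (y, b)"
        by (simp add: * D_def algebra_simps)
      moreover have "cmod ((fe_apply h y - fe_apply h a) * \<phi> (y, b)) \<le>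
          (sqdiff h (a, y) + \<mu> (y, b)) / 2"
        using mult_le_half_squares[of "cmod (fe_apply h y - fe_apply h a)" "cmod (\<phi> (y, b))"] \<phi>
        by (simp add: norm_mult sqdiff_def)
      ultimately show ?thesis using M2[of "(a, y)"] M2[of "(y, b)"]
        by (intro exI[of _ a] exI[of _ "(fe_apply h y - fe_apply h a) * \<phi> (y, b)"]) simp
    qed
    then obtain c R where cR: "\<psi> (a, y) + \<psi> (y, b) - \<psi> (a, b) = fe_apply h c * D + R"
      "cmod R \<le> (\<mu> (a, y) + \<mu> (y, b) + sqdiff h (a, y) + sqdiff h (y, b)) / 2" by blast
    have "cmod (fe_apply h c * D) \<le> M * (\<mu> (a, y) + \<mu> (y, b))"
      unfolding norm_mult using M D by (intro mult_mono) auto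
    then have "cmod (\<psi> (a, y) + \<psi> (y, b) - \<psi> (a, b)) \<le> M * (\<mu> (a, y) + \<mu> (y, b)) +
        (\<mu> (a, y) + \<mu> (y, b) + sqdiff h (a, y) + sqdiff h (y, b)) / 2"
      unfolding cR(1) using cR(2) norm_triangle_ineq[of "fe_apply h c * D" R] by linarith
    also have "\<dots> \<le> \<nu> (a, y) + \<nu> (y, b)"
      using M2[of "(a, y)"] M2[of "(y, b)"] by (simp add: \<nu>_def algebra_simps)
    finally show ?thesis .
  qed
  ultimately show ?thesis unfolding controlled_def by blast
qed

lemma controlled_pairing:
  assumes "\<omega> \<in> Omega1"
  shows "\<exists>\<mu>. decaying \<mu> \<and> controlled \<mu> (pairing \<omega>)"
  using assms
proof induction
  case (form f g) show ?case by (rule controlled_form)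
next
  case zero
  have "decaying (\<lambda>_. 0)" by (auto simp: decaying_def intro!: exI[of _ 0])
  then show ?case by (auto simp: controlled_def pairing_zero)
next
  case (add \<omega> \<eta>)
  then obtain \<mu> \<nu> where "decaying \<mu>" "controlled \<mu> (pairing \<omega>)" "decaying \<nu>" "controlled \<nu> (pairing \<eta>)"
    by blast
  then have "decaying (\<lambda>e. 2 * \<mu> e + 2 * \<nu> e)" "controlled (\<lambda>e. 2 * \<mu> e + 2 * \<nu> e) (pairing (\<omega> + \<eta>))"
    using controlled_add[of \<mu> \<nu> "pairing \<omega>" "pairing \<eta>"]
    by (auto simp: pairing_add[abs_def] intro: decaying_lincomb)
  then show ?case by blast
next
  case (lmult \<omega> h)
  then show ?case using controlled_mult[of _ "pairing \<omega>" "pairing (h \<cdot>\<^sub>L \<omega>)" h] pairing_lmult by blast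
next
  case (rmult \<omega> h)
  then show ?case using controlled_mult[of _ "pairing \<omega>" "pairing (\<omega> \<cdot>\<^sub>R h)" h] pairing_rmult by blast
qed

text \<open>With the finer edges grouped in pairs, the change between consecutive levels is the sum
  of the defects of additivity at the inserted midpoints.\<close>

lemma subdivision_step:
  assumes c: "controlled \<mu> \<phi>" and e: "e \<in> oriented_edges n"
  shows "cmod ((\<Sum>d\<in>subedges (Suc j) e. \<phi> d) - (\<Sum>d\<in>subedges j e. \<phi> d)) \<le> (\<Sum>d\<in>subedges (Suc j) e. \<mu> d)"
proof -
  have ne: "source e \<noteq> target e" using oriented_edges_lattice(7)[OF e] .
  have children: "\<exists>a y b. subedge e j k = (a, b) \<and> subedge e (Suc j) (2 * k) = (a, y) \<and>
      subedge e (Suc j) (2 * k + 1) = (y, b)" for k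
    by (auto simp: subedge_def add_divide_distrib)
  have "cmod ((\<Sum>d\<in>subedges (Suc j) e. \<phi> d) - (\<Sum>d\<in>subedges j e. \<phi> d)) =
      cmod (\<Sum>k<2 ^ j. \<phi> (subedge e (Suc j) (2 * k)) + \<phi> (subedge e (Suc j) (2 * k + 1)) - \<phi> (subedge e j k))"
    unfolding sum_subedges[OF ne] sum_two_power_Suc sum_subtractf ..
  also have "\<dots> \<le> (\<Sum>k<2 ^ j. \<mu> (subedge e (Suc j) (2 * k)) + \<mu> (subedge e (Suc j) (2 * k + 1)))"
  proof (rule sum_norm_le)
    fix k :: nat assume "k \<in> {..<2 ^ j}"
    then have "2 * k < 2 ^ Suc j" "2 * k + 1 < 2 ^ Suc j" by auto
    from this[THEN subedge_oriented[OF e]] obtain a y b where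
      "subedge e j k = (a, b)" "subedge e (Suc j) (2 * k) = (a, y)" "subedge e (Suc j) (2 * k + 1) = (y, b)"
      and "(a, y) \<in> oriented_edges (n + Suc j)" "(y, b) \<in> oriented_edges (n + Suc j)"
      using children[of k] by auto
    moreover from this have "a \<in> gasket" "y \<in> gasket" "b \<in> gasket"
      using oriented_edges_lattice(5,6) by fastforce+
    ultimately show "cmod (\<phi> (subedge e (Suc j) (2 * k)) + \<phi> (subedge e (Suc j) (2 * k + 1)) - \<phi> (subedge e j k))
        \<le> \<mu> (subedge e (Suc j) (2 * k)) + \<mu> (subedge e (Suc j) (2 * k + 1))"
      using c by (simp add: controlled_def)
  qed
  also have "\<dots> = (\<Sum>d\<in>subedges (Suc j) e. \<mu> d)" unfolding sum_subedges[OF ne] sum_two_power_Suc ..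
  finally show ?thesis .
qed

lemma sum_subedges_le:
  assumes A: "A \<subseteq> oriented_edges n" and \<mu>: "\<And>e. 0 \<le> \<mu> e"
  shows "(\<Sum>e\<in>A. \<Sum>d\<in>subedges j e. \<mu> d) \<le> (\<Sum>e\<in>oriented_edges (n + j). \<mu> e :: real)"
  unfolding sum_subedges_UN[OF A, symmetric]
  using A subedge_oriented by (intro sum_mono2 finite_oriented_edges \<mu>) (auto simp: subedges_def)

lemma subdivision_sums_convergent:
  assumes d: "decaying \<mu>" and c: "controlled \<mu> \<phi>" and e: "e \<in> oriented_edges n"
  shows "convergent (\<lambda>j. \<Sum>d\<in>subedges j e. \<phi> d)"
proof -
  obtain K where K: "K \<ge> 0" "\<And>n. (\<Sum>e\<in>oriented_edges n. \<mu> e) \<le> K * (3/5) ^ n" using decayingE[OF d] by blast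
  let ?R = "\<lambda>j. \<Sum>d\<in>subedges j e. \<phi> d"
  have "summable (\<lambda>j. ?R (Suc j) - ?R j)"
  proof (rule summable_comparison_test'[of "\<lambda>j. K * (3/5) ^ j" 0])
    show "summable (\<lambda>j. K * (3/5) ^ j)" by (intro summable_mult summable_geometric) simp
    fix j
    have "cmod (?R (Suc j) - ?R j) \<le> (\<Sum>d\<in>subedges (Suc j) e. \<mu> d)" by (rule subdivision_step[OF c e])
    also have "\<dots> \<le> (\<Sum>d\<in>oriented_edges (n + Suc j). \<mu> d)"
      using sum_subedges_le[of "{e}" n \<mu> "Suc j"] e decaying_nonneg[OF d] by simp
    also have "\<dots> \<le> K * (3/5) ^ (n + Suc j)" by (rule K)
    also have "\<dots> \<le> K * (3/5) ^ j" using K(1) by (intro mult_left_mono power_decreasing) auto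
    finally show "cmod (?R (Suc j) - ?R j) \<le> K * (3/5) ^ j" .
  qed
  then have "convergent (\<lambda>j. ?R j - ?R 0)"
    unfolding summable_iff_convergent sum_lessThan_telescope[of ?R] .
  then show ?thesis unfolding convergent_diff_const_right_iff .
qed

text \<open>The errors are summed over all edges of level \<open>n\<close> at once. The defects at
  depth \<open>i\<close> cost at most the total weight at level \<open>n + i + 1\<close>, and the
  geometric series makes the bound uniform in \<open>j\<close>, so that \<open>j\<close> may later
  tend to infinity.\<close>

lemma subdivision_sums_error:
  assumes d: "decaying \<mu>" and c: "controlled \<mu> \<phi>"
  obtains K where "\<And>n j. (\<Sum>e\<in>oriented_edges n. cmod ((\<Sum>d\<in>subedges j e. \<phi> d) - \<phi> e)) \<le> K * (3/5) ^ n"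
proof -
  obtain K where K: "K \<ge> 0" "\<And>n. (\<Sum>e\<in>oriented_edges n. \<mu> e) \<le> K * (3/5) ^ n" using decayingE[OF d] by blast
  let ?R = "\<lambda>j e. \<Sum>d\<in>subedges j e. \<phi> d"
  have "(\<Sum>e\<in>oriented_edges n. cmod (?R j e - \<phi> e)) \<le> (\<Sum>i<j. K * (3/5) ^ (n + Suc i))" for n j
  proof (induction j)
    case 0
    have "?R 0 e = \<phi> e" for e by (simp add: subedges_def subedge_0 lessThan_Suc)
    then show ?case by simp
  next
    case (Suc j)
    have "(\<Sum>e\<in>oriented_edges n. cmod (?R (Suc j) e - \<phi> e)) \<le>
        (\<Sum>e\<in>oriented_edges n. cmod (?R j e - \<phi> e) + (\<Sum>d\<in>subedges (Suc j) e. \<mu> d))"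
    proof (rule sum_mono)
      fix e assume e: "e \<in> oriented_edges n"
      show "cmod (?R (Suc j) e - \<phi> e) \<le> cmod (?R j e - \<phi> e) + (\<Sum>d\<in>subedges (Suc j) e. \<mu> d)"
        using subdivision_step[OF c e, of j] norm_triangle_ineq[of "?R j e - \<phi> e" "?R (Suc j) e - ?R j e"]
        by simp
    qed
    also have "\<dots> \<le> (\<Sum>i<j. K * (3/5) ^ (n + Suc i)) + K * (3/5) ^ (n + Suc j)"
      unfolding sum.distrib using sum_subedges_le[OF order_refl, of \<mu> "Suc j" n] decaying_nonneg[OF d]
      by (intro add_mono Suc order_trans[OF _ K(2)]) blast
    finally show ?case by simp
  qed
  \<comment> \<open>The factor 3/2 is the sum of all powers of 3/5 with positive exponent.\<close>
  also have "(\<Sum>i<j. K * (3/5) ^ (n + Suc i)) \<le> K * (3/2) * (3/5) ^ n" for n j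
  proof -
    have "(\<Sum>i<j. (3/5) ^ Suc i) = 3/5 * ((1 - (3/5 :: real) ^ j) * (5/2))"
      by (simp add: sum_gp_strict flip: sum_distrib_left sum_divide_distrib)
    also have "\<dots> \<le> 3/5 * (1 * (5/2))" by (intro mult_left_mono mult_right_mono) auto
    finally have "(\<Sum>i<j. (3/5) ^ Suc i) \<le> (3/2 :: real)" by simp
    then have "K * (3/5) ^ n * (\<Sum>i<j. (3/5) ^ Suc i) \<le> K * (3/5) ^ n * (3/2)"
      using K(1) by (intro mult_left_mono) auto
    then show ?thesis by (simp add: sum_distrib_left power_add mult_ac)
  qed
  finally show thesis using that by blast
qed

section \<open>Limits of the sums, trace property and refinement\<close>

lemma riemann_sum_edge:
  "e \<in> oriented_edges m \<Longrightarrow> riemann_sum (m + j) [e] \<omega> = (\<Sum>d\<in>subedges j e. pairing \<omega> d)"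
  by (simp add: riemann_sum_def path_edges_edge)

lemma riemann_sum_edge_tendsto:
  assumes \<omega>: "\<omega> \<in> Omega1" and e: "e \<in> oriented_edges m"
  shows "(\<lambda>j. \<Sum>d\<in>subedges j e. pairing \<omega> d) \<longlonglongrightarrow> path_integral [e] \<omega>"
proof -
  obtain \<mu> where "decaying \<mu>" "controlled \<mu> (pairing \<omega>)" using controlled_pairing[OF \<omega>] by blast
  from subdivision_sums_convergent[OF this e]
  obtain L where L: "(\<lambda>j. \<Sum>d\<in>subedges j e. pairing \<omega> d) \<longlonglongrightarrow> L" by (auto simp: convergent_def)
  then have "(\<lambda>j. riemann_sum (j + m) [e] \<omega>) \<longlonglongrightarrow> L" using riemann_sum_edge[OF e] by (simp add: add.commute)
  then have "(\<lambda>n. riemann_sum n [e] \<omega>) \<longlonglongrightarrow> L" by (rule LIMSEQ_offset)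
  then show ?thesis using L unfolding path_integral_def by (simp add: limI)
qed

lemma riemann_sum_convergent:
  assumes \<omega>: "\<omega> \<in> Omega1" and \<gamma>: "elementary_path \<gamma>"
  shows "convergent (\<lambda>n. riemann_sum n \<gamma> \<omega>)"
proof -
  obtain lev N where lev: "\<And>e. e \<in> set \<gamma> \<Longrightarrow> e \<in> oriented_edges (lev e) \<and> lev e \<le> N"
    using elementary_path_levels[OF \<gamma>] by blast
  have "riemann_sum (j + N) \<gamma> \<omega> = (\<Sum>e\<in>path_edges N \<gamma>. \<Sum>d\<in>subedges j e. pairing \<omega> d)" for j
    using path_edges_refine[of \<gamma> lev N j, OF lev] sum_subedges_UN[OF path_edges_subset]
    by (simp add: riemann_sum_def add.commute)
  moreover have "(\<lambda>j. \<Sum>e\<in>path_edges N \<gamma>. \<Sum>d\<in>subedges j e. pairing \<omega> d)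
      \<longlonglongrightarrow> (\<Sum>e\<in>path_edges N \<gamma>. path_integral [e] \<omega>)"
    by (intro tendsto_sum riemann_sum_edge_tendsto[OF \<omega>]) (use path_edges_subset in blast)
  ultimately have "(\<lambda>j. riemann_sum (j + N) \<gamma> \<omega>) \<longlonglongrightarrow> (\<Sum>e\<in>path_edges N \<gamma>. path_integral [e] \<omega>)" by simp
  from LIMSEQ_offset[OF this] show ?thesis by (rule convergentI)
qed

lemma riemann_sum_tendsto:
  "\<omega> \<in> Omega1 \<Longrightarrow> elementary_path \<gamma> \<Longrightarrow> (\<lambda>n. riemann_sum n \<gamma> \<omega>) \<longlonglongrightarrow> path_integral \<gamma> \<omega>"
  using riemann_sum_convergent unfolding path_integral_def by (simp add: convergent_LIMSEQ_iff)

lemma geometric_tendsto_0: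
  fixes X :: "nat \<Rightarrow> complex"
  assumes "\<And>n. cmod (X n) \<le> K * (3/5) ^ n"
  shows "X \<longlonglongrightarrow> 0"
proof (rule Lim_null_comparison)
  show "\<forall>\<^sub>F n in sequentially. cmod (X n) \<le> K * (3/5) ^ n" using assms by simp
  show "(\<lambda>n. K * (3/5) ^ n) \<longlonglongrightarrow> 0" by (intro tendsto_mult_right_zero LIMSEQ_power_zero) simp
qed

text \<open>The two sums differ by increments of \<open>h\<close> times values of
  \<open>\<omega>\<close>. The squares of both factors have sums of order (3/5)^n, hence so do the
  products.\<close>

lemma path_integral_trace:
  assumes \<omega>: "\<omega> \<in> Omega1" and \<gamma>: "elementary_path \<gamma>"
  shows "path_integral \<gamma> (h \<cdot>\<^sub>L \<omega>) = path_integral \<gamma> (\<omega> \<cdot>\<^sub>R h)"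
proof -
  obtain \<mu> where \<mu>: "decaying \<mu>" "controlled \<mu> (pairing \<omega>)" using controlled_pairing[OF \<omega>] by blast
  have "decaying (\<lambda>e. 1/2 * sqdiff h e + 1/2 * \<mu> e)" by (intro decaying_lincomb decaying_sqdiff \<mu>) auto
  then obtain K where K: "\<And>n. (\<Sum>e\<in>oriented_edges n. 1/2 * sqdiff h e + 1/2 * \<mu> e) \<le> K * (3/5) ^ n"
    using decayingE by blast
  have "cmod (riemann_sum n \<gamma> (h \<cdot>\<^sub>L \<omega>) - riemann_sum n \<gamma> (\<omega> \<cdot>\<^sub>R h)) \<le> K * (3/5) ^ n" for n
  proof -
    have "riemann_sum n \<gamma> (h \<cdot>\<^sub>L \<omega>) - riemann_sum n \<gamma> (\<omega> \<cdot>\<^sub>R h) =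
        (\<Sum>e\<in>path_edges n \<gamma>. (fe_apply h (target e) - fe_apply h (source e)) * pairing \<omega> e)"
      by (simp add: riemann_sum_def pairing_lmult pairing_rmult sum_subtractf[symmetric] algebra_simps)
    also have "cmod \<dots> \<le> (\<Sum>e\<in>path_edges n \<gamma>. 1/2 * sqdiff h e + 1/2 * \<mu> e)"
    proof (rule sum_norm_le)
      fix e assume "e \<in> path_edges n \<gamma>"
      then have "source e \<in> gasket" "target e \<in> gasket"
        using path_edges_subset oriented_edges_lattice(5,6) by blast+
      then have "(cmod (pairing \<omega> (source e, target e)))\<^sup>2 \<le> \<mu> (source e, target e)"
        using \<mu>(2) unfolding controlled_def by blast
      then show "cmod ((fe_apply h (target e) - fe_apply h (source e)) * pairing \<omega> e) \<le> 1/2 * sqdiff h e + 1/2 * \<mu> e"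
        using mult_le_half_squares[of "cmod (fe_apply h (target e) - fe_apply h (source e))" "cmod (pairing \<omega> e)"]
        by (simp add: norm_mult sqdiff_def)
    qed
    also have "\<dots> \<le> (\<Sum>e\<in>oriented_edges n. 1/2 * sqdiff h e + 1/2 * \<mu> e)"
      using decaying_nonneg[OF \<mu>(1)] path_edges_subset
      by (intro sum_mono2 finite_oriented_edges) (auto simp: sqdiff_def)
    finally show ?thesis using K[of n] by simp
  qed
  then have "(\<lambda>n. riemann_sum n \<gamma> (h \<cdot>\<^sub>L \<omega>) - riemann_sum n \<gamma> (\<omega> \<cdot>\<^sub>R h)) \<longlonglongrightarrow> 0" by (rule geometric_tendsto_0)
  moreover have "(\<lambda>n. riemann_sum n \<gamma> (h \<cdot>\<^sub>L \<omega>) - riemann_sum n \<gamma> (\<omega> \<cdot>\<^sub>R h))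
      \<longlonglongrightarrow> path_integral \<gamma> (h \<cdot>\<^sub>L \<omega>) - path_integral \<gamma> (\<omega> \<cdot>\<^sub>R h)"
    using \<omega> \<gamma> by (intro tendsto_diff riemann_sum_tendsto Omega1.intros)
  ultimately show ?thesis using LIMSEQ_unique by fastforce
qed

text \<open>Replacing \<open>path_integral [e] \<omega>\<close> by \<open>pairing \<omega> e\<close>
  on all edges of level \<open>n\<close> costs a total of order (3/5)^n, also after multiplication
  by the bounded \<open>h\<close>, and turns the sum into the one for
  \<open>h \<cdot>\<^sub>L \<omega>\<close>.\<close>

lemma path_integral_lmult_limit:
  assumes \<omega>: "\<omega> \<in> Omega1" and \<gamma>: "elementary_path \<gamma>"
  shows "(\<lambda>n. \<Sum>e\<in>path_edges n \<gamma>. fe_apply h (target e) * path_integral [e] \<omega>)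
      \<longlonglongrightarrow> path_integral \<gamma> (h \<cdot>\<^sub>L \<omega>)"
proof -
  obtain \<mu> where \<mu>: "decaying \<mu>" "controlled \<mu> (pairing \<omega>)" using controlled_pairing[OF \<omega>] by blast
  obtain K where K: "\<And>n j. (\<Sum>e\<in>oriented_edges n. cmod ((\<Sum>d\<in>subedges j e. pairing \<omega> d) - pairing \<omega> e)) \<le> K * (3/5) ^ n"
    using subdivision_sums_error[OF \<mu>] by blast
  obtain M where M: "M \<ge> 0" "\<And>x. cmod (fe_apply h x) \<le> M" using fe_bounded by blast
  \<comment> \<open>The bound of \<open>subdivision_sums_error\<close> does not depend on
    \<open>j\<close> and the edge set is finite, so it survives the limit.\<close>
  have lim: "(\<Sum>e\<in>oriented_edges n. cmod (path_integral [e] \<omega> - pairing \<omega> e)) \<le> K * (3/5) ^ n" for n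
  proof (rule tendsto_upperbound)
    show "(\<lambda>j. \<Sum>e\<in>oriented_edges n. cmod ((\<Sum>d\<in>subedges j e. pairing \<omega> d) - pairing \<omega> e))
        \<longlonglongrightarrow> (\<Sum>e\<in>oriented_edges n. cmod (path_integral [e] \<omega> - pairing \<omega> e))"
      by (intro tendsto_intros riemann_sum_edge_tendsto[OF \<omega>])
  qed (use K in auto)
  have "cmod ((\<Sum>e\<in>path_edges n \<gamma>. fe_apply h (target e) * path_integral [e] \<omega>) - riemann_sum n \<gamma> (h \<cdot>\<^sub>L \<omega>))
      \<le> M * K * (3/5) ^ n" for n
  proof -
    have "(\<Sum>e\<in>path_edges n \<gamma>. fe_apply h (target e) * path_integral [e] \<omega>) - riemann_sum n \<gamma> (h \<cdot>\<^sub>L \<omega>) =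
        (\<Sum>e\<in>path_edges n \<gamma>. fe_apply h (target e) * (path_integral [e] \<omega> - pairing \<omega> e))"
      by (simp add: riemann_sum_def pairing_lmult sum_subtractf[symmetric] algebra_simps)
    also have "cmod \<dots> \<le> (\<Sum>e\<in>path_edges n \<gamma>. M * cmod (path_integral [e] \<omega> - pairing \<omega> e))"
      using M by (intro sum_norm_le) (auto simp: norm_mult intro!: mult_right_mono)
    also have "\<dots> \<le> (\<Sum>e\<in>oriented_edges n. M * cmod (path_integral [e] \<omega> - pairing \<omega> e))"
      using M path_edges_subset by (intro sum_mono2 finite_oriented_edges) auto
    also have "\<dots> \<le> M * (K * (3/5) ^ n)"
      unfolding sum_distrib_left[symmetric] using M lim by (intro mult_left_mono) auto
    finally show ?thesis by simp
  qed
  then have "(\<lambda>n. (\<Sum>e\<in>path_edges n \<gamma>. fe_apply h (target e) * path_integral [e] \<omega>) - riemann_sum n \<gamma> (h \<cdot>\<^sub>L \<omega>)) \<longlonglongrightarrow> 0"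
    by (rule geometric_tendsto_0)
  from tendsto_add[OF this riemann_sum_tendsto[OF Omega1.lmult[OF \<omega>, of h] \<gamma>]]
  show ?thesis by simp
qed

section \<open>Energy along an edge\<close>

text \<open>\<open>A\<close>, \<open>B\<close>, \<open>C\<close> are the energies of the subcells at
  the vertices with values \<open>a\<close>, \<open>b\<close>, \<open>c\<close>; the first two
  border the side from \<open>a\<close> to \<open>b\<close>. The bracket is the energy gained by
  refinement. The coefficient of \<open>E\<close> has to be below 3/5, so that it stays below 1
  after renormalisation by 5/3.\<close>

lemma strip_inequality_real:
  fixes a b c x y z :: real
  defines "A \<equiv> (z - a)\<^sup>2 + (y - z)\<^sup>2 + (a - y)\<^sup>2" and "B \<equiv> (b - z)\<^sup>2 + (x - b)\<^sup>2 + (z - x)\<^sup>2"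
    and "C \<equiv> (x - y)\<^sup>2 + (c - x)\<^sup>2 + (y - c)\<^sup>2" and "E \<equiv> (b - a)\<^sup>2 + (c - b)\<^sup>2 + (a - c)\<^sup>2"
  shows "A + B \<le> 29/50 * E + 29 * (5/3 * (A + B + C) - E)"
proof -
  \<comment> \<open>Deviations from the harmonic extension, whose midpoint values are weighted means
    with weights 2/5 for the two adjacent vertices and 1/5 for the opposite one.\<close>
  define u v w where "u = x - (a + 2*b + 2*c)/5" and "v = y - (b + 2*a + 2*c)/5"
    and "w = z - (c + 2*b + 2*a)/5"
  have e: "x = u + (a + 2*b + 2*c)/5" "y = v + (b + 2*a + 2*c)/5" "z = w + (c + 2*b + 2*a)/5"
    by (simp_all add: u_def v_def w_def)
  \<comment> \<open>Young's inequality with weights \<open>1 + 1/28\<close> and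
    \<open>1 + 28\<close>. The harmonic part is at most 14/25 of \<open>E\<close>; the weight 29/28
    is less than 15/14, the ratio of 3/5 to 14/25, and the product is 29/50.\<close>
  have sq: "(p + q)\<^sup>2 \<le> 29/28 * p\<^sup>2 + 29 * q\<^sup>2" for p q :: real
    using zero_le_power2[of "p - 28 * q"] by (simp add: power2_eq_square algebra_simps)
  have "A + B = ((c + 2*b - 3*a)/5 + w)\<^sup>2 + ((c - b)/5 + (v - w))\<^sup>2 + ((3*a - b - 2*c)/5 + - v)\<^sup>2
      + ((3*b - c - 2*a)/5 + - w)\<^sup>2 + ((a + 2*c - 3*b)/5 + u)\<^sup>2 + ((a - c)/5 + (w - u))\<^sup>2"
    unfolding A_def B_def e by (simp add: power2_eq_square field_simps)
  also have "\<dots> \<le> (29/28 * ((c + 2*b - 3*a)/5)\<^sup>2 + 29 * w\<^sup>2) + (29/28 * ((c - b)/5)\<^sup>2 + 29 * (v - w)\<^sup>2)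
      + (29/28 * ((3*a - b - 2*c)/5)\<^sup>2 + 29 * (- v)\<^sup>2) + (29/28 * ((3*b - c - 2*a)/5)\<^sup>2 + 29 * (- w)\<^sup>2)
      + (29/28 * ((a + 2*c - 3*b)/5)\<^sup>2 + 29 * u\<^sup>2) + (29/28 * ((a - c)/5)\<^sup>2 + 29 * (w - u)\<^sup>2)"
    by (intro add_mono sq)
  also have "\<dots> = 29/28 * (14/25 * E - 16/25 * (c - (a + b)/2)\<^sup>2) +
      29 * ((v - w)\<^sup>2 + (w - u)\<^sup>2 + u\<^sup>2 + v\<^sup>2 + 2 * w\<^sup>2)"
    unfolding E_def by (simp add: power2_eq_square field_simps)
  also have "\<dots> \<le> 29/50 * E + 29 * (5/3 * ((u - v)\<^sup>2 + (v - w)\<^sup>2 + (w - u)\<^sup>2 + 2 * (u\<^sup>2 + v\<^sup>2 + w\<^sup>2)))"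
  proof -
    have "0 \<le> (c - (a + b)/2)\<^sup>2" "0 \<le> (u - v)\<^sup>2" "0 \<le> (v - w)\<^sup>2" "0 \<le> (w - u)\<^sup>2" "0 \<le> u\<^sup>2" "0 \<le> v\<^sup>2" "0 \<le> w\<^sup>2"
      by simp_all
    then show ?thesis by argo
  qed
  also have "5/3 * ((u - v)\<^sup>2 + (v - w)\<^sup>2 + (w - u)\<^sup>2 + 2 * (u\<^sup>2 + v\<^sup>2 + w\<^sup>2)) = 5/3 * (A + B + C) - E"
    unfolding A_def B_def C_def E_def e by (simp add: power2_eq_square field_simps)
  finally show ?thesis .
qed

lemma strip_inequality_complex:
  fixes a b c x y z :: complex
  defines "A \<equiv> (cmod (z - a))\<^sup>2 + (cmod (y - z))\<^sup>2 + (cmod (a - y))\<^sup>2"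
    and "B \<equiv> (cmod (b - z))\<^sup>2 + (cmod (x - b))\<^sup>2 + (cmod (z - x))\<^sup>2"
    and "C \<equiv> (cmod (x - y))\<^sup>2 + (cmod (c - x))\<^sup>2 + (cmod (y - c))\<^sup>2"
    and "E \<equiv> (cmod (b - a))\<^sup>2 + (cmod (c - b))\<^sup>2 + (cmod (a - c))\<^sup>2"
  shows "A + B \<le> 29/50 * E + 29 * (5/3 * (A + B + C) - E)"
  using strip_inequality_real[of "Re z" "Re a" "Re y" "Re b" "Re x" "Re c"]
    strip_inequality_real[of "Im z" "Im a" "Im y" "Im b" "Im x" "Im c"]
  unfolding A_def B_def C_def E_def cmod_power2 minus_complex.sel by argo

text \<open>Energy of the \<open>2 ^ n\<close> cells whose words use only \<open>i\<close> and
  \<open>j\<close>: the cells with a side on the edge from \<open>vertex i\<close> to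
  \<open>vertex j\<close>. The recursion splits off the outermost contraction, as
  \<open>edge_energy_Suc\<close> does.\<close>

primrec strip_energy :: "nat \<Rightarrow> nat \<Rightarrow> nat \<Rightarrow> (point \<Rightarrow> complex) \<Rightarrow> real"
  where "strip_energy i j 0 = edge_energy 0"
  | "strip_energy i j (Suc n) = (\<lambda>F. strip_energy i j n (F \<circ> contr i) + strip_energy i j n (F \<circ> contr j))"

lemma strip_energy_nonneg: "0 \<le> strip_energy i j n F"
  by (induction n arbitrary: F) (simp_all add: edge_energy_nonneg)

text \<open>Level 0 is the strip inequality for each of the three sides. In the induction both
  retained cells contribute their own energy gain; the gain of the third cell is nonnegative, so the
  total gain dominates the two.\<close>

lemma strip_energy_step:
  assumes "i < 3" "j < 3" "i \<noteq> j"
  shows "strip_energy i j (Suc n) F \<le> 29/50 * strip_energy i j n F +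
    29 * (5/3 * edge_energy (Suc n) F - edge_energy n F)"
proof (induction n arbitrary: F)
  case 0
  have s: "{..<3::nat} = {0, 1, 2}" by auto
  have v: "contr 0 (vertex 0) = vertex 0" "contr 1 (vertex 1) = vertex 1"
    "contr 2 (vertex 2) = vertex 2" "contr 1 (vertex 0) = contr 0 (vertex 1)"
    "contr 2 (vertex 0) = contr 0 (vertex 2)" "contr 2 (vertex 1) = contr 1 (vertex 2)"
    by (auto simp: contr_def vertex_def)
  define a b c x y z where "a = F (vertex 0)" and "b = F (vertex 1)" and "c = F (vertex 2)"
    and "x = F (contr 1 (vertex 2))" and "y = F (contr 0 (vertex 2))" and "z = F (contr 0 (vertex 1))"
  have E: "edge_energy 0 (F \<circ> contr 0) = (cmod (z - a))\<^sup>2 + (cmod (y - z))\<^sup>2 + (cmod (a - y))\<^sup>2"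
    "edge_energy 0 (F \<circ> contr 1) = (cmod (b - z))\<^sup>2 + (cmod (x - b))\<^sup>2 + (cmod (z - x))\<^sup>2"
    "edge_energy 0 (F \<circ> contr 2) = (cmod (x - y))\<^sup>2 + (cmod (c - x))\<^sup>2 + (cmod (y - c))\<^sup>2"
    "edge_energy 0 F = (cmod (b - a))\<^sup>2 + (cmod (c - b))\<^sup>2 + (cmod (a - c))\<^sup>2"
    by (simp_all add: edge_energy_0 v[simplified] a_def b_def c_def x_def y_def z_def)
  have E1: "edge_energy (Suc 0) F = edge_energy 0 (F \<circ> contr 0) + edge_energy 0 (F \<circ> contr 1) + edge_energy 0 (F \<circ> contr 2)"
    unfolding edge_energy_Suc s by simp
  have "i = 0 \<and> j = 1 \<or> i = 1 \<and> j = 0 \<or> i = 0 \<and> j = 2 \<or> i = 2 \<and> j = 0 \<or> i = 1 \<and> j = 2 \<or> i = 2 \<and> j = 1"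
    using assms by auto
  moreover have "edge_energy 0 (F \<circ> contr 0) + edge_energy 0 (F \<circ> contr 1) \<le>
      29/50 * edge_energy 0 F + 29 * (5/3 * edge_energy (Suc 0) F - edge_energy 0 F)"
    unfolding E1 E by (rule strip_inequality_complex)
  \<comment> \<open>The reflection exchanging vertices 1 and 2 reverses the direction of the edges,
    hence the sign changes under the norms. The side from 1 to 2 below is a rotation and keeps
    directions.\<close>
  moreover have "edge_energy 0 (F \<circ> contr 0) + edge_energy 0 (F \<circ> contr 2) \<le>
      29/50 * edge_energy 0 F + 29 * (5/3 * edge_energy (Suc 0) F - edge_energy 0 F)"
    using strip_inequality_complex[of y a z c x b] unfolding E1 E
    by (simp only: norm_minus_commute[of y a] norm_minus_commute[of z y]
      norm_minus_commute[of a z] norm_minus_commute[of c y] norm_minus_commute[of x c]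
      norm_minus_commute[of y x] norm_minus_commute[of x z] norm_minus_commute[of b x]
      norm_minus_commute[of z b] norm_minus_commute[of c a] norm_minus_commute[of b c]
      norm_minus_commute[of a b] ac_simps)
  moreover have "edge_energy 0 (F \<circ> contr 1) + edge_energy 0 (F \<circ> contr 2) \<le>
      29/50 * edge_energy 0 F + 29 * (5/3 * edge_energy (Suc 0) F - edge_energy 0 F)"
    using strip_inequality_complex[of x b z c y a] unfolding E1 E by (simp only: ac_simps)
  ultimately show ?case by (elim disjE) (simp_all add: add.commute)
next
  case (Suc n)
  define X where "X F = 5/3 * edge_energy (Suc n) F - edge_energy n F" for F
  have X: "0 \<le> X F" for F using edge_energy_mono[of n F] by (simp add: X_def)
  have "strip_energy i j (Suc (Suc n)) F \<le>
      (29/50 * strip_energy i j n (F \<circ> contr i) + 29 * X (F \<circ> contr i)) +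
      (29/50 * strip_energy i j n (F \<circ> contr j) + 29 * X (F \<circ> contr j))"
    unfolding strip_energy.simps(2)[of i j "Suc n"] X_def by (intro add_mono Suc.IH)
  also have "\<dots> = 29/50 * strip_energy i j (Suc n) F + 29 * (\<Sum>l\<in>{i, j}. X (F \<circ> contr l))"
    using assms by (simp add: algebra_simps)
  also have "(\<Sum>l\<in>{i, j}. X (F \<circ> contr l)) \<le> (\<Sum>l<3. X (F \<circ> contr l))"
    using assms X by (intro sum_mono2) auto
  also have "\<dots> = 5/3 * edge_energy (Suc (Suc n)) F - edge_energy (Suc n) F"
    unfolding edge_energy_Suc[of "Suc n"] edge_energy_Suc[of n F] X_def
    by (simp only: sum_subtractf sum_distrib_left)
  finally show ?case by simp
qed

text \<open>After renormalisation the factor is \<open>5/3 * 29/50 = 29/30\<close>, and the gains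
  become \<open>5/3 * 29\<close> times the increments of a bounded sequence, which telescope. The
  constant 30 is the inverse of \<open>1 - 29/30\<close>.\<close>

lemma summable_strip_energy:
  assumes ij: "i < 3" "j < 3" "i \<noteq> j" and C: "\<And>n. (5/3) ^ n * edge_energy n F \<le> C"
  shows "summable (\<lambda>n. (5/3) ^ n * strip_energy i j n F)"
proof (rule summableI_nonneg_bounded)
  define a where "a n = (5/3) ^ n * strip_energy i j n F" for n
  define e where "e n = (5/3) ^ n * edge_energy n F" for n
  show a0: "0 \<le> a n" for n by (simp add: a_def strip_energy_nonneg)
  have step: "a (Suc n) \<le> 29/30 * a n + 145/3 * (e (Suc n) - e n)" for n
  proof -
    have "a (Suc n) \<le> (5/3) ^ Suc n * (29/50 * strip_energy i j n F +
        29 * (5/3 * edge_energy (Suc n) F - edge_energy n F))"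
      unfolding a_def by (intro mult_left_mono strip_energy_step[OF ij]) auto
    also have "\<dots> = 29/30 * a n + 145/3 * (e (Suc n) - e n)"
      by (simp add: a_def e_def algebra_simps)
    finally show ?thesis .
  qed
  show "sum a {..<n} \<le> 30 * (a 0 + 145/3 * C)" for n
  proof -
    have "sum a {..<n} \<le> sum a {..<Suc n}" using a0 by simp
    also have "\<dots> = a 0 + (\<Sum>k<n. a (Suc k))" by (rule sum.lessThan_Suc_shift)
    also have "(\<Sum>k<n. a (Suc k)) \<le> (\<Sum>k<n. 29/30 * a k + 145/3 * (e (Suc k) - e k))"
      by (intro sum_mono step)
    also have "\<dots> = 29/30 * sum a {..<n} + 145/3 * (e n - e 0)"
      by (simp only: sum.distrib sum_distrib_left[symmetric] sum_lessThan_telescope)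
    also have "e n - e 0 \<le> C" using C[of n] by (simp add: e_def add_increasing2 edge_energy_nonneg algebra_simps)
    finally show ?thesis by simp
  qed
qed

section \<open>Squared increments of a trace along an edge\<close>

definition dyadic_sq :: "nat \<Rightarrow> (real \<Rightarrow> complex) \<Rightarrow> real"
  where "dyadic_sq n u = (\<Sum>k<2 ^ n. (cmod (u (real (Suc k) / 2 ^ n) - u (real k / 2 ^ n)))\<^sup>2)"

lemma dyadic_sq_nonneg: "0 \<le> dyadic_sq n u"
  by (simp add: dyadic_sq_def sum_nonneg)

text \<open>Cutting at 1/2, rather than refining the smallest cells, matches the recursion of
  \<open>strip_energy\<close>: the outermost contractions \<open>contr i\<close> and
  \<open>contr j\<close> map the side onto its two halves.\<close>

lemma dyadic_sq_Suc:
  "dyadic_sq (Suc n) u = dyadic_sq n (\<lambda>x. u (x / 2)) + dyadic_sq n (\<lambda>x. u ((1 + x) / 2))"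
proof -
  define a where "a k = (cmod (u (real (Suc k) / 2 ^ Suc n) - u (real k / 2 ^ Suc n)))\<^sup>2" for k
  have "dyadic_sq (Suc n) u = sum a {0..<2 ^ n + 2 ^ n}"
  proof -
    have "(2::nat) ^ Suc n = 2 ^ n + 2 ^ n" by simp
    then show ?thesis unfolding dyadic_sq_def a_def atLeast0LessThan by presburger
  qed
  also have "\<dots> = sum a {0..<2 ^ n} + sum a {0 + 2 ^ n..<2 ^ n + 2 ^ n}"
    by (simp add: sum.atLeastLessThan_concat)
  also have "sum a {0 + 2 ^ n..<2 ^ n + 2 ^ n} = (\<Sum>k\<in>{0..<2 ^ n}. a (k + 2 ^ n))"
    by (rule sum.shift_bounds_nat_ivl)
  also have "\<dots> = dyadic_sq n (\<lambda>x. u ((1 + x) / 2))"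
  proof -
    have *: "(1 + x / 2 ^ n) / 2 = (x + 2 ^ n) / (2 * 2 ^ n)" for x :: real by (simp add: field_simps)
    show ?thesis unfolding dyadic_sq_def a_def * by (simp add: atLeast0LessThan ac_simps)
  qed
  also have "sum a {0..<2 ^ n} = dyadic_sq n (\<lambda>x. u (x / 2))"
    by (simp add: dyadic_sq_def a_def atLeast0LessThan mult.commute)
  finally show ?thesis .
qed

lemma dyadic_sq_le_strip_energy:
  assumes "i < 3" "j < 3" "i \<noteq> j"
  shows "dyadic_sq n (\<lambda>x. F (vertex i + x *\<^sub>R (vertex j - vertex i))) \<le> strip_energy i j n F"
proof (induction n arbitrary: F)
  case 0
  have "i = 0 \<and> j = 1 \<or> i = 1 \<and> j = 0 \<or> i = 0 \<and> j = 2 \<or> i = 2 \<and> j = 0 \<or> i = 1 \<and> j = 2 \<or> i = 2 \<and> j = 1"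
    using assms by auto
  then show ?case
    by (elim disjE) (simp_all add: dyadic_sq_def edge_energy_0 norm_minus_commute)
next
  case (Suc n)
  have 1: "vertex i + (x / 2) *\<^sub>R (vertex j - vertex i) = contr i (vertex i + x *\<^sub>R (vertex j - vertex i))" for x
    by (simp add: contr_def)
  have 2: "vertex i + ((1 + x) / 2) *\<^sub>R (vertex j - vertex i) = contr j (vertex i + x *\<^sub>R (vertex j - vertex i))" for x
  proof -
    have "vertex i + ((1 + x) / 2) *\<^sub>R (vertex j - vertex i)
        = vertex i + (1/2) *\<^sub>R (vertex j - vertex i) + (x / 2) *\<^sub>R (vertex j - vertex i)"
      by (simp only: add_divide_distrib scaleR_add_left add.assoc)
    also have "vertex i + (1/2) *\<^sub>R (vertex j - vertex i) = contr j (vertex i)"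
      by (simp add: contr_eq algebra_simps flip: scaleR_add_left)
    finally show ?thesis by (simp only: contr_affine)
  qed
  show ?case
    using Suc.IH[of "F \<circ> contr i"] Suc.IH[of "F \<circ> contr j"] unfolding dyadic_sq_Suc 2 unfolding 1 by (simp add: comp_def)
qed

text \<open>The energy inside one cell of level \<open>m\<close> is part of the total energy at
  level \<open>n + m\<close>.\<close>

lemma edge_energy_contr_word: "\<sigma> \<in> words m \<Longrightarrow> edge_energy n (F \<circ> contr_word \<sigma>) \<le> edge_energy (n + m) F"
proof (induction m arbitrary: \<sigma> F)
  case 0
  then show ?case by (simp add: words_0 contr_word_def)
next
  case (Suc m)
  then obtain i \<tau> where i: "i < 3" "\<tau> \<in> words m" "\<sigma> = i # \<tau>" by (auto simp: words_Suc)
  then have "F \<circ> contr_word \<sigma> = (F \<circ> contr i) \<circ> contr_word \<tau>" by (simp add: contr_word_def o_assoc)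
  then have "edge_energy n (F \<circ> contr_word \<sigma>) \<le> edge_energy (n + m) (F \<circ> contr i)" using Suc.IH i by metis
  also have "\<dots> \<le> (\<Sum>l<3. edge_energy (n + m) (F \<circ> contr l))"
    using i by (intro member_le_sum) (auto simp: edge_energy_nonneg)
  also have "\<dots> = edge_energy (n + Suc m) F" using edge_energy_Suc[of "n + m"] by simp
  finally show ?case .
qed

lemma contr_word_affine: "contr_word \<sigma> (s + x *\<^sub>R (t - s)) = contr_word \<sigma> s + x *\<^sub>R (contr_word \<sigma> t - contr_word \<sigma> s)"
proof (induction \<sigma>)
  case Nil
  show ?case by (simp add: contr_word_def)
next
  case (Cons i \<sigma>)
  show ?case by (simp add: contr_word_Cons Cons contr_affine contr_diff)
qed

lemma oriented_edge_word:
  assumes "e \<in> oriented_edges m"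
  obtains \<sigma> i j where "\<sigma> \<in> words m" "i < 3" "j < 3" "i \<noteq> j"
    "source e = contr_word \<sigma> (vertex i)" "target e = contr_word \<sigma> (vertex j)"
proof -
  have "e \<in> edges m \<or> prod.swap e \<in> edges m"
    using assms by (auto simp: oriented_edges_def)
  then have "\<exists>\<sigma> i. \<sigma> \<in> words m \<and> i < 3 \<and> (e = (contr_word \<sigma> (vertex i), contr_word \<sigma> (vertex ((i + 1) mod 3))) \<or>
      e = (contr_word \<sigma> (vertex ((i + 1) mod 3)), contr_word \<sigma> (vertex i)))"
    unfolding edges_def by (elim disjE CollectE exE conjE) (metis, metis swap_simp swap_swap)
  then obtain \<sigma> i where "\<sigma> \<in> words m" "i < 3" and e: "e = (contr_word \<sigma> (vertex i), contr_word \<sigma> (vertex ((i + 1) mod 3))) \<or>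
      e = (contr_word \<sigma> (vertex ((i + 1) mod 3)), contr_word \<sigma> (vertex i))" by blast
  moreover have "i \<noteq> (i + 1) mod 3" "(i + 1) mod 3 < 3" using \<open>i < 3\<close> by presburger+
  ultimately show thesis using that[of \<sigma> i "(i + 1) mod 3"] that[of \<sigma> "(i + 1) mod 3" i] by auto
qed

text \<open>Composition with the contraction of the cell moves the edge to a side of the large
  triangle. The energy bound is inherited, since the factor \<open>(5/3) ^ n\<close> only grows when
  \<open>n\<close> is replaced by \<open>n + m\<close>.\<close>

lemma summable_dyadic_sq_edge_trace:
  assumes "e \<in> all_oriented_edges"
  shows "summable (\<lambda>n. (5/3) ^ n * dyadic_sq n (edge_trace e f))"
proof -
  obtain m where "e \<in> oriented_edges m" using assms by (auto simp: all_oriented_edges_def)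
  then obtain \<sigma> i j where \<sigma>: "\<sigma> \<in> words m" and ij: "i < 3" "j < 3" "i \<noteq> j"
    and e: "source e = contr_word \<sigma> (vertex i)" "target e = contr_word \<sigma> (vertex j)"
    by (rule oriented_edge_word)
  define F where "F = fe_apply f \<circ> contr_word \<sigma>"
  have tr: "edge_trace e f = (\<lambda>x. F (vertex i + x *\<^sub>R (vertex j - vertex i)))"
    by (simp add: fun_eq_iff edge_trace_def F_def e contr_word_affine)
  have "energy (fe_apply f) < \<infinity>" using fe_apply[of f] by (simp add: finite_energy_def)
  then obtain C where C: "\<And>m. (5/3) ^ m * edge_energy m (fe_apply f) \<le> C"
    unfolding energy_finite_iff by blast
  have "(5/3) ^ n * edge_energy n F \<le> C" for n
  proof -
    have "(5/3) ^ n * edge_energy n F \<le> (5/3) ^ (n + m) * edge_energy (n + m) (fe_apply f)"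
      unfolding F_def using edge_energy_contr_word[OF \<sigma>]
      by (intro mult_mono power_increasing) (auto simp: edge_energy_nonneg)
    also have "\<dots> \<le> C" by (rule C)
    finally show ?thesis .
  qed
  from summable_strip_energy[OF ij this] show ?thesis
  proof (rule summable_comparison_test'[where N = 0])
    fix n
    show "norm ((5/3) ^ n * dyadic_sq n (edge_trace e f)) \<le> (5/3) ^ n * strip_energy i j n F"
      using dyadic_sq_le_strip_energy[OF ij, of n F] by (simp add: tr dyadic_sq_nonneg)
  qed
qed

section \<open>Dyadic chaining\<close>

definition dyadic_index :: "nat \<Rightarrow> real \<Rightarrow> nat"
  where "dyadic_index n x = nat \<lfloor>2 ^ n * x\<rfloor>"

text \<open>Half-open cells partition \<open>[0,1)\<close>; the point 1 lies in no cell of index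
  below \<open>2 ^ n\<close> and is treated as a null set.\<close>

definition dyadic_cell :: "nat \<Rightarrow> nat \<Rightarrow> real set"
  where "dyadic_cell n i = {real i / 2 ^ n..<real (Suc i) / 2 ^ n}"

lemma dyadic_index_iff: "0 \<le> x \<Longrightarrow> x \<in> dyadic_cell n i \<longleftrightarrow> dyadic_index n x = i"
proof -
  assume x: "0 \<le> x"
  have "x \<in> dyadic_cell n i \<longleftrightarrow> real i \<le> 2 ^ n * x \<and> 2 ^ n * x < real i + 1"
    by (auto simp: dyadic_cell_def field_simps)
  also have "\<dots> \<longleftrightarrow> \<lfloor>2 ^ n * x\<rfloor> = int i" by (simp add: floor_eq_iff)
  also have "\<dots> \<longleftrightarrow> dyadic_index n x = i" using x by (auto simp: dyadic_index_def)
  finally show ?thesis .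
qed

lemma dyadic_index_bounds:
  assumes "0 \<le> x"
  shows "real (dyadic_index n x) / 2 ^ n \<le> x" "x < real (Suc (dyadic_index n x)) / 2 ^ n"
  using dyadic_index_iff[OF assms, of n "dyadic_index n x"] by (auto simp: dyadic_cell_def)

lemma dyadic_index_less:
  assumes "0 \<le> x" "x < 1" shows "dyadic_index n x < 2 ^ n"
proof -
  have "2 ^ n * x < 2 ^ n" using assms by simp
  then have "\<lfloor>2 ^ n * x\<rfloor> < 2 ^ n" by (simp add: floor_less_iff)
  then show ?thesis using assms by (simp add: dyadic_index_def nat_less_iff)
qed

lemma dyadic_index_Suc:
  assumes "0 \<le> x"
  shows "dyadic_index (Suc n) x = 2 * dyadic_index n x \<or> dyadic_index (Suc n) x = 2 * dyadic_index n x + 1"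
proof -
  have "\<lfloor>2 * (2 ^ n * x)\<rfloor> = 2 * \<lfloor>2 ^ n * x\<rfloor> \<or> \<lfloor>2 * (2 ^ n * x)\<rfloor> = 2 * \<lfloor>2 ^ n * x\<rfloor> + 1" by linarith
  moreover have "0 \<le> \<lfloor>2 ^ n * x\<rfloor>" using assms by simp
  ultimately have "nat \<lfloor>2 * (2 ^ n * x)\<rfloor> = 2 * nat \<lfloor>2 ^ n * x\<rfloor> \<or>
      nat \<lfloor>2 * (2 ^ n * x)\<rfloor> = 2 * nat \<lfloor>2 ^ n * x\<rfloor> + 1" by linarith
  then show ?thesis by (simp add: dyadic_index_def mult.assoc)
qed

lemma dyadic_index_tendsto:
  assumes "0 \<le> x"
  shows "(\<lambda>n. real (dyadic_index n x) / 2 ^ n) \<longlonglongrightarrow> x"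
proof (rule LIM_zero_cancel, rule Lim_null_comparison)
  show "\<forall>\<^sub>F n in sequentially. norm (real (dyadic_index n x) / 2 ^ n - x) \<le> (1/2) ^ n"
  proof (rule always_eventually, rule allI)
    fix n
    have "real (dyadic_index n x) / 2 ^ n \<le> x" "x \<le> real (dyadic_index n x) / 2 ^ n + (1/2) ^ n"
      using dyadic_index_bounds[OF assms, of n] by (simp_all add: field_simps)
    then show "norm (real (dyadic_index n x) / 2 ^ n - x) \<le> (1/2) ^ n" by simp
  qed
  show "(\<lambda>n. (1/2 :: real) ^ n) \<longlonglongrightarrow> 0" by (rule LIMSEQ_power_zero) simp
qed

text \<open>The share of cell \<open>i\<close> of level \<open>n\<close> in
  \<open>dyadic_sq (Suc n) u\<close>: the two half steps inside it.\<close>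

definition child_sq :: "(real \<Rightarrow> complex) \<Rightarrow> nat \<Rightarrow> nat \<Rightarrow> real"
  where "child_sq u n i = (cmod (u (real (2 * i + 1) / 2 ^ Suc n) - u (real i / 2 ^ n)))\<^sup>2 +
    (cmod (u (real (Suc i) / 2 ^ n) - u (real (2 * i + 1) / 2 ^ Suc n)))\<^sup>2"

definition osc :: "(real \<Rightarrow> complex) \<Rightarrow> nat \<Rightarrow> real \<Rightarrow> real"
  where "osc u n x = (\<Sum>i<2 ^ n. child_sq u n i * indicator (dyadic_cell n i) x)"

lemma child_sq_nonneg: "0 \<le> child_sq u n i"
  by (simp add: child_sq_def)

lemma osc_nonneg: "0 \<le> osc u n x"
  by (simp add: osc_def child_sq_nonneg sum_nonneg)

lemma osc_eq:
  assumes "0 \<le> x" "x < 1" shows "osc u n x = child_sq u n (dyadic_index n x)"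
proof -
  have "osc u n x = (\<Sum>i<2 ^ n. if i = dyadic_index n x then child_sq u n i else 0)"
    unfolding osc_def by (intro sum.cong) (auto simp: indicator_def dyadic_index_iff[OF assms(1)])
  then show ?thesis using dyadic_index_less[OF assms] by simp
qed

lemma sum_child_sq: "(\<Sum>i<2 ^ n. child_sq u n i) = dyadic_sq (Suc n) u"
proof -
  have half: "real (2 * i) / 2 ^ Suc n = real i / 2 ^ n" for i by simp
  have "Suc (2 * i + 1) = 2 * Suc i" for i by simp
  then show ?thesis unfolding dyadic_sq_def sum_two_power_Suc child_sq_def
    by (intro sum.cong refl) (metis half Suc_eq_plus1)
qed

lemma nn_integral_osc: "(\<integral>\<^sup>+x. ennreal (osc u n x) \<partial>lborel) = ennreal (dyadic_sq (Suc n) u / 2 ^ n)"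
proof -
  have m: "emeasure lborel (dyadic_cell n i) = ennreal (1 / 2 ^ n)" for i
    by (simp add: dyadic_cell_def divide_right_mono add_divide_distrib)
  have "(\<integral>\<^sup>+x. ennreal (osc u n x) \<partial>lborel) =
      (\<integral>\<^sup>+x. (\<Sum>i<2 ^ n. ennreal (child_sq u n i) * indicator (dyadic_cell n i) x) \<partial>lborel)"
    unfolding osc_def
    by (intro nn_integral_cong) (simp add: sum_ennreal[symmetric] child_sq_nonneg ennreal_mult ennreal_indicator
        del: sum_ennreal)
  also have "\<dots> = (\<Sum>i<2 ^ n. \<integral>\<^sup>+x. ennreal (child_sq u n i) * indicator (dyadic_cell n i) x \<partial>lborel)"
    by (rule nn_integral_sum) (simp add: dyadic_cell_def)
  also have "\<dots> = (\<Sum>i<2 ^ n. ennreal (child_sq u n i * (1 / 2 ^ n)))"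
  proof (rule sum.cong[OF refl])
    fix i
    have "dyadic_cell n i \<in> sets lborel" by (simp add: dyadic_cell_def)
    then show "(\<integral>\<^sup>+x. ennreal (child_sq u n i) * indicator (dyadic_cell n i) x \<partial>lborel) =
        ennreal (child_sq u n i * (1 / 2 ^ n))"
      by (simp only: nn_integral_cmult_indicator m ennreal_mult[OF child_sq_nonneg] zero_le_divide_1_iff
          zero_le_power zero_le_numeral)
  qed
  also have "\<dots> = ennreal (dyadic_sq (Suc n) u / 2 ^ n)"
    by (simp add: sum_ennreal child_sq_nonneg sum_divide_distrib[symmetric] sum_child_sq)
  finally show ?thesis .
qed

lemma borel_measurable_osc [measurable]: "osc u n \<in> borel_measurable borel"
  unfolding osc_def dyadic_cell_def by measurable

text \<open>Cauchy-Schwarz with weights 1/3 and 2/3. Along a chain the factor 3/2 is applied again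
  at every level; being less than 2, it loses against the factor 1/2 that each level gains in
  \<open>nn_integral_osc\<close>.\<close>

lemma norm_sum_sq_weighted: "(cmod (a + b))\<^sup>2 \<le> 3 * (cmod a)\<^sup>2 + 3/2 * (cmod b)\<^sup>2"
proof -
  have "(cmod (a + b))\<^sup>2 \<le> (cmod a + cmod b)\<^sup>2" by (intro power_mono norm_triangle_ineq) simp
  also have "\<dots> \<le> 3 * (cmod a)\<^sup>2 + 3/2 * (cmod b)\<^sup>2"
    using zero_le_power2[of "2 * cmod a - cmod b"] by (simp add: power2_eq_square algebra_simps)
  finally show ?thesis .
qed

text \<open>From one level to the next the left end of the cell around \<open>x\<close> stays or
  moves by one half step, which \<open>osc\<close> records. The chain is peeled at its coarse end,
  so that the finer remainder carries the factor 3/2.\<close>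

lemma dyadic_chain_finite:
  assumes x: "0 \<le> x" "x < 1"
  shows "(cmod (u (real (dyadic_index (n + J) x) / 2 ^ (n + J)) - u (real (dyadic_index n x) / 2 ^ n)))\<^sup>2
    \<le> 3 * (\<Sum>j<J. (3/2) ^ j * osc u (n + j) x)"
proof (induction J arbitrary: n)
  case 0 then show ?case by simp
next
  case (Suc J)
  let ?p = "\<lambda>n. u (real (dyadic_index n x) / 2 ^ n)"
  have t: "(cmod (?p (Suc n) - ?p n))\<^sup>2 \<le> osc u n x"
  proof (cases "dyadic_index (Suc n) x = 2 * dyadic_index n x")
    case True
    then show ?thesis using osc_nonneg[of u n x] by simp
  next
    case False
    then have i: "dyadic_index (Suc n) x = 2 * dyadic_index n x + 1" using dyadic_index_Suc[OF x(1), of n] by auto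
    show ?thesis unfolding i osc_eq[OF x] child_sq_def by simp
  qed
  have "(cmod (?p (n + Suc J) - ?p n))\<^sup>2 = (cmod ((?p (Suc n) - ?p n) + (?p (Suc n + J) - ?p (Suc n))))\<^sup>2" by simp
  also have "\<dots> \<le> 3 * (cmod (?p (Suc n) - ?p n))\<^sup>2 + 3/2 * (cmod (?p (Suc n + J) - ?p (Suc n)))\<^sup>2"
    by (rule norm_sum_sq_weighted)
  also have "\<dots> \<le> 3 * osc u n x + 3/2 * (3 * (\<Sum>j<J. (3/2) ^ j * osc u (Suc n + j) x))"
    by (intro add_mono mult_left_mono t Suc.IH) auto
  also have "\<dots> = 3 * (\<Sum>j<Suc J. (3/2) ^ j * osc u (n + j) x)"
    unfolding sum.lessThan_Suc_shift by (simp add: sum_distrib_left mult_ac)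
  finally show ?case .
qed

definition osc_sum :: "(real \<Rightarrow> complex) \<Rightarrow> nat \<Rightarrow> real \<Rightarrow> ennreal"
  where "osc_sum u n x = suminf (\<lambda>j. ennreal ((3/2) ^ j * osc u (n + j) x))"

lemma dyadic_chain:
  assumes u: "continuous_on {0..1} u" and x: "0 \<le> x" "x < 1"
  shows "ennreal ((cmod (u x - u (real (dyadic_index n x) / 2 ^ n)))\<^sup>2) \<le> 3 * osc_sum u n x"
proof (rule tendsto_upperbound)
  let ?p = "\<lambda>n. real (dyadic_index n x) / 2 ^ n"
  have "0 \<le> ?p n" "?p n \<le> 1" for n
    using dyadic_index_bounds(1)[OF x(1), of n] x(2) by (simp, linarith)
  then have "(\<lambda>J. u (?p J)) \<longlonglongrightarrow> u x"
    using x by (intro continuous_on_tendsto_compose[OF u dyadic_index_tendsto]) auto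
  then have "(\<lambda>J. u (?p (J + n))) \<longlonglongrightarrow> u x" by (rule LIMSEQ_ignore_initial_segment)
  then show "(\<lambda>J. ennreal ((cmod (u (?p (n + J)) - u (?p n)))\<^sup>2)) \<longlonglongrightarrow> ennreal ((cmod (u x - u (?p n)))\<^sup>2)"
    unfolding add.commute[of n] by (intro tendsto_intros)
  show "\<forall>\<^sub>F J in sequentially. ennreal ((cmod (u (?p (n + J)) - u (?p n)))\<^sup>2) \<le> 3 * osc_sum u n x"
  proof (rule always_eventually, rule allI)
    fix J
    have "ennreal ((cmod (u (?p (n + J)) - u (?p n)))\<^sup>2) \<le> ennreal (3 * (\<Sum>j<J. (3/2) ^ j * osc u (n + j) x))"
      by (intro ennreal_leI dyadic_chain_finite x)
    also have "\<dots> = 3 * (\<Sum>j<J. ennreal ((3/2) ^ j * osc u (n + j) x))"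
      by (subst sum_ennreal) (auto simp: ennreal_mult' osc_nonneg sum_nonneg)
    also have "\<dots> \<le> 3 * osc_sum u n x" unfolding osc_sum_def
      by (intro mult_left_mono sum_le_suminf) auto
    finally show "ennreal ((cmod (u (?p (n + J)) - u (?p n)))\<^sup>2) \<le> 3 * osc_sum u n x" .
  qed
qed simp

text \<open>Points at most one mesh width apart lie in equal or adjacent cells, so the left ends
  differ by at most one step of level \<open>n\<close>; this step is split at its midpoint to fit
  \<open>osc\<close>.\<close>

lemma dyadic_neighbours:
  assumes x: "0 \<le> x" "x < 1" and y: "0 \<le> y" "y < 1" and xy: "\<bar>x - y\<bar> \<le> (1/2) ^ n"
  shows "(cmod (u (real (dyadic_index n x) / 2 ^ n) - u (real (dyadic_index n y) / 2 ^ n)))\<^sup>2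
    \<le> 2 * (osc u n x + osc u n y)"
proof -
  have d: "(cmod (u (real (Suc i) / 2 ^ n) - u (real i / 2 ^ n)))\<^sup>2 \<le> 2 * child_sq u n i" for i
    using norm_sum_squared_le[of "u (real (Suc i) / 2 ^ n) - u (real (2 * i + 1) / 2 ^ Suc n)"
        "u (real (2 * i + 1) / 2 ^ Suc n) - u (real i / 2 ^ n)"] by (simp add: child_sq_def)
  have "dyadic_index n y \<le> Suc (dyadic_index n x)" if "0 \<le> x" "0 \<le> y" "\<bar>x - y\<bar> \<le> (1/2) ^ n" for x y
  proof -
    have "real (dyadic_index n y) / 2 ^ n \<le> y" "x < real (Suc (dyadic_index n x)) / 2 ^ n"
      using dyadic_index_bounds that by blast+
    then have "real (dyadic_index n y) / 2 ^ n < real (Suc (dyadic_index n x)) / 2 ^ n + (1/2) ^ n"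
      using that(3) by linarith
    then have "real (dyadic_index n y) < real (Suc (dyadic_index n x)) + 1" by (simp add: field_simps)
    then show ?thesis by linarith
  qed
  from this[OF x(1) y(1) xy] this[OF y(1) x(1)] xy
  have "dyadic_index n y = dyadic_index n x \<or> dyadic_index n y = Suc (dyadic_index n x) \<or>
      dyadic_index n x = Suc (dyadic_index n y)" by (auto simp: abs_minus_commute)
  then show ?thesis
    using d[of "dyadic_index n x"] d[of "dyadic_index n y"] child_sq_nonneg[of u n "dyadic_index n x"]
      child_sq_nonneg[of u n "dyadic_index n y"]
    unfolding osc_eq[OF x] osc_eq[OF y] by (auto simp: norm_minus_commute)
qed

lemma osc_le_osc_sum: "ennreal (osc u n x) \<le> osc_sum u n x"
  unfolding osc_sum_def using sum_le_suminf[of "\<lambda>j. ennreal ((3/2) ^ j * osc u (n + j) x)" "{0}"] by simp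

text \<open>Chain from \<open>x\<close> to the left end of its cell, across to the cell of
  \<open>y\<close>, and on to \<open>y\<close>. The constant is \<open>3 * 3 + 3 * 2\<close>: a
  chain and a crossing, both weighted by 3.\<close>

lemma dyadic_chain_pair:
  assumes u: "continuous_on {0..1} u" and x: "0 \<le> x" "x < 1" and y: "0 \<le> y" "y < 1"
    and xy: "\<bar>x - y\<bar> \<le> (1/2) ^ n"
  shows "ennreal ((cmod (u x - u y))\<^sup>2) \<le> 15 * (osc_sum u n x + osc_sum u n y)"
proof -
  define p q where "p = u (real (dyadic_index n x) / 2 ^ n)" and "q = u (real (dyadic_index n y) / 2 ^ n)"
  have "(cmod (u x - u y))\<^sup>2 = (cmod ((u x - p) + ((p - q) + (q - u y))))\<^sup>2" by simp
  also have "\<dots> \<le> 3 * (cmod (u x - p))\<^sup>2 + 3/2 * (cmod ((p - q) + (q - u y)))\<^sup>2"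
    by (rule norm_sum_sq_weighted)
  also have "\<dots> \<le> 3 * (cmod (u x - p))\<^sup>2 + 3/2 * (2 * (cmod (p - q))\<^sup>2 + 2 * (cmod (q - u y))\<^sup>2)"
    by (intro add_left_mono mult_left_mono norm_sum_squared_le) auto
  also have "\<dots> = 3 * (cmod (u x - p))\<^sup>2 + 3 * (cmod (p - q))\<^sup>2 + 3 * (cmod (u y - q))\<^sup>2"
    by (simp add: norm_minus_commute)
  finally have "ennreal ((cmod (u x - u y))\<^sup>2) \<le>
      ennreal (3 * (cmod (u x - p))\<^sup>2 + 3 * (cmod (p - q))\<^sup>2 + 3 * (cmod (u y - q))\<^sup>2)" by (rule ennreal_leI)
  also have "\<dots> = 3 * ennreal ((cmod (u x - p))\<^sup>2) + 3 * ennreal ((cmod (p - q))\<^sup>2) + 3 * ennreal ((cmod (u y - q))\<^sup>2)"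
    by (simp add: ennreal_mult)
  also have "\<dots> \<le> 3 * (3 * osc_sum u n x) + 3 * (2 * (osc_sum u n x + osc_sum u n y)) + 3 * (3 * osc_sum u n y)"
  proof (intro add_mono mult_left_mono)
    show "ennreal ((cmod (u x - p))\<^sup>2) \<le> 3 * osc_sum u n x" unfolding p_def by (rule dyadic_chain[OF u x])
    show "ennreal ((cmod (u y - q))\<^sup>2) \<le> 3 * osc_sum u n y" unfolding q_def by (rule dyadic_chain[OF u y])
    have "ennreal ((cmod (p - q))\<^sup>2) \<le> ennreal (2 * (osc u n x + osc u n y))"
      unfolding p_def q_def by (intro ennreal_leI dyadic_neighbours x y xy)
    also have "\<dots> = 2 * (ennreal (osc u n x) + ennreal (osc u n y))" by (simp add: ennreal_mult osc_nonneg)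
    also have "\<dots> \<le> 2 * (osc_sum u n x + osc_sum u n y)" by (intro mult_left_mono add_mono osc_le_osc_sum) auto
    finally show "ennreal ((cmod (p - q))\<^sup>2) \<le> 2 * (osc_sum u n x + osc_sum u n y)" .
  qed auto
  also have "\<dots> = 15 * (osc_sum u n x + osc_sum u n y)"
  proof -
    have "3 * (3 * a) + 3 * (2 * (a + b)) + 3 * (3 * b) = 15 * (a + b)" for a b :: ennreal
    proof -
      have "3 * (3 * a) + 3 * (2 * (a + b)) + 3 * (3 * b) = (9 * a + 6 * a) + (6 * b + 9 * b)"
        by (simp add: distrib_left mult.assoc[symmetric] add_ac)
      also have "9 * a + 6 * a = 15 * a" by (simp add: distrib_right[symmetric])
      also have "6 * b + 9 * b = 15 * b" by (simp add: distrib_right[symmetric])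
      finally show ?thesis by (simp add: distrib_left)
    qed
    then show ?thesis by blast
  qed
  finally show ?thesis .
qed

section \<open>Bound of the Gagliardo seminorm by dyadic increments\<close>

definition gagliardo :: "real \<Rightarrow> (real \<Rightarrow> complex) \<Rightarrow> ennreal"
  where "gagliardo \<alpha> u = (\<integral>\<^sup>+x\<in>{0..1}. (\<integral>\<^sup>+y\<in>{0..1}.
      ennreal ((cmod (u x - u y))\<^sup>2 / \<bar>x - y\<bar> powr (1 + 2 * \<alpha>)) \<partial>lborel) \<partial>lborel)"

text \<open>Two scales are kept apart: \<open>n\<close> is the scale of the distance between the
  points, \<open>n + j\<close> the level reached by the chains.\<close>

definition near_osc :: "(real \<Rightarrow> complex) \<Rightarrow> nat \<Rightarrow> nat \<Rightarrow> real \<times> real \<Rightarrow> ennreal"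
  where "near_osc u j n = (\<lambda>(x, y). indicator {-((1/2) ^ n)..(1/2) ^ n} (x - y) *
    (ennreal (osc u (n + j) x) + ennreal (osc u (n + j) y)))"

lemma borel_measurable_near_osc [measurable]: "near_osc u j n \<in> borel_measurable (lborel \<Otimes>\<^sub>M lborel)"
  unfolding near_osc_def by measurable

text \<open>Each section of the band has length \<open>2 * (1/2) ^ n\<close>, and the two variables
  contribute equally, hence the 4.\<close>

lemma nn_integral_near_osc:
  "(\<integral>\<^sup>+z. near_osc u j n z \<partial>(lborel \<Otimes>\<^sub>M lborel)) = ennreal (4 * (1/2) ^ n * (dyadic_sq (Suc (n + j)) u / 2 ^ (n + j)))"
proof -
  define r :: real where "r = (1/2) ^ n"
  have r: "r > 0" by (simp add: r_def)
  define W where "W x = ennreal (osc u (n + j) x)" for x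
  have [measurable]: "W \<in> borel_measurable borel" unfolding W_def by measurable
  have m1: "(\<lambda>(x, y). indicator {-r..r} (x - y) * W x) \<in> borel_measurable (lborel \<Otimes>\<^sub>M lborel)"
    and m2: "(\<lambda>(x, y). indicator {-r..r} (x - y) * W y) \<in> borel_measurable (lborel \<Otimes>\<^sub>M lborel)"
    by measurable
  have ind: "(\<integral>\<^sup>+y. indicator {-r..r} (x - y) * c \<partial>lborel) = ennreal (2 * r) * c"
    "(\<integral>\<^sup>+y. indicator {-r..r} (y - x) * c \<partial>lborel) = ennreal (2 * r) * c" for x c
  proof -
    have "indicator {-r..r} (x - y) = (indicator {x - r..x + r} y :: ennreal)"
      "indicator {-r..r} (y - x) = (indicator {x - r..x + r} y :: ennreal)" for y
      by (auto simp: indicator_def)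
    then show "(\<integral>\<^sup>+y. indicator {-r..r} (x - y) * c \<partial>lborel) = ennreal (2 * r) * c"
      "(\<integral>\<^sup>+y. indicator {-r..r} (y - x) * c \<partial>lborel) = ennreal (2 * r) * c"
      using r by (simp_all add: nn_integral_multc)
  qed
  have "(\<integral>\<^sup>+z. near_osc u j n z \<partial>(lborel \<Otimes>\<^sub>M lborel)) =
      (\<integral>\<^sup>+z. (\<lambda>(x, y). indicator {-r..r} (x - y) * W x) z + (\<lambda>(x, y). indicator {-r..r} (x - y) * W y) z \<partial>(lborel \<Otimes>\<^sub>M lborel))"
    by (intro nn_integral_cong) (auto simp: near_osc_def r_def W_def distrib_left)
  also have "\<dots> = (\<integral>\<^sup>+z. (\<lambda>(x, y). indicator {-r..r} (x - y) * W x) z \<partial>(lborel \<Otimes>\<^sub>M lborel)) +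
      (\<integral>\<^sup>+z. (\<lambda>(x, y). indicator {-r..r} (x - y) * W y) z \<partial>(lborel \<Otimes>\<^sub>M lborel))"
    by (intro nn_integral_add m1 m2)
  also have "(\<integral>\<^sup>+z. (\<lambda>(x, y). indicator {-r..r} (x - y) * W x) z \<partial>(lborel \<Otimes>\<^sub>M lborel)) =
      (\<integral>\<^sup>+x. \<integral>\<^sup>+y. indicator {-r..r} (x - y) * W x \<partial>lborel \<partial>lborel)"
    by (subst lborel.nn_integral_fst[OF m1, symmetric]) simp
  also have "(\<integral>\<^sup>+z. (\<lambda>(x, y). indicator {-r..r} (x - y) * W y) z \<partial>(lborel \<Otimes>\<^sub>M lborel)) =
      (\<integral>\<^sup>+y. \<integral>\<^sup>+x. indicator {-r..r} (x - y) * W y \<partial>lborel \<partial>lborel)"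
    by (subst lborel_pair.nn_integral_snd[OF m2, symmetric]) simp
  also have "(\<integral>\<^sup>+x. \<integral>\<^sup>+y. indicator {-r..r} (x - y) * W x \<partial>lborel \<partial>lborel) +
      (\<integral>\<^sup>+y. \<integral>\<^sup>+x. indicator {-r..r} (x - y) * W y \<partial>lborel \<partial>lborel) = 2 * (ennreal (2 * r) * (\<integral>\<^sup>+x. W x \<partial>lborel))"
    unfolding ind by (simp add: nn_integral_cmult flip: mult_2)
  also have "(\<integral>\<^sup>+x. W x \<partial>lborel) = ennreal (dyadic_sq (Suc (n + j)) u / 2 ^ (n + j))"
    unfolding W_def by (rule nn_integral_osc)
  also have "2 * (ennreal (2 * r) * ennreal (dyadic_sq (Suc (n + j)) u / 2 ^ (n + j)))
      = ennreal (2 * ((2 * r) * (dyadic_sq (Suc (n + j)) u / 2 ^ (n + j))))"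
  proof -
    have "ennreal (2 * ((2 * r) * X)) = ennreal 2 * (ennreal (2 * r) * ennreal X)" if "0 \<le> X" for X
      using r that by (simp only: ennreal_mult mult_nonneg_nonneg zero_le_numeral less_imp_le)
    from this[of "dyadic_sq (Suc (n + j)) u / 2 ^ (n + j)"] show ?thesis by (simp add: dyadic_sq_nonneg)
  qed
  finally show ?thesis by (simp add: r_def mult.assoc)
qed

lemma dyadic_scale:
  fixes d :: real
  assumes "0 < d" "d < 1"
  obtains n where "(1/2) ^ Suc n < d" "d \<le> (1/2) ^ n"
proof -
  have ex: "\<exists>n. (1/2) ^ n < d" using real_arch_pow_inv[OF assms(1), of "1/2"] by auto
  define N where "N = (LEAST n. (1/2) ^ n < d)"
  have N: "(1/2) ^ N < d" unfolding N_def by (rule LeastI_ex[OF ex])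
  then have "N \<noteq> 0" using assms(2) by (metis less_asym power_0)
  then obtain n where n: "N = Suc n" by (metis not0_implies_Suc)
  have "\<not> (1/2) ^ n < d" using not_less_Least[of n "\<lambda>n. (1/2) ^ n < d"] n by (simp add: N_def[symmetric])
  then show thesis using that N n by simp
qed

text \<open>For pairs at distance about \<open>(1/2) ^ n\<close> the kernel is at most
  \<open>K n\<close>, and chaining bounds the difference by oscillations at levels
  \<open>n + j\<close> with weight \<open>(3/2) ^ j\<close>. Integration leaves
  \<open>(3/4) ^ j * q ^ n\<close> times the squared increments of level \<open>n + j + 1\<close>;
  the sum over \<open>n\<close> is then dominated by the given series and the sum over
  \<open>j\<close> is geometric. The constant 480 is \<open>15 * 4 * 2 * 4\<close>, from chaining,
  band, kernel and geometric series.\<close>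

lemma gagliardo_le:
  assumes u: "continuous_on {0..1} u" and \<alpha>: "1/2 \<le> \<alpha>"
    and S: "summable (\<lambda>n. (2 powr (2 * \<alpha> - 1)) ^ n * dyadic_sq n u)"
  shows "gagliardo \<alpha> u \<le> ennreal (480 * 4 powr \<alpha> * (suminf (\<lambda>n. (2 powr (2 * \<alpha> - 1)) ^ n * dyadic_sq n u)))"
proof -
  define K where "K n = (2 ^ Suc n) powr (1 + 2 * \<alpha>)" for n :: nat
  define c where "c j n = 15 * K n * (3/2) ^ j" for j n :: nat
  have c0: "0 \<le> c j n" for j n by (simp add: c_def K_def)
  define q where "q = 2 powr (2 * \<alpha> - 1)"
  \<comment> \<open>A majorant that does not refer to the scale of the pair: the row belonging to
    the right \<open>n\<close> is one of its nonnegative terms.\<close>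
  define R where "R z = suminf (\<lambda>j. suminf (\<lambda>n. ennreal (c j n) * near_osc u j n z))" for z
  have Rm: "R \<in> borel_measurable (lborel \<Otimes>\<^sub>M lborel)" unfolding R_def by measurable
  have pt: "ennreal ((cmod (u x - u y))\<^sup>2 / \<bar>x - y\<bar> powr (1 + 2 * \<alpha>)) \<le> R (x, y)"
    if x: "0 \<le> x" "x < 1" and y: "0 \<le> y" "y < 1" for x y
  proof (cases "x = y")
    case True
    then show ?thesis by simp
  next
    case False
    then have "0 < \<bar>x - y\<bar>" "\<bar>x - y\<bar> < 1" using x y by auto
    then obtain n where n: "(1/2) ^ Suc n < \<bar>x - y\<bar>" "\<bar>x - y\<bar> \<le> (1/2) ^ n"
      by (rule dyadic_scale)
    have "1 / \<bar>x - y\<bar> < 2 ^ Suc n"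
      using n(1) False by (simp add: field_simps)
    then have "(1 / \<bar>x - y\<bar>) powr (1 + 2 * \<alpha>) \<le> K n"
      unfolding K_def using \<alpha> by (intro powr_mono2) auto
    then have "1 / \<bar>x - y\<bar> powr (1 + 2 * \<alpha>) \<le> K n" using False by (simp add: powr_divide)
    then have "(cmod (u x - u y))\<^sup>2 * (1 / \<bar>x - y\<bar> powr (1 + 2 * \<alpha>)) \<le> (cmod (u x - u y))\<^sup>2 * K n"
      by (intro mult_left_mono) auto
    then have "(cmod (u x - u y))\<^sup>2 / \<bar>x - y\<bar> powr (1 + 2 * \<alpha>) \<le> (cmod (u x - u y))\<^sup>2 * K n" by simp
    then have "ennreal ((cmod (u x - u y))\<^sup>2 / \<bar>x - y\<bar> powr (1 + 2 * \<alpha>)) \<le> ennreal (K n) * ennreal ((cmod (u x - u y))\<^sup>2)"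
      by (subst ennreal_mult[symmetric]) (auto simp: K_def mult.commute intro: ennreal_leI)
    also have "\<dots> \<le> ennreal (K n) * (15 * (osc_sum u n x + osc_sum u n y))"
      by (intro mult_left_mono dyadic_chain_pair u x y n) simp
    also have "\<dots> = ennreal (15 * K n) * suminf (\<lambda>j. ennreal ((3/2) ^ j * osc u (n + j) x) + ennreal ((3/2) ^ j * osc u (n + j) y))"
      unfolding osc_sum_def by (subst suminf_add) (auto simp: ennreal_mult K_def mult_ac)
    also have "\<dots> = suminf (\<lambda>j. ennreal (c j n) * near_osc u j n (x, y))"
    proof -
      have "x - y \<in> {- ((1/2) ^ n)..(1/2) ^ n}" using n(2) by auto
      then have "ennreal (c j n) * near_osc u j n (x, y) = ennreal (15 * K n) * (ennreal ((3/2) ^ j * osc u (n + j) x) + ennreal ((3/2) ^ j * osc u (n + j) y))" for j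
        unfolding near_osc_def c_def K_def by (simp add: ennreal_mult osc_nonneg distrib_left distrib_right mult_ac)
      then show ?thesis by simp
    qed
    also have "\<dots> \<le> R (x, y)"
      unfolding R_def
    proof (rule suminf_le)
      fix j
      show "ennreal (c j n) * near_osc u j n (x, y) \<le> suminf (\<lambda>n. ennreal (c j n) * near_osc u j n (x, y))"
        using sum_le_suminf[of "\<lambda>n. ennreal (c j n) * near_osc u j n (x, y)" "{n}"] by simp
    qed auto
    finally show ?thesis .
  qed
  \<comment> \<open>\<open>pt\<close> leaves out the coordinate 1, where the half-open cells
    end.\<close>
  have ae: "AE x in lborel. x \<noteq> (1::real)" by (rule AE_lborel_singleton)
  have "gagliardo \<alpha> u \<le> (\<integral>\<^sup>+x. \<integral>\<^sup>+y. R (x, y) \<partial>lborel \<partial>lborel)"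
    unfolding gagliardo_def
  proof (rule nn_integral_mono_AE, rule AE_mp[OF ae], rule AE_I2, rule impI)
    fix x :: real assume "x \<noteq> 1"
    show "(\<integral>\<^sup>+y\<in>{0..1}. ennreal ((cmod (u x - u y))\<^sup>2 / \<bar>x - y\<bar> powr (1 + 2 * \<alpha>)) \<partial>lborel) * indicator {0..1} x
        \<le> (\<integral>\<^sup>+y. R (x, y) \<partial>lborel)"
    proof (cases "x \<in> {0..1}")
      case True
      have "(\<integral>\<^sup>+y\<in>{0..1}. ennreal ((cmod (u x - u y))\<^sup>2 / \<bar>x - y\<bar> powr (1 + 2 * \<alpha>)) \<partial>lborel) \<le> (\<integral>\<^sup>+y. R (x, y) \<partial>lborel)"
      proof (rule nn_integral_mono_AE, rule AE_mp[OF ae], rule AE_I2, rule impI)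
        fix y :: real assume "y \<noteq> 1"
        then show "ennreal ((cmod (u x - u y))\<^sup>2 / \<bar>x - y\<bar> powr (1 + 2 * \<alpha>)) * indicator {0..1} y \<le> R (x, y)"
          using pt[of x y] True \<open>x \<noteq> 1\<close> by (cases "y \<in> {0..1}") auto
      qed
      then show ?thesis using True by simp
    qed simp
  qed
  also have "\<dots> = (\<integral>\<^sup>+z. R z \<partial>(lborel \<Otimes>\<^sub>M lborel))" by (rule lborel.nn_integral_fst[OF Rm])
  also have "\<dots> = suminf (\<lambda>j. suminf (\<lambda>n. \<integral>\<^sup>+z. ennreal (c j n) * near_osc u j n z \<partial>(lborel \<Otimes>\<^sub>M lborel)))"
    unfolding R_def by (subst nn_integral_suminf, measurable) (intro suminf_cong nn_integral_suminf, measurable)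
  also have "\<dots> = suminf (\<lambda>j. suminf (\<lambda>n. ennreal (c j n * (4 * (1/2) ^ n * (dyadic_sq (Suc (n + j)) u / 2 ^ (n + j))))))"
    by (simp only: nn_integral_cmult[OF borel_measurable_near_osc] nn_integral_near_osc ennreal_mult'[OF c0])
  also have "\<dots> \<le> suminf (\<lambda>j. suminf (\<lambda>n. ennreal (120 * 4 powr \<alpha> * (3/4) ^ j) * ennreal (q ^ (n + Suc j) * dyadic_sq (n + Suc j) u)))"
  proof (intro suminf_le)
    fix j n
    \<comment> \<open>Kernel against area of the band:
      \<open>2 powr ((n + 1) * (1 + 2 * \<alpha>))\<close> divided by \<open>4 ^ n\<close>.\<close>
    have "K n * (1/2) ^ n / 2 ^ n = 2 * 4 powr \<alpha> * q ^ n"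
    proof -
      have "K n = (2 powr real (Suc n)) powr (1 + 2 * \<alpha>)" unfolding K_def by (subst powr_realpow) auto
      also have "\<dots> = 2 powr (1 + 2 * \<alpha> + (real n * (2 * \<alpha> - 1) + real n + real n))"
        by (simp add: powr_powr algebra_simps)
      also have "\<dots> = 2 * 4 powr \<alpha> * (2 powr (2 * \<alpha> - 1)) powr real n * (2 ^ n * 2 ^ n)"
      proof -
        have "2 powr (2 * \<alpha>) = (4::real) powr \<alpha>" using powr_powr[of 2 2 \<alpha>] by simp
        moreover have "2 powr (2 * real n) = (2::real) ^ n * 2 ^ n"
          using powr_realpow[of 2 "2 * n"] by (simp add: power_even_eq power2_eq_square)
        ultimately show ?thesis by (simp add: powr_add powr_powr powr_realpow mult.commute[of "real n"])
      qed
      also have "(2 powr (2 * \<alpha> - 1)) powr real n = q ^ n" by (simp add: q_def powr_realpow)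
      finally show ?thesis by (simp add: power_one_over)
    qed
    moreover have "(4::real) ^ j = 2 ^ j * 2 ^ j" by (simp flip: power_mult_distrib)
    then have "c j n * (4 * (1/2) ^ n * (dyadic_sq (Suc (n + j)) u / 2 ^ (n + j))) =
        60 * (K n * (1/2) ^ n / 2 ^ n) * (3/4) ^ j * dyadic_sq (Suc (n + j)) u"
      by (simp add: c_def power_add power_divide mult_ac)
    \<comment> \<open>\<open>\<alpha> \<ge> 1/2\<close> means \<open>q \<ge> 1\<close>, so the
      exponent may be raised to the level of the increments.\<close>
    moreover have "q ^ n \<le> q ^ (n + Suc j)"
      using \<alpha> by (intro power_increasing) (auto simp: q_def ge_one_powr_ge_zero)
    then have "(120 * 4 powr \<alpha> * (3/4) ^ j * dyadic_sq (n + Suc j) u) * q ^ n \<le>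
        (120 * 4 powr \<alpha> * (3/4) ^ j * dyadic_sq (n + Suc j) u) * q ^ (n + Suc j)"
      by (intro mult_left_mono) (auto simp: dyadic_sq_nonneg)
    ultimately have "c j n * (4 * (1/2) ^ n * (dyadic_sq (Suc (n + j)) u / 2 ^ (n + j))) \<le>
        120 * 4 powr \<alpha> * (3/4) ^ j * (q ^ (n + Suc j) * dyadic_sq (n + Suc j) u)"
      by (simp add: mult_ac)
    then show "ennreal (c j n * (4 * (1/2) ^ n * (dyadic_sq (Suc (n + j)) u / 2 ^ (n + j)))) \<le>
        ennreal (120 * 4 powr \<alpha> * (3/4) ^ j) * ennreal (q ^ (n + Suc j) * dyadic_sq (n + Suc j) u)"
      by (subst ennreal_mult[symmetric]) (auto simp: q_def dyadic_sq_nonneg intro: ennreal_leI)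
  qed auto
  also have "\<dots> \<le> suminf (\<lambda>j. ennreal (120 * 4 powr \<alpha> * (3/4) ^ j) * ennreal (suminf (\<lambda>n. q ^ n * dyadic_sq n u)))"
  proof (intro suminf_le)
    fix j
    let ?a = "\<lambda>n. q ^ n * dyadic_sq n u"
    have a0: "0 \<le> ?a n" for n by (simp add: q_def dyadic_sq_nonneg)
    have s: "summable ?a" using S by (simp add: q_def)
    have "suminf (\<lambda>n. ennreal (?a (n + Suc j))) = ennreal (suminf (\<lambda>n. ?a (n + Suc j)))"
      using s a0 by (intro suminf_ennreal2) (simp only: a0, simp only: summable_iff_shift[of ?a "Suc j"])
    also have "\<dots> \<le> ennreal (suminf ?a)"
      using suminf_split_initial_segment[OF s, of "Suc j"] a0 by (intro ennreal_leI) (simp add: sum_nonneg)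
    finally show "suminf (\<lambda>n. ennreal (120 * 4 powr \<alpha> * (3/4) ^ j) * ennreal (?a (n + Suc j))) \<le>
        ennreal (120 * 4 powr \<alpha> * (3/4) ^ j) * ennreal (suminf ?a)"
      by (simp only: ennreal_suminf_cmult) (intro mult_left_mono, auto)
  qed auto
  also have "\<dots> = ennreal (120 * 4 powr \<alpha> * 4) * ennreal (suminf (\<lambda>n. q ^ n * dyadic_sq n u))"
  proof -
    have "(\<lambda>j. (3/4::real) ^ j) sums 4" using geometric_sums[of "3/4::real"] by simp
    then have "(\<lambda>j. 120 * 4 powr \<alpha> * (3/4::real) ^ j) sums (120 * 4 powr \<alpha> * 4)" by (rule sums_mult)
    then have "suminf (\<lambda>j. ennreal (120 * 4 powr \<alpha> * (3/4) ^ j)) = ennreal (120 * 4 powr \<alpha> * 4)"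
      by (intro suminf_ennreal_eq) auto
    then show ?thesis by (simp only: ennreal_suminf_multc)
  qed
  also have "\<dots> = ennreal (480 * 4 powr \<alpha> * (suminf (\<lambda>n. q ^ n * dyadic_sq n u)))"
    by (subst ennreal_mult[symmetric]) (use S in \<open>auto simp: q_def dyadic_sq_nonneg intro!: suminf_nonneg\<close>)
  finally show ?thesis by (simp add: q_def)
qed

text \<open>Dyadic points of an edge are vertices of finer edges, and the gasket is closed.\<close>

lemma edge_in_gasket:
  assumes e: "e \<in> oriented_edges m" and x: "0 \<le> x" "x \<le> 1"
  shows "source e + x *\<^sub>R (target e - source e) \<in> gasket"
proof (cases "x = 1")
  case True
  then show ?thesis using oriented_edges_lattice(6)[OF e] by simp
next
  case False
  let ?p = "\<lambda>n. source e + (real (dyadic_index n x) / 2 ^ n) *\<^sub>R (target e - source e)"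
  have "?p n \<in> gasket" for n
    using oriented_edges_lattice(5)[OF subedge_oriented[OF e dyadic_index_less[of x n]]] x False
    by (simp add: source_subedge)
  moreover have "?p \<longlonglongrightarrow> source e + x *\<^sub>R (target e - source e)"
    by (intro tendsto_intros dyadic_index_tendsto x)
  ultimately show ?thesis
    by (rule closed_sequentially[OF compact_imp_closed[OF compact_gasket]])
qed

lemma continuous_on_edge_trace:
  assumes "e \<in> all_oriented_edges"
  shows "continuous_on {0..1} (edge_trace e f)"
proof -
  obtain m where e: "e \<in> oriented_edges m" using assms by (auto simp: all_oriented_edges_def)
  have "continuous_on gasket (fe_apply f)" using fe_apply[of f] by (simp add: finite_energy_def)
  then show ?thesis unfolding edge_trace_def
    by (rule continuous_on_compose2) (use edge_in_gasket[OF e] in \<open>auto intro!: continuous_intros\<close>)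
qed

section \<open>A bounded extension from dyadic averages\<close>

text \<open>Cell means replace values at dyadic points: they are continuous in the Sobolev norm,
  while point values of an element of the space are not even determined up to norm 0.\<close>

definition avg :: "nat \<Rightarrow> nat \<Rightarrow> (real \<Rightarrow> complex) \<Rightarrow> complex"
  where "avg n k u = 2 ^ n * (LINT x:dyadic_cell n k|lborel. u x)"

lemma dyadic_cell_borel [measurable]: "dyadic_cell n k \<in> sets borel"
  by (simp add: dyadic_cell_def)

lemma emeasure_dyadic_cell: "emeasure lborel (dyadic_cell n k) = ennreal (1 / 2 ^ n)"
  by (simp add: dyadic_cell_def divide_right_mono add_divide_distrib)

lemma measure_dyadic_cell: "measure lborel (dyadic_cell n k) = 1 / 2 ^ n"
  by (simp add: measure_def emeasure_dyadic_cell)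

lemma dyadic_cell_subset:
  assumes "k < 2 ^ n" shows "dyadic_cell n k \<subseteq> {0..1}"
proof -
  have "real (Suc k) \<le> 2 ^ n" by (rule real_Suc_le_two_power[OF assms])
  then have "real (Suc k) / 2 ^ n \<le> 1" by simp
  moreover have "0 \<le> real k / 2 ^ n" by simp
  ultimately show ?thesis unfolding dyadic_cell_def
    by (intro subsetI) (simp only: atLeastLessThan_iff atLeastAtMost_iff, linarith)
qed

lemma set_integrable_dyadic_cell:
  fixes u :: "real \<Rightarrow> complex"
  assumes "set_integrable lborel {0..1} u" "k < 2 ^ n"
  shows "set_integrable lborel (dyadic_cell n k) u"
  by (rule set_integrable_subset[OF assms(1)]) (use dyadic_cell_subset[OF assms(2)] in auto)

lemma set_integrable_cell_const: "set_integrable lborel (dyadic_cell n k) (\<lambda>x. c :: complex)"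
  unfolding set_integrable_def by (simp add: emeasure_dyadic_cell integrable_indicator_iff)

lemma avg_const: "avg n k (\<lambda>x. c) = c"
  by (simp add: avg_def set_integral_const emeasure_dyadic_cell measure_dyadic_cell scaleR_conv_of_real)

lemma avg_add:
  assumes "set_integrable lborel {0..1} u" "set_integrable lborel {0..1} v" "k < 2 ^ n"
  shows "avg n k (\<lambda>x. u x + v x) = avg n k u + avg n k v"
  unfolding avg_def
  by (subst set_integral_add(2)) (auto intro: set_integrable_dyadic_cell assms simp: distrib_left)

lemma avg_scale: "avg n k (\<lambda>x. c * u x) = c * avg n k u"
  by (simp add: avg_def)

lemma avg_diff_const:
  assumes "set_integrable lborel (dyadic_cell n k) u"
  shows "avg n k (\<lambda>x. u x - c) = avg n k u - c"
proof -
  have "avg n k (\<lambda>x. u x - c) = avg n k u - avg n k (\<lambda>x. c)"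
    unfolding avg_def by (subst set_integral_diff(2)) (auto intro: assms set_integrable_cell_const simp: right_diff_distrib)
  then show ?thesis by (simp add: avg_const)
qed

lemma two_power_ennreal: "(2::ennreal) ^ n = ennreal (2 ^ n)"
  using ennreal_power[of 2 n] by simp

text \<open>Jensen's inequality for the square, obtained from
  \<open>a * b \<le> (a\<^sup>2 + b\<^sup>2) / 2\<close> by absorbing half of the left side.\<close>

lemma avg_sq_le:
  "ennreal ((cmod (avg n k w))\<^sup>2) \<le> 2 ^ n * (\<integral>\<^sup>+x\<in>dyadic_cell n k. ennreal ((cmod (w x))\<^sup>2) \<partial>lborel)"
proof (cases "set_integrable lborel (dyadic_cell n k) w")
  case False
  \<comment> \<open>The integral of a non-integrable function is 0 by convention, so the average
    vanishes.\<close>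
  then show ?thesis
    by (simp add: avg_def set_lebesgue_integral_def set_integrable_def not_integrable_integral_eq)
next
  case True
  define M where "M = cmod (avg n k w)"
  define X where "X = (\<integral>\<^sup>+x\<in>dyadic_cell n k. ennreal ((cmod (w x))\<^sup>2) \<partial>lborel)"
  have wm: "(\<lambda>x. indicator (dyadic_cell n k) x *\<^sub>R w x) \<in> borel_measurable lborel"
    using True unfolding set_integrable_def by (rule borel_measurable_integrable)
  then have nm: "(\<lambda>x. cmod (indicator (dyadic_cell n k) x *\<^sub>R w x)) \<in> borel_measurable lborel"
    using measurable_compose[OF _ borel_measurable_norm] by blast
  have Xeq: "X = (\<integral>\<^sup>+x. ennreal ((cmod (indicator (dyadic_cell n k) x *\<^sub>R w x))\<^sup>2) \<partial>lborel)"
    unfolding X_def by (intro nn_integral_cong) (auto simp: indicator_def)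
  have m: "M / 2 ^ n = cmod (LINT x:dyadic_cell n k|lborel. w x)" by (simp add: M_def avg_def norm_mult norm_power)
  have "ennreal (M\<^sup>2 / 2 ^ n) = ennreal M * ennreal (M / 2 ^ n)"
    by (subst ennreal_mult[symmetric]) (auto simp: M_def power2_eq_square)
  moreover have "ennreal (M / 2 ^ n) \<le> (\<integral>\<^sup>+x. ennreal (cmod (indicator (dyadic_cell n k) x *\<^sub>R w x)) \<partial>lborel)"
    unfolding m set_lebesgue_integral_def
    using integral_norm_bound_ennreal[OF True[unfolded set_integrable_def]] by simp
  ultimately have "ennreal (M\<^sup>2 / 2 ^ n) \<le> ennreal M * (\<integral>\<^sup>+x. ennreal (cmod (indicator (dyadic_cell n k) x *\<^sub>R w x)) \<partial>lborel)"
    by (simp add: mult_left_mono)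
  also have "\<dots> = (\<integral>\<^sup>+x. ennreal M * ennreal (cmod (indicator (dyadic_cell n k) x *\<^sub>R w x)) \<partial>lborel)"
    by (rule nn_integral_cmult[symmetric]) (use nm in measurable)
  also have "\<dots> \<le> (\<integral>\<^sup>+x. ennreal (M\<^sup>2 / 2) * indicator (dyadic_cell n k) x +
      ennreal (1/2) * ennreal ((cmod (indicator (dyadic_cell n k) x *\<^sub>R w x))\<^sup>2) \<partial>lborel)"
  proof (intro nn_integral_mono)
    fix x
    show "ennreal M * ennreal (cmod (indicator (dyadic_cell n k) x *\<^sub>R w x)) \<le> ennreal (M\<^sup>2 / 2) * indicator (dyadic_cell n k) x +
      ennreal (1/2) * ennreal ((cmod (indicator (dyadic_cell n k) x *\<^sub>R w x))\<^sup>2)"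
    proof (cases "x \<in> dyadic_cell n k")
      case True
      have "M * cmod (w x) \<le> M\<^sup>2 / 2 + 1/2 * (cmod (w x))\<^sup>2"
        using mult_le_half_squares[of M "cmod (w x)"] by simp
      then have "ennreal (M * cmod (w x)) \<le> ennreal (M\<^sup>2 / 2 + 1/2 * (cmod (w x))\<^sup>2)" by (rule ennreal_leI)
      then show ?thesis using True by (simp only: ennreal_mult ennreal_plus M_def norm_ge_zero zero_le_power2
          divide_nonneg_nonneg zero_le_numeral mult_nonneg_nonneg zero_le_one indicator_simps scaleR_one mult_1_right)
    qed simp
  qed
  also have "\<dots> = ennreal (M\<^sup>2 / 2) * ennreal (1 / 2 ^ n) + ennreal (1/2) * X"
    unfolding Xeq using nm
    by (subst nn_integral_add) (auto simp: nn_integral_cmult nn_integral_cmult_indicator emeasure_dyadic_cell)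
  finally have le: "ennreal (M\<^sup>2 / 2 ^ n) \<le> ennreal (M\<^sup>2 / 2 / 2 ^ n) + ennreal (1/2) * X"
    by (simp add: ennreal_mult[symmetric])
  \<comment> \<open>The absorption subtracts, hence the separate treatment of an infinite
    \<open>X\<close>.\<close>
  have "ennreal (M\<^sup>2) \<le> 2 ^ n * X"
  proof (cases X)
    case (real r)
    have "ennreal (1/2) * ennreal r = ennreal (1/2 * r)" by (rule ennreal_mult'[symmetric]) simp
    moreover have "ennreal (M\<^sup>2 / 2 / 2 ^ n) + ennreal (1/2 * r) = ennreal (M\<^sup>2 / 2 / 2 ^ n + 1/2 * r)"
      by (rule ennreal_plus[symmetric]) (use real in auto)
    ultimately have "ennreal (M\<^sup>2 / 2 ^ n) \<le> ennreal (M\<^sup>2 / 2 / 2 ^ n + 1/2 * r)"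
      using le real by simp
    then have "M\<^sup>2 / 2 ^ n \<le> M\<^sup>2 / 2 / 2 ^ n + 1/2 * r" using real by (subst (asm) ennreal_le_iff) auto
    then have "M\<^sup>2 \<le> 2 ^ n * r" by (simp add: field_simps)
    then have "ennreal (M\<^sup>2) \<le> ennreal (2 ^ n * r)" by (rule ennreal_leI)
    then show ?thesis using real by (simp add: two_power_ennreal ennreal_mult')
  next
    case top
    then show ?thesis by (simp add: ennreal_mult_top)
  qed
  then show ?thesis by (simp add: M_def X_def)
qed

lemma avg_dev_sq_le:
  assumes "set_integrable lborel (dyadic_cell n k) u"
  shows "ennreal ((cmod (avg n k u - c))\<^sup>2) \<le> 2 ^ n * (\<integral>\<^sup>+x\<in>dyadic_cell n k. ennreal ((cmod (u x - c))\<^sup>2) \<partial>lborel)"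
  using avg_sq_le[of n k "\<lambda>x. u x - c"] by (simp add: avg_diff_const[OF assms])

lemma avg_refine:
  assumes "set_integrable lborel {0..1} u" "k < 2 ^ n"
  shows "avg n k u = (avg (Suc n) (2 * k) u + avg (Suc n) (2 * k + 1) u) / 2"
proof -
  have "dyadic_cell n k = dyadic_cell (Suc n) (2 * k) \<union> dyadic_cell (Suc n) (2 * k + 1)"
    "dyadic_cell (Suc n) (2 * k) \<inter> dyadic_cell (Suc n) (2 * k + 1) = {}"
    by (auto simp: dyadic_cell_def field_simps)
  moreover have "2 * k < 2 ^ Suc n" "2 * k + 1 < 2 ^ Suc n" using assms(2) by auto
  then have "set_integrable lborel (dyadic_cell (Suc n) (2 * k)) u"
    "set_integrable lborel (dyadic_cell (Suc n) (2 * k + 1)) u"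
    using set_integrable_dyadic_cell[OF assms(1)] by blast+
  ultimately have "(LINT x:dyadic_cell n k|lborel. u x) =
      (LINT x:dyadic_cell (Suc n) (2 * k)|lborel. u x) + (LINT x:dyadic_cell (Suc n) (2 * k + 1)|lborel. u x)"
    using set_integral_Un by metis
  then show ?thesis by (simp add: avg_def distrib_left)
qed

lemma sobolevD:
  assumes "u \<in> sobolev \<alpha>"
  shows "(\<lambda>x. indicator {0..1} x *\<^sub>R u x) \<in> borel_measurable borel"
    "ennreal ((sobolev_norm \<alpha> u)\<^sup>2) = sobolev_sq \<alpha> u"
    "gagliardo \<alpha> u \<le> ennreal ((sobolev_norm \<alpha> u)\<^sup>2)"
    "(\<integral>\<^sup>+x\<in>{0..1}. ennreal ((cmod (u x))\<^sup>2) \<partial>lborel) \<le> ennreal ((sobolev_norm \<alpha> u)\<^sup>2)"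
    "set_integrable lborel {0..1} u"
proof -
  show m: "(\<lambda>x. indicator {0..1} x *\<^sub>R u x) \<in> borel_measurable borel"
    using assms by (simp add: sobolev_def set_borel_measurable_def)
  have fin: "sobolev_sq \<alpha> u < \<infinity>" using assms by (simp add: sobolev_def)
  then show eq: "ennreal ((sobolev_norm \<alpha> u)\<^sup>2) = sobolev_sq \<alpha> u" by (simp add: sobolev_norm_def)
  show "gagliardo \<alpha> u \<le> ennreal ((sobolev_norm \<alpha> u)\<^sup>2)"
    "(\<integral>\<^sup>+x\<in>{0..1}. ennreal ((cmod (u x))\<^sup>2) \<partial>lborel) \<le> ennreal ((sobolev_norm \<alpha> u)\<^sup>2)"
    unfolding eq by (simp_all add: gagliardo_def sobolev_sq_def)
  show "set_integrable lborel {0..1} u"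
    unfolding set_integrable_def
  proof (rule integrableI_bounded)
    show "(\<lambda>x. indicator {0..1} x *\<^sub>R u x) \<in> borel_measurable lborel" using m by simp
    have "(\<integral>\<^sup>+x. ennreal (cmod (indicator {0..1} x *\<^sub>R u x)) \<partial>lborel) \<le>
        (\<integral>\<^sup>+x. indicator {0..1} x + ennreal ((cmod (indicator {0..1} x *\<^sub>R u x))\<^sup>2) \<partial>lborel)"
    proof (intro nn_integral_mono)
      fix x :: real
      have "cmod (u x) \<le> 1 + (cmod (u x))\<^sup>2" using mult_le_half_squares[of 1 "cmod (u x)", unfolded one_power2 mult_1_left] zero_le_power2[of "cmod (u x)"]
        by argo
      then show "ennreal (cmod (indicator {0..1} x *\<^sub>R u x)) \<le> indicator {0..1} x + ennreal ((cmod (indicator {0..1} x *\<^sub>R u x))\<^sup>2)"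
        by (auto simp: indicator_def ennreal_plus[symmetric] ennreal_1[symmetric] simp del: ennreal_plus ennreal_1 intro: ennreal_leI)
    qed
    also have "\<dots> = 1 + (\<integral>\<^sup>+x\<in>{0..1}. ennreal ((cmod (u x))\<^sup>2) \<partial>lborel)"
    proof -
      have "(\<integral>\<^sup>+x\<in>{0..1}. ennreal ((cmod (u x))\<^sup>2) \<partial>lborel) = (\<integral>\<^sup>+x. ennreal ((cmod (indicator {0..1} x *\<^sub>R u x))\<^sup>2) \<partial>lborel)"
        by (intro nn_integral_cong) (auto simp: indicator_def)
      moreover have "(\<lambda>x. ennreal ((cmod (indicator {0..1} x *\<^sub>R u x))\<^sup>2)) \<in> borel_measurable lborel" using m by measurable
      ultimately show ?thesis by (subst nn_integral_add) auto
    qed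
    also have "\<dots> < \<infinity>"
      using fin by (auto simp: sobolev_sq_def)
    finally show "(\<integral>\<^sup>+x. ennreal (cmod (indicator {0..1} x *\<^sub>R u x)) \<partial>lborel) < \<infinity>" .
  qed
qed

text \<open>The hypothesis gives measurability of \<open>u\<close> on \<open>[0,1]\<close> only, so
  the integrand is compared with that of the zero extension \<open>w\<close>, which agrees where
  both variables lie in \<open>[0,1]\<close>.\<close>

lemma gagliardo_inner_measurable:
  assumes u: "set_integrable lborel {0..1} u" and A: "A \<in> sets borel" "A \<subseteq> {0..1}"
  shows "(\<lambda>x. (\<integral>\<^sup>+y\<in>{0..1}. ennreal ((cmod (u x - u y))\<^sup>2 / \<bar>x - y\<bar> powr p) \<partial>lborel) * indicator A x) \<in> borel_measurable lborel"
proof -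
  define w where "w x = indicator {0..1} x *\<^sub>R u x" for x :: real
  have [measurable]: "w \<in> borel_measurable borel"
    using borel_measurable_integrable[OF u[unfolded set_integrable_def]] by (simp add: w_def[abs_def])
  note A(1)[measurable]
  have "(\<lambda>x. (\<integral>\<^sup>+y\<in>{0..1}. ennreal ((cmod (w x - w y))\<^sup>2 / \<bar>x - y\<bar> powr p) \<partial>lborel) * indicator A x) \<in> borel_measurable lborel"
    by measurable
  also have "(\<lambda>x. (\<integral>\<^sup>+y\<in>{0..1}. ennreal ((cmod (w x - w y))\<^sup>2 / \<bar>x - y\<bar> powr p) \<partial>lborel) * indicator A x) =
      (\<lambda>x. (\<integral>\<^sup>+y\<in>{0..1}. ennreal ((cmod (u x - u y))\<^sup>2 / \<bar>x - y\<bar> powr p) \<partial>lborel) * indicator A x)"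
  proof
    fix x
    show "(\<integral>\<^sup>+y\<in>{0..1}. ennreal ((cmod (w x - w y))\<^sup>2 / \<bar>x - y\<bar> powr p) \<partial>lborel) * indicator A x =
        (\<integral>\<^sup>+y\<in>{0..1}. ennreal ((cmod (u x - u y))\<^sup>2 / \<bar>x - y\<bar> powr p) \<partial>lborel) * indicator A x"
    proof (cases "x \<in> A")
      case True
      then have "x \<in> {0..1}" using A by blast
      then have "(\<integral>\<^sup>+y\<in>{0..1}. ennreal ((cmod (w x - w y))\<^sup>2 / \<bar>x - y\<bar> powr p) \<partial>lborel) =
          (\<integral>\<^sup>+y\<in>{0..1}. ennreal ((cmod (u x - u y))\<^sup>2 / \<bar>x - y\<bar> powr p) \<partial>lborel)"
        by (intro nn_integral_cong) (auto simp: w_def indicator_def)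
      then show ?thesis by simp
    qed simp
  qed
  finally show ?thesis .
qed

definition avg_var :: "nat \<Rightarrow> (real \<Rightarrow> complex) \<Rightarrow> real"
  where "avg_var n u = L2_set (\<lambda>k. cmod (avg n (Suc k) u - avg n k u)) {..<2 ^ n - 1}"

text \<open>Jensen twice, in \<open>x\<close> over cell \<open>k + 1\<close> and in \<open>y\<close>
  over cell \<open>k\<close>. Such points are at most two mesh widths apart, so 1 is dominated by
  \<open>(2 / 2 ^ n) powr (1 + 2 * \<alpha>)\<close> times the kernel.\<close>

lemma avg_step_sq_le:
  assumes u: "set_integrable lborel {0..1} u" and k: "Suc k < 2 ^ n" and \<alpha>: "0 \<le> \<alpha>"
  shows "ennreal ((cmod (avg n (Suc k) u - avg n k u))\<^sup>2) \<le> ennreal (4 ^ n * (2 / 2 ^ n) powr (1 + 2 * \<alpha>)) *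
    (\<integral>\<^sup>+x\<in>dyadic_cell n (Suc k). (\<integral>\<^sup>+y\<in>{0..1}. ennreal ((cmod (u x - u y))\<^sup>2 / \<bar>x - y\<bar> powr (1 + 2 * \<alpha>)) \<partial>lborel) \<partial>lborel)"
proof -
  define G where "G x = (\<integral>\<^sup>+y\<in>{0..1}. ennreal ((cmod (u x - u y))\<^sup>2 / \<bar>x - y\<bar> powr (1 + 2 * \<alpha>)) \<partial>lborel)" for x
  define C where "C = (2 / 2 ^ n) powr (1 + 2 * \<alpha>)"
  have k': "k < 2 ^ n" using k by simp
  have ik: "set_integrable lborel (dyadic_cell n k) u" "set_integrable lborel (dyadic_cell n (Suc k)) u"
    using set_integrable_dyadic_cell[OF u] k k' by blast+
  have "ennreal ((cmod (avg n (Suc k) u - avg n k u))\<^sup>2) \<le>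
      2 ^ n * (\<integral>\<^sup>+x\<in>dyadic_cell n (Suc k). ennreal ((cmod (u x - avg n k u))\<^sup>2) \<partial>lborel)"
    by (rule avg_dev_sq_le[OF ik(2)])
  also have "\<dots> \<le> 2 ^ n * (\<integral>\<^sup>+x\<in>dyadic_cell n (Suc k). (ennreal (2 ^ n * C) * G x) \<partial>lborel)"
  proof (intro mult_left_mono nn_integral_mono)
    fix x :: real
    show "ennreal ((cmod (u x - avg n k u))\<^sup>2) * indicator (dyadic_cell n (Suc k)) x \<le>
        ennreal (2 ^ n * C) * G x * indicator (dyadic_cell n (Suc k)) x"
    proof (cases "x \<in> dyadic_cell n (Suc k)")
      case True
      have "ennreal ((cmod (u x - avg n k u))\<^sup>2) \<le> 2 ^ n * (\<integral>\<^sup>+y\<in>dyadic_cell n k. ennreal ((cmod (u y - u x))\<^sup>2) \<partial>lborel)"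
        using avg_dev_sq_le[OF ik(1), of "u x"] by (simp add: norm_minus_commute)
      also have "\<dots> \<le> 2 ^ n * (\<integral>\<^sup>+y. ennreal C * (ennreal ((cmod (u x - u y))\<^sup>2 / \<bar>x - y\<bar> powr (1 + 2 * \<alpha>)) * indicator {0..1} y) \<partial>lborel)"
      proof (intro mult_left_mono nn_integral_mono)
        fix y :: real
        show "ennreal ((cmod (u y - u x))\<^sup>2) * indicator (dyadic_cell n k) y \<le>
            ennreal C * (ennreal ((cmod (u x - u y))\<^sup>2 / \<bar>x - y\<bar> powr (1 + 2 * \<alpha>)) * indicator {0..1} y)"
        proof (cases "y \<in> dyadic_cell n k")
          case y: True
          \<comment> \<open>Half-open cells keep \<open>x\<close> and \<open>y\<close> distinct, so
            the kernel is not a division by 0.\<close>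
          have "0 < x - y" "x - y \<le> 2 / 2 ^ n" using y True by (auto simp: dyadic_cell_def add_divide_distrib)
          then have "\<bar>x - y\<bar> powr (1 + 2 * \<alpha>) \<le> C" "0 < \<bar>x - y\<bar> powr (1 + 2 * \<alpha>)"
            unfolding C_def using \<alpha> by (auto intro: powr_mono2)
          then have "(cmod (u y - u x))\<^sup>2 \<le> C * ((cmod (u x - u y))\<^sup>2 / \<bar>x - y\<bar> powr (1 + 2 * \<alpha>))"
            using mult_right_mono[of "\<bar>x - y\<bar> powr (1 + 2 * \<alpha>)" C "(cmod (u x - u y))\<^sup>2 / \<bar>x - y\<bar> powr (1 + 2 * \<alpha>)"]
            by (simp add: norm_minus_commute)
          then have "ennreal ((cmod (u y - u x))\<^sup>2) \<le> ennreal C * ennreal ((cmod (u x - u y))\<^sup>2 / \<bar>x - y\<bar> powr (1 + 2 * \<alpha>))"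
            by (subst ennreal_mult[symmetric]) (auto simp: C_def intro: ennreal_leI)
          then show ?thesis using y dyadic_cell_subset[OF k'] by auto
        qed simp
      qed auto
      also have "\<dots> = 2 ^ n * (ennreal C * G x)"
        unfolding G_def
      proof (subst nn_integral_cmult)
        have m: "(\<lambda>y. indicator {0..1} y *\<^sub>R u y) \<in> borel_measurable lborel"
          using u unfolding set_integrable_def by (rule borel_measurable_integrable)
        have "(\<lambda>y. ennreal ((cmod (u x - indicator {0..1} y *\<^sub>R u y))\<^sup>2 / \<bar>x - y\<bar> powr (1 + 2 * \<alpha>)) * indicator {0..1} y) \<in> borel_measurable lborel"
          using m by measurable
        also have "(\<lambda>y. ennreal ((cmod (u x - indicator {0..1} y *\<^sub>R u y))\<^sup>2 / \<bar>x - y\<bar> powr (1 + 2 * \<alpha>)) * indicator {0..1} y) =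
            (\<lambda>y. ennreal ((cmod (u x - u y))\<^sup>2 / \<bar>x - y\<bar> powr (1 + 2 * \<alpha>)) * indicator {0..1} y)"
          by (auto simp: fun_eq_iff indicator_def)
        finally show "(\<lambda>y. ennreal ((cmod (u x - u y))\<^sup>2 / \<bar>x - y\<bar> powr (1 + 2 * \<alpha>)) * indicator {0..1} y) \<in> borel_measurable lborel" .
      qed simp
      also have "\<dots> = ennreal (2 ^ n * C) * G x"
        by (simp add: two_power_ennreal ennreal_mult' mult.assoc)
      finally show ?thesis using True by simp
    qed simp
  qed auto
  also have "(\<integral>\<^sup>+x\<in>dyadic_cell n (Suc k). (ennreal (2 ^ n * C) * G x) \<partial>lborel) = ennreal (2 ^ n * C) * (\<integral>\<^sup>+x\<in>dyadic_cell n (Suc k). G x \<partial>lborel)"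
    using gagliardo_inner_measurable[OF u, of "dyadic_cell n (Suc k)"] dyadic_cell_subset[OF k]
    by (subst nn_integral_cmult[symmetric]) (auto simp: G_def mult.assoc)
  also have "2 ^ n * (ennreal (2 ^ n * C) * (\<integral>\<^sup>+x\<in>dyadic_cell n (Suc k). G x \<partial>lborel)) = ennreal (4 ^ n * C) * (\<integral>\<^sup>+x\<in>dyadic_cell n (Suc k). G x \<partial>lborel)"
  proof -
    have "(4::real) ^ n = 2 ^ n * 2 ^ n" by (simp flip: power_mult_distrib)
    then show ?thesis by (simp add: two_power_ennreal ennreal_mult' mult.assoc)
  qed
  finally show ?thesis by (simp add: G_def C_def)
qed

text \<open>The square root of \<open>4 ^ n * (2 / 2 ^ n) powr (1 + 2 * \<alpha>)\<close>: a
  geometric sequence, with ratio below 1 exactly when \<open>\<alpha> > 1/2\<close>.\<close>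

definition var_bound :: "real \<Rightarrow> nat \<Rightarrow> real"
  where "var_bound \<alpha> n = 2 powr (1/2 + \<alpha>) * (2 powr (1/2 - \<alpha>)) ^ n"

text \<open>The inner integrals of \<open>avg_step_sq_le\<close> run over disjoint cells, so
  together they are at most the whole seminorm.\<close>

lemma avg_var_le:
  assumes u: "u \<in> sobolev \<alpha>" and \<alpha>: "0 \<le> \<alpha>"
  shows "avg_var n u \<le> var_bound \<alpha> n * sobolev_norm \<alpha> u"
proof -
  note ui = sobolevD(5)[OF u]
  define G where "G x = (\<integral>\<^sup>+y\<in>{0..1}. ennreal ((cmod (u x - u y))\<^sup>2 / \<bar>x - y\<bar> powr (1 + 2 * \<alpha>)) \<partial>lborel)" for x
  define C where "C = 4 ^ n * (2 / 2 ^ n) powr (1 + 2 * \<alpha>)"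
  have C: "C \<ge> 0" by (simp add: C_def)
  let ?N = "sobolev_norm \<alpha> u"
  have k: "Suc k < 2 ^ n" if "k < 2 ^ n - 1" for k using that by simp
  have "ennreal ((avg_var n u)\<^sup>2) = (\<Sum>k<2 ^ n - 1. ennreal ((cmod (avg n (Suc k) u - avg n k u))\<^sup>2))"
    by (simp add: avg_var_def L2_set_def sum_nonneg)
  also have "\<dots> \<le> (\<Sum>k<2 ^ n - 1. ennreal C * (\<integral>\<^sup>+x\<in>dyadic_cell n (Suc k). G x \<partial>lborel))"
    unfolding C_def G_def using k by (intro sum_mono avg_step_sq_le[OF ui _ \<alpha>]) auto
  also have "\<dots> = ennreal C * (\<Sum>k<2 ^ n - 1. \<integral>\<^sup>+x\<in>dyadic_cell n (Suc k). G x \<partial>lborel)"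
    by (rule sum_distrib_left[symmetric])
  also have "(\<Sum>k<2 ^ n - 1. \<integral>\<^sup>+x\<in>dyadic_cell n (Suc k). G x \<partial>lborel) =
      (\<integral>\<^sup>+x. (\<Sum>k<2 ^ n - 1. G x * indicator (dyadic_cell n (Suc k)) x) \<partial>lborel)"
  proof (rule nn_integral_sum[symmetric])
    fix i assume "i \<in> {..<2 ^ n - 1::nat}"
    then show "(\<lambda>x. G x * indicator (dyadic_cell n (Suc i)) x) \<in> borel_measurable lborel"
      unfolding G_def using k by (intro gagliardo_inner_measurable[OF ui] dyadic_cell_subset) auto
  qed
  also have "ennreal C * \<dots> \<le> ennreal C * (\<integral>\<^sup>+x. G x * indicator {0..1} x \<partial>lborel)"
  proof (intro mult_left_mono nn_integral_mono)
    fix x :: real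
    have "(\<Sum>k<2 ^ n - 1. indicator (dyadic_cell n (Suc k)) x) \<le> (indicator {0..1} x :: ennreal)"
    proof (cases "x \<in> {0..1}")
      case True
      then have "(\<Sum>k<2 ^ n - 1. indicator (dyadic_cell n (Suc k)) x) = (\<Sum>k<2 ^ n - 1. if dyadic_index n x = Suc k then 1 else (0::ennreal))"
        by (intro sum.cong) (auto simp: indicator_def dyadic_index_iff)
      also have "\<dots> \<le> 1"
      proof (cases "dyadic_index n x")
        case (Suc m)
        then show ?thesis by (simp add: eq_commute[of m])
      qed simp
      finally show ?thesis using True by simp
    next
      case False
      then have "indicator (dyadic_cell n (Suc i)) x = (0::ennreal)" if "i < 2 ^ n - 1" for i
        using dyadic_cell_subset[OF k[OF that]] by (auto simp: indicator_def)
      then show ?thesis by simp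
    qed
    then show "(\<Sum>k<2 ^ n - 1. G x * indicator (dyadic_cell n (Suc k)) x) \<le> G x * indicator {0..1} x"
      unfolding sum_distrib_left[symmetric] by (intro mult_left_mono) auto
  qed auto
  also have "(\<integral>\<^sup>+x. G x * indicator {0..1} x \<partial>lborel) = gagliardo \<alpha> u" by (simp add: gagliardo_def G_def)
  also have "ennreal C * gagliardo \<alpha> u \<le> ennreal C * ennreal (?N\<^sup>2)" by (intro mult_left_mono sobolevD(3)[OF u]) auto
  also have "\<dots> = ennreal (C * ?N\<^sup>2)" using C by (simp add: ennreal_mult)
  finally have "(avg_var n u)\<^sup>2 \<le> C * ?N\<^sup>2" using C by (simp add: ennreal_le_iff)
  also have "C = (var_bound \<alpha> n)\<^sup>2"
  proof -
    have p: "(2::real) ^ m = 2 powr real m" for m by (simp add: powr_realpow)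
    have "(4::real) ^ n = 2 ^ (2 * n)" by (simp add: power_mult)
    then have "C = 2 powr real (2 * n) * (2 powr 1 / 2 powr real n) powr (1 + 2 * \<alpha>)" by (simp add: C_def p)
    also have "\<dots> = 2 powr (real (2 * n) + (1 - real n) * (1 + 2 * \<alpha>))"
      by (simp only: powr_diff[symmetric] powr_powr powr_add[symmetric])
    also have "real (2 * n) + (1 - real n) * (1 + 2 * \<alpha>) = 2 * ((1/2 + \<alpha>) + real n * (1/2 - \<alpha>))"
      by (simp add: algebra_simps)
    also have "2 powr \<dots> = (2 powr ((1/2 + \<alpha>) + real n * (1/2 - \<alpha>)))\<^sup>2"
      by (simp only: power2_eq_square powr_add[symmetric] mult_2)
    also have "2 powr ((1/2 + \<alpha>) + real n * (1/2 - \<alpha>)) = var_bound \<alpha> n"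
      unfolding var_bound_def powr_add by (simp add: powr_powr mult.commute flip: powr_realpow)
    finally show ?thesis .
  qed
  finally have "(avg_var n u)\<^sup>2 \<le> (var_bound \<alpha> n * ?N)\<^sup>2" by (simp add: power_mult_distrib)
  then show ?thesis
    by (rule power2_le_imp_le) (simp add: var_bound_def sobolev_norm_def)
qed

section \<open>Trapezoid sums of averages and their limit\<close>

definition avg_form :: "nat \<Rightarrow> (real \<Rightarrow> complex) \<Rightarrow> (real \<Rightarrow> complex) \<Rightarrow> complex"
  where "avg_form n u v = (\<Sum>k<2 ^ n - 1. (avg n k u + avg n (Suc k) u) / 2 * (avg n (Suc k) v - avg n k v))"

text \<open>\<open>p\<close>, \<open>q\<close> are fine averages, \<open>A\<close>, \<open>C\<close>
  the coarse ones, and \<open>a\<close>, \<open>c\<close> half the differences inside a coarse cell.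
  The change under refinement contains values of \<open>A\<close> times fine increments, for which
  Cauchy-Schwarz gives nothing small. Summation by parts arranges that these telescope to the two
  ends, and that all other terms are products of two increments.\<close>

lemma trapezoid_refine:
  fixes p q :: "nat \<Rightarrow> complex"
  defines "A k \<equiv> (p (2 * k) + p (2 * k + 1)) / 2" and "a k \<equiv> (p (2 * k + 1) - p (2 * k)) / 2"
    and "C k \<equiv> (q (2 * k) + q (2 * k + 1)) / 2" and "c k \<equiv> (q (2 * k + 1) - q (2 * k)) / 2"
  shows "(\<Sum>k<2 * L + 1. (p k + p (Suc k)) / 2 * (q (Suc k) - q k)) - (\<Sum>k<L. (A k + A (Suc k)) / 2 * (C (Suc k) - C k)) =
    A 0 * c 0 + A L * c L + (\<Sum>k<L. (A (Suc k) - A k) * (c (Suc k) - c k) / 2) +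
    (\<Sum>k<L. (a k - a (Suc k)) / 2 * (C (Suc k) - C k - c k - c (Suc k)))"
proof (induction L)
  case 0
  show ?case by (simp add: A_def c_def field_simps)
next
  case (Suc L)
  define t where "t k = (p k + p (Suc k)) / 2 * (q (Suc k) - q k)" for k
  have s: "(\<Sum>k<2 * Suc L + 1. t k) = (\<Sum>k<2 * L + 1. t k) + t (2 * L + 1) + t (2 * L + 2)"
    by (simp add: eval_nat_numeral)
  have n: "Suc (2 * L + 1) = 2 * Suc L" "Suc (2 * L + 2) = 2 * Suc L + 1" "2 * L + 2 = 2 * Suc L" by simp_all
  define p0 p1 p2 p3 q0 q1 q2 q3 where "p0 = p (2 * L)" and "p1 = p (2 * L + 1)" and "p2 = p (2 * Suc L)" and "p3 = p (2 * Suc L + 1)"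
    and "q0 = q (2 * L)" and "q1 = q (2 * L + 1)" and "q2 = q (2 * Suc L)" and "q3 = q (2 * Suc L + 1)"
  note d = p0_def p1_def p2_def p3_def q0_def q1_def q2_def q3_def
  have T: "t (2 * L + 1) + t (2 * L + 2) = (p1 + p2) / 2 * (q2 - q1) + (p2 + p3) / 2 * (q3 - q2)"
    by (simp add: t_def d)
  \<comment> \<open>The first two terms on the right are the telescoping part.\<close>
  have key: "t (2 * L + 1) + t (2 * L + 2) - (A L + A (Suc L)) / 2 * (C (Suc L) - C L) =
     A (Suc L) * c (Suc L) - A L * c L + (A (Suc L) - A L) * (c (Suc L) - c L) / 2 +
     (a L - a (Suc L)) / 2 * (C (Suc L) - C L - c L - c (Suc L))"
    unfolding T A_def a_def C_def c_def d[symmetric] by (simp add: field_simps)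
  show ?case
    using Suc key unfolding t_def[symmetric] s sum.lessThan_Suc by (simp add: algebra_simps)
qed

lemma L2_set_reindex_le:
  assumes "finite B" "inj_on h A" "h ` A \<subseteq> B"
  shows "L2_set (\<lambda>k. f (h k)) A \<le> L2_set f B"
proof -
  have "(\<Sum>k\<in>A. (f (h k))\<^sup>2) = (\<Sum>j\<in>h ` A. (f j)\<^sup>2)" using assms(2) by (simp add: sum.reindex)
  also have "\<dots> \<le> (\<Sum>j\<in>B. (f j)\<^sup>2)" using assms by (intro sum_mono2) auto
  finally show ?thesis by (simp add: L2_set_def)
qed

lemma norm_sum_mult_le_L2:
  "cmod (\<Sum>k\<in>A. f k * g k) \<le> L2_set (\<lambda>k. cmod (f k)) A * L2_set (\<lambda>k. cmod (g k)) A"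
proof -
  have "cmod (\<Sum>k\<in>A. f k * g k) \<le> (\<Sum>k\<in>A. \<bar>cmod (f k)\<bar> * \<bar>cmod (g k)\<bar>)"
    by (rule order_trans[OF norm_sum]) (simp add: norm_mult)
  also have "\<dots> \<le> L2_set (\<lambda>k. cmod (f k)) A * L2_set (\<lambda>k. cmod (g k)) A" by (rule L2_set_mult_ineq)
  finally show ?thesis .
qed

lemma L2_set_norm_triangle:
  "L2_set (\<lambda>k. cmod (f k - g k)) A \<le> L2_set (\<lambda>k. cmod (f k)) A + L2_set (\<lambda>k. cmod (g k)) A"
  by (rule order_trans[OF L2_set_mono L2_set_triangle_ineq]) (auto simp: norm_triangle_ineq4)

lemma L2_set_half: "L2_set (\<lambda>k. cmod (f k / 2)) A = L2_set (\<lambda>k. cmod (f k)) A / 2"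
  using L2_set_right_distrib[of "1/2" "\<lambda>k. cmod (f k)" A] by (simp add: norm_divide mult.commute)

lemma avg_step_le_var: "Suc k < 2 ^ n \<Longrightarrow> cmod (avg n (Suc k) u - avg n k u) \<le> avg_var n u"
  unfolding avg_var_def
  using member_le_L2_set[of "{..<2 ^ n - 1}" k "\<lambda>k. cmod (avg n (Suc k) u - avg n k u)"] by simp

text \<open>Cauchy-Schwarz on the sums of \<open>trapezoid_refine\<close>. Only the two end averages
  remain undifferenced; \<open>end_avg_le\<close> bounds them.\<close>

lemma avg_form_Suc_diff:
  assumes u: "set_integrable lborel {0..1} u" and v: "set_integrable lborel {0..1} v"
  shows "cmod (avg_form (Suc n) u v - avg_form n u v) \<le>
    (cmod (avg n 0 u) + cmod (avg n (2 ^ n - 1) u)) / 2 * avg_var (Suc n) v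
    + avg_var n u * avg_var (Suc n) v / 2 + avg_var (Suc n) u * (avg_var n v + avg_var (Suc n) v) / 2"
proof -
  define L where "L = (2::nat) ^ n - 1"
  have "(1::nat) \<le> 2 ^ n" by simp
  then have L: "Suc L = 2 ^ n" "2 ^ Suc n - 1 = 2 * L + 1" unfolding L_def power_Suc by linarith+
  define p q where "p k = avg (Suc n) k u" and "q k = avg (Suc n) k v" for k
  define A a C c where "A k = (p (2 * k) + p (2 * k + 1)) / 2" and "a k = (p (2 * k + 1) - p (2 * k)) / 2"
    and "C k = (q (2 * k) + q (2 * k + 1)) / 2" and "c k = (q (2 * k + 1) - q (2 * k)) / 2" for k
  have AC: "avg n k u = A k" "avg n k v = C k" if "k \<le> L" for k
  proof -
    have "k < 2 ^ n" using that L(1) by linarith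
    then show "avg n k u = A k" "avg n k v = C k"
      using avg_refine[OF u] avg_refine[OF v] by (simp_all add: A_def C_def p_def q_def)
  qed
  have n1: "avg_form (Suc n) u v = (\<Sum>k<2 * L + 1. (p k + p (Suc k)) / 2 * (q (Suc k) - q k))"
    unfolding avg_form_def L p_def q_def ..
  have n0: "avg_form n u v = (\<Sum>k<L. (A k + A (Suc k)) / 2 * (C (Suc k) - C k))"
    unfolding avg_form_def L_def[symmetric] by (intro sum.cong refl) (simp add: AC Suc_leI)
  let ?N = "\<lambda>f. L2_set (\<lambda>k. cmod (f k)) {..<L}"
  have half: "?N a \<le> avg_var (Suc n) u / 2" "?N (\<lambda>k. a (Suc k)) \<le> avg_var (Suc n) u / 2"
    "?N c \<le> avg_var (Suc n) v / 2" "?N (\<lambda>k. c (Suc k)) \<le> avg_var (Suc n) v / 2"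
    "cmod (c 0) \<le> avg_var (Suc n) v / 2" "cmod (c L) \<le> avg_var (Suc n) v / 2"
  proof -
    \<comment> \<open>The differences inside coarse cells are the fine increments of even index, so
      their square sum is part of the one in \<open>avg_var (Suc n)\<close>.\<close>
    have R: "L2_set (\<lambda>k. cmod ((x (2 * h k + 1) - x (2 * h k)) / 2)) {..<L} \<le>
        L2_set (\<lambda>k. cmod (x (Suc k) - x k)) {..<2 * L + 1} / 2"
      if "inj h" "\<And>k. k < L \<Longrightarrow> h k \<le> L" for x :: "nat \<Rightarrow> complex" and h
      unfolding L2_set_half
      using that L2_set_reindex_le[of "{..<2 * L + 1}" "\<lambda>k. 2 * h k" "{..<L}" "\<lambda>k. cmod (x (Suc k) - x k)"]
      by (force simp: inj_on_def inj_def)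
    show "?N a \<le> avg_var (Suc n) u / 2" "?N c \<le> avg_var (Suc n) v / 2"
      using R[of "\<lambda>k. k" p] R[of "\<lambda>k. k" q] unfolding a_def c_def avg_var_def L p_def q_def by simp_all
    show "?N (\<lambda>k. a (Suc k)) \<le> avg_var (Suc n) u / 2" "?N (\<lambda>k. c (Suc k)) \<le> avg_var (Suc n) v / 2"
      using R[of Suc p] R[of Suc q] unfolding a_def c_def avg_var_def L p_def q_def by simp_all
    show "cmod (c 0) \<le> avg_var (Suc n) v / 2" "cmod (c L) \<le> avg_var (Suc n) v / 2"
      using avg_step_le_var[of 0 "Suc n" v] avg_step_le_var[of "2 * L" "Suc n" v] L
      unfolding c_def q_def by (simp_all add: norm_divide)
  qed
  have full: "?N (\<lambda>k. A (Suc k) - A k) = avg_var n u" "?N (\<lambda>k. C (Suc k) - C k) = avg_var n v"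
    unfolding avg_var_def L_def[symmetric] by (intro L2_set_cong refl; simp add: AC Suc_leI)+
  define Y where "Y = A 0 * c 0 + A L * c L +
      (\<Sum>k<L. (A (Suc k) - A k) * ((c (Suc k) - c k) / 2)) +
      (\<Sum>k<L. (a k - a (Suc k)) / 2 * (C (Suc k) - C k - c k - c (Suc k)))"
  have Y: "avg_form (Suc n) u v - avg_form n u v = Y"
    unfolding n1 n0 Y_def times_divide_eq_right unfolding A_def a_def C_def c_def by (rule trapezoid_refine)
  have "cmod (A 0 * c 0 + A L * c L + (\<Sum>k<L. (A (Suc k) - A k) * ((c (Suc k) - c k) / 2)) + (\<Sum>k<L. (a k - a (Suc k)) / 2 * (C (Suc k) - C k - c k - c (Suc k)))) \<le>
      cmod (A 0) * (avg_var (Suc n) v / 2) + cmod (A L) * (avg_var (Suc n) v / 2) +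
      avg_var n u * (avg_var (Suc n) v / 2) + avg_var (Suc n) u / 2 * (avg_var n v + avg_var (Suc n) v)"
  proof (intro norm_triangle_le add_mono)
    show "cmod (A 0 * c 0) \<le> cmod (A 0) * (avg_var (Suc n) v / 2)" "cmod (A L * c L) \<le> cmod (A L) * (avg_var (Suc n) v / 2)"
      unfolding norm_mult by (intro mult_left_mono half norm_ge_zero)+
    have "?N (\<lambda>k. (c (Suc k) - c k) / 2) \<le> avg_var (Suc n) v / 2"
      unfolding L2_set_half using L2_set_norm_triangle[of "\<lambda>k. c (Suc k)" c "{..<L}"] half by linarith
    then show "cmod (\<Sum>k<L. (A (Suc k) - A k) * ((c (Suc k) - c k) / 2)) \<le> avg_var n u * (avg_var (Suc n) v / 2)"
      by (intro order_trans[OF norm_sum_mult_le_L2] mult_mono) (auto simp: full L2_set_nonneg avg_var_def)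
    have "?N (\<lambda>k. (a k - a (Suc k)) / 2) \<le> avg_var (Suc n) u / 2"
      unfolding L2_set_half using L2_set_norm_triangle[of a "\<lambda>k. a (Suc k)" "{..<L}"] half by linarith
    moreover have "?N (\<lambda>k. C (Suc k) - C k - c k - c (Suc k)) \<le> avg_var n v + avg_var (Suc n) v"
      using L2_set_norm_triangle[of "\<lambda>k. C (Suc k) - C k - c k" "\<lambda>k. c (Suc k)" "{..<L}"]
        L2_set_norm_triangle[of "\<lambda>k. C (Suc k) - C k" c "{..<L}"] half full by linarith
    ultimately show "cmod (\<Sum>k<L. (a k - a (Suc k)) / 2 * (C (Suc k) - C k - c k - c (Suc k)))
        \<le> avg_var (Suc n) u / 2 * (avg_var n v + avg_var (Suc n) v)"
      by (intro order_trans[OF norm_sum_mult_le_L2] mult_mono) (auto simp: L2_set_nonneg avg_var_def)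
  qed
  then have "cmod Y \<le>
      cmod (A 0) * (avg_var (Suc n) v / 2) + cmod (A L) * (avg_var (Suc n) v / 2) +
      avg_var n u * (avg_var (Suc n) v / 2) + avg_var (Suc n) u / 2 * (avg_var n v + avg_var (Suc n) v)" unfolding Y_def .
  moreover have "A 0 = avg n 0 u" "A L = avg n (2 ^ n - 1) u"
    using AC(1)[of 0] AC(1)[of L] by (simp_all add: L_def)
  ultimately show ?thesis unfolding Y by (simp add: field_simps)
qed

text \<open>A discrete trace inequality. The outermost average changes from one level to the next by
  at most one fine increment, and the bounds for these increments are summable for
  \<open>\<alpha> > 1/2\<close>; thus boundary values are controlled by the norm.\<close>

lemma end_avg_le:
  assumes u: "u \<in> sobolev \<alpha>" and \<alpha>: "1/2 < \<alpha>" and k: "k = (\<lambda>n. 0) \<or> k = (\<lambda>n. 2 ^ n - 1)"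
  shows "cmod (avg n (k n) u) \<le> (1 + (\<Sum>i<n. var_bound \<alpha> (Suc i))) * sobolev_norm \<alpha> u"
proof (induction n)
  case 0
  have "ennreal ((cmod (avg 0 0 u))\<^sup>2) \<le> (\<integral>\<^sup>+x\<in>dyadic_cell 0 0. ennreal ((cmod (u x))\<^sup>2) \<partial>lborel)"
    using avg_sq_le[of 0 0 u] by simp
  also have "\<dots> \<le> (\<integral>\<^sup>+x\<in>{0..1}. ennreal ((cmod (u x))\<^sup>2) \<partial>lborel)"
    by (intro nn_integral_mono) (auto simp: dyadic_cell_def indicator_def)
  also have "\<dots> \<le> ennreal ((sobolev_norm \<alpha> u)\<^sup>2)" by (rule sobolevD(4)[OF u])
  finally have "(cmod (avg 0 0 u))\<^sup>2 \<le> (sobolev_norm \<alpha> u)\<^sup>2" by (simp add: ennreal_le_iff)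
  then have "cmod (avg 0 0 u) \<le> sobolev_norm \<alpha> u" by (rule power2_le_imp_le) (simp add: sobolev_norm_def)
  then show ?case using k by auto
next
  case (Suc n)
  have kn: "k n < 2 ^ n" "k (Suc n) = 2 * k n \<or> k (Suc n) = 2 * k n + 1" using k by (auto simp: diff_mult_distrib2 less_imp_diff_less) 
  define p q where "p = avg (Suc n) (2 * k n) u" and "q = avg (Suc n) (2 * k n + 1) u"
  have "avg n (k n) u = (p + q) / 2" unfolding p_def q_def by (rule avg_refine[OF sobolevD(5)[OF u] kn(1)])
  moreover have "avg (Suc n) (k (Suc n)) u = p \<or> avg (Suc n) (k (Suc n)) u = q" using kn(2) by (auto simp: p_def q_def)
  ultimately have "avg (Suc n) (k (Suc n)) u = avg n (k n) u + (p - q) / 2 \<or> avg (Suc n) (k (Suc n)) u = avg n (k n) u - (p - q) / 2"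
    by (auto simp: field_simps)
  then have "cmod (avg (Suc n) (k (Suc n)) u) \<le> cmod (avg n (k n) u) + cmod ((p - q) / 2)"
    using norm_triangle_ineq[of "avg n (k n) u" "(p - q) / 2"] norm_triangle_ineq4[of "avg n (k n) u" "(p - q) / 2"] by auto
  also have "cmod ((p - q) / 2) \<le> cmod (q - p)" by (simp add: norm_divide norm_minus_commute)
  also have "cmod (q - p) \<le> avg_var (Suc n) u"
    using avg_step_le_var[of "2 * k n" "Suc n" u] kn(1) by (simp add: p_def q_def)
  also have "avg_var (Suc n) u \<le> var_bound \<alpha> (Suc n) * sobolev_norm \<alpha> u" using \<alpha> by (intro avg_var_le[OF u]) simp
  finally show ?case using Suc by (simp add: algebra_simps)
qed

lemma var_bound_nonneg: "0 \<le> var_bound \<alpha> n"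
  by (simp add: var_bound_def)

lemma summable_var_bound:
  assumes "1/2 < \<alpha>" shows "summable (var_bound \<alpha>)"
proof -
  have "(2::real) powr (1/2 - \<alpha>) < 2 powr 0" using assms by (intro powr_less_mono) auto
  then show ?thesis unfolding var_bound_def[abs_def] by (intro summable_mult summable_geometric) simp
qed

lemma var_bound_Suc_le:
  assumes "1/2 < \<alpha>" shows "var_bound \<alpha> (Suc n) \<le> var_bound \<alpha> n"
proof -
  have "(2::real) powr (1/2 - \<alpha>) \<le> 2 powr 0" using assms by (intro powr_mono) auto
  then show ?thesis unfolding var_bound_def by (intro mult_left_mono power_decreasing) auto
qed

definition form_step :: "real \<Rightarrow> nat \<Rightarrow> real"
  where "form_step \<alpha> n = (1 + suminf (var_bound \<alpha>) + 2 * var_bound \<alpha> 0) * var_bound \<alpha> n"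

lemma avg_form_step:
  assumes u: "u \<in> sobolev \<alpha>" and v: "v \<in> sobolev \<alpha>" and \<alpha>: "1/2 < \<alpha>"
  shows "cmod (avg_form (Suc n) u v - avg_form n u v) \<le> form_step \<alpha> n * sobolev_norm \<alpha> u * sobolev_norm \<alpha> v"
proof -
  let ?U = "sobolev_norm \<alpha> u" and ?V = "sobolev_norm \<alpha> v" and ?b = "var_bound \<alpha>" and ?S = "1 + suminf (var_bound \<alpha>)"
  have nn: "0 \<le> ?U" "0 \<le> ?V" by (simp_all add: sobolev_norm_def)
  note s = summable_var_bound[OF \<alpha>]
  have b0: "?b n \<le> ?b 0" for n
    using lift_Suc_antimono_le[of ?b 0 n] var_bound_Suc_le[OF \<alpha>] by simp
  have var: "avg_var m w \<le> ?b n * sobolev_norm \<alpha> w" if "w \<in> sobolev \<alpha>" "m = n \<or> m = Suc n" for m w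
  proof -
    have "avg_var m w \<le> ?b m * sobolev_norm \<alpha> w" using \<alpha> by (intro avg_var_le[OF that(1)]) simp
    also have "\<dots> \<le> ?b n * sobolev_norm \<alpha> w"
      using that(2) var_bound_Suc_le[OF \<alpha>, of n] by (auto intro!: mult_right_mono simp: sobolev_norm_def)
    finally show ?thesis .
  qed
  have vn: "0 \<le> avg_var m w" for m w by (simp add: avg_var_def L2_set_nonneg)
  have e: "cmod (avg n 0 u) \<le> ?S * ?U" "cmod (avg n (2 ^ n - 1) u) \<le> ?S * ?U"
  proof -
    have "(\<Sum>i<n. ?b (Suc i)) = (\<Sum>i\<in>Suc ` {..<n}. ?b i)" by (simp add: sum.reindex)
    also have "\<dots> \<le> suminf ?b" by (intro sum_le_suminf s) (auto simp: var_bound_nonneg)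
    finally have "(1 + (\<Sum>i<n. ?b (Suc i))) * ?U \<le> ?S * ?U" using nn by (intro mult_right_mono) auto
    then show "cmod (avg n 0 u) \<le> ?S * ?U" "cmod (avg n (2 ^ n - 1) u) \<le> ?S * ?U"
      using end_avg_le[OF u \<alpha>, of "\<lambda>_. 0" n] end_avg_le[OF u \<alpha>, of "\<lambda>n. 2 ^ n - 1" n] by auto
  qed
  have "cmod (avg_form (Suc n) u v - avg_form n u v) \<le>
    (cmod (avg n 0 u) + cmod (avg n (2 ^ n - 1) u)) / 2 * avg_var (Suc n) v
    + avg_var n u * avg_var (Suc n) v / 2 + avg_var (Suc n) u * (avg_var n v + avg_var (Suc n) v) / 2"
    by (intro avg_form_Suc_diff sobolevD(5)[OF u] sobolevD(5)[OF v])
  also have "\<dots> \<le> (?S * ?U + ?S * ?U) / 2 * (?b n * ?V) + (?b n * ?U) * (?b n * ?V) / 2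
      + (?b n * ?U) * (?b n * ?V + ?b n * ?V) / 2"
    using e var[OF u] var[OF v] vn nn
    by (intro add_mono mult_mono divide_right_mono) (auto simp: var_bound_nonneg suminf_nonneg s)
  also have "\<dots> \<le> (?S + 2 * ?b n) * ?b n * ?U * ?V"
    using mult_nonneg_nonneg[OF mult_nonneg_nonneg[OF mult_nonneg_nonneg[OF var_bound_nonneg var_bound_nonneg] nn(1)] nn(2), of \<alpha> n \<alpha> n]
    by (simp add: field_simps)
  also have "\<dots> \<le> form_step \<alpha> n * ?U * ?V"
    unfolding form_step_def using b0[of n] nn var_bound_nonneg
    by (intro mult_right_mono) auto
  finally show ?thesis .
qed

definition weak_form :: "(real \<Rightarrow> complex) \<Rightarrow> (real \<Rightarrow> complex) \<Rightarrow> complex"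
  where "weak_form u v = lim (\<lambda>n. avg_form n u v)"

lemma summable_form_step: "1/2 < \<alpha> \<Longrightarrow> summable (form_step \<alpha>)"
  unfolding form_step_def[abs_def] by (intro summable_mult summable_var_bound)

lemma weak_form_limit:
  assumes u: "u \<in> sobolev \<alpha>" and v: "v \<in> sobolev \<alpha>" and \<alpha>: "1/2 < \<alpha>"
  shows "(\<lambda>n. avg_form n u v) \<longlonglongrightarrow> weak_form u v"
    and "cmod (weak_form u v) \<le> suminf (form_step \<alpha>) * sobolev_norm \<alpha> u * sobolev_norm \<alpha> v"
proof -
  let ?c = "\<lambda>n. form_step \<alpha> n * (sobolev_norm \<alpha> u * sobolev_norm \<alpha> v)"
  have s: "summable ?c" using summable_form_step[OF \<alpha>] by (rule summable_mult2)
  have le: "cmod (avg_form (Suc n) u v - avg_form n u v) \<le> ?c n" for n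
    using avg_form_step[OF u v \<alpha>] by (simp add: mult.assoc)
  have sm: "summable (\<lambda>n. avg_form (Suc n) u v - avg_form n u v)"
    by (rule summable_comparison_test'[OF s]) (rule le)
  have "(\<lambda>n. \<Sum>i<n. avg_form (Suc i) u v - avg_form i u v) \<longlonglongrightarrow> suminf (\<lambda>n. avg_form (Suc n) u v - avg_form n u v)"
    using sm by (rule summable_LIMSEQ)
  \<comment> \<open>At level 0 there is one cell and no gap, so \<open>avg_form 0\<close> is an
    empty sum and the telescoping series is the form itself. This gives the bound along with the
    limit.\<close>
  moreover have "(\<Sum>i<n. avg_form (Suc i) u v - avg_form i u v) = avg_form n u v" for n
    using sum_lessThan_telescope[of "\<lambda>n. avg_form n u v" n] by (simp add: avg_form_def[of 0])
  ultimately have L: "(\<lambda>n. avg_form n u v) \<longlonglongrightarrow> suminf (\<lambda>n. avg_form (Suc n) u v - avg_form n u v)" by simp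
  then have eq: "weak_form u v = suminf (\<lambda>n. avg_form (Suc n) u v - avg_form n u v)"
    unfolding weak_form_def by (rule limI)
  show "(\<lambda>n. avg_form n u v) \<longlonglongrightarrow> weak_form u v" using L eq by simp
  have "cmod (weak_form u v) \<le> suminf ?c"
    unfolding eq by (rule norm_suminf_le[OF le s])
  also have "\<dots> = suminf (form_step \<alpha>) * (sobolev_norm \<alpha> u * sobolev_norm \<alpha> v)"
    using summable_form_step[OF \<alpha>] by (rule suminf_mult2[symmetric])
  finally show "cmod (weak_form u v) \<le> suminf (form_step \<alpha>) * sobolev_norm \<alpha> u * sobolev_norm \<alpha> v"
    by (simp add: mult.assoc)
qed

lemma avg_form_add:
  assumes "set_integrable lborel {0..1} u" "set_integrable lborel {0..1} v"
  shows "avg_form n (\<lambda>x. u x + v x) w = avg_form n u w + avg_form n v w"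
    "avg_form n w (\<lambda>x. u x + v x) = avg_form n w u + avg_form n w v"
proof -
  have *: "avg n k (\<lambda>x. u x + v x) = avg n k u + avg n k v"
    "avg n (Suc k) (\<lambda>x. u x + v x) = avg n (Suc k) u + avg n (Suc k) v" if "k < 2 ^ n - 1" for k
    using that by (auto intro!: avg_add assms)
  show "avg_form n (\<lambda>x. u x + v x) w = avg_form n u w + avg_form n v w"
    "avg_form n w (\<lambda>x. u x + v x) = avg_form n w u + avg_form n w v"
    unfolding avg_form_def sum.distrib[symmetric] by (intro sum.cong refl; simp add: * field_simps)+
qed

lemma avg_form_scale:
  "avg_form n (\<lambda>x. c * u x) w = c * avg_form n u w" "avg_form n w (\<lambda>x. c * u x) = c * avg_form n w u"
  unfolding avg_form_def sum_distrib_left avg_scale by (intro sum.cong refl; simp add: field_simps)+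

section \<open>Agreement of the limit form with the integral on smooth functions\<close>

lemma vector_derivative_lipschitz:
  fixes f :: "real \<Rightarrow> complex"
  assumes "\<And>x. x \<in> {a..b} \<Longrightarrow> (f has_vector_derivative f' x) (at x within {a..b})"
    and "\<And>x. x \<in> {a..b} \<Longrightarrow> cmod (f' x) \<le> B" and "x \<in> {a..b}" "y \<in> {a..b}"
  shows "cmod (f x - f y) \<le> B * \<bar>x - y\<bar>"
proof -
  have "norm (f x - f y) \<le> B * norm (x - y)"
  proof (rule differentiable_bound[of "{a..b}" f "\<lambda>x h. h *\<^sub>R f' x"])
    show "(f has_derivative (\<lambda>h. h *\<^sub>R f' z)) (at z within {a..b})" if "z \<in> {a..b}" for z
      using assms(1)[OF that] by (simp add: has_vector_derivative_def)
    show "onorm (\<lambda>h. h *\<^sub>R f' z) \<le> B" if "z \<in> {a..b}" for z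
      using assms(2)[OF that] by (intro onorm_le) (simp add: mult.commute[of B] mult_left_mono)
  qed (use assms in auto)
  then show ?thesis by simp
qed

lemma avg_near:
  assumes i: "set_integrable lborel (dyadic_cell n k) u" and e: "\<And>x. x \<in> dyadic_cell n k \<Longrightarrow> cmod (u x - c) \<le> \<epsilon>" "0 \<le> \<epsilon>"
  shows "cmod (avg n k u - c) \<le> \<epsilon>"
proof -
  have "ennreal ((cmod (avg n k u - c))\<^sup>2) \<le> 2 ^ n * (\<integral>\<^sup>+x\<in>dyadic_cell n k. ennreal ((cmod (u x - c))\<^sup>2) \<partial>lborel)"
    by (rule avg_dev_sq_le[OF i])
  also have "\<dots> \<le> 2 ^ n * (\<integral>\<^sup>+x. ennreal (\<epsilon>\<^sup>2) * indicator (dyadic_cell n k) x \<partial>lborel)"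
    using e by (intro mult_left_mono nn_integral_mono) (auto simp: indicator_def intro!: ennreal_leI power_mono)
  also have "\<dots> = ennreal (2 ^ n) * (ennreal (\<epsilon>\<^sup>2) * ennreal (1 / 2 ^ n))"
    by (simp add: nn_integral_cmult_indicator emeasure_dyadic_cell two_power_ennreal)
  also have "\<dots> = ennreal (2 ^ n * (\<epsilon>\<^sup>2 * (1 / 2 ^ n)))"
    by (subst ennreal_mult[symmetric], simp, simp)+ simp
  finally have "(cmod (avg n k u - c))\<^sup>2 \<le> \<epsilon>\<^sup>2" by (simp add: ennreal_le_iff)
  then show ?thesis using e(2) by (rule power2_le_imp_le)
qed

lemma avg_shift: "avg n (Suc k) v = avg n k (\<lambda>x. v (x + 1 / 2 ^ n))"
proof -
  have "indicator (dyadic_cell n (Suc k)) (1 / 2 ^ n + 1 * x) = (indicator (dyadic_cell n k) x :: real)" for x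
    by (auto simp: dyadic_cell_def indicator_def add_divide_distrib)
  then have "(LINT x:dyadic_cell n (Suc k)|lborel. v x) = (LINT x:dyadic_cell n k|lborel. v (x + 1 / 2 ^ n))"
    unfolding set_lebesgue_integral_def
    by (subst lborel_integral_real_affine[where c = 1 and t = "1 / 2 ^ n"]) (simp_all add: add.commute)
  then show ?thesis by (simp add: avg_def)
qed

lemma sum_avg:
  assumes "set_integrable lborel {0..1} w" shows "(\<Sum>k<2 ^ n. avg n k w) = 2 ^ n * avg 0 0 w"
proof (induction n)
  case (Suc n)
  have "(\<Sum>k<2 ^ Suc n. avg (Suc n) k w) = (\<Sum>k<2 ^ n. 2 * avg n k w)"
    unfolding sum_two_power_Suc by (intro sum.cong refl) (simp add: avg_refine[OF assms, of _ n])
  then show ?case using Suc by (simp flip: sum_distrib_left)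
qed simp

text \<open>Each summand is within \<open>10 * L\<^sup>2 * h\<^sup>2\<close> of the integral of
  \<open>u * v'\<close> over its cell, and there are fewer than \<open>1 / h\<close> of them. The
  last cell has no gap to its right; its integral is missing from the sum and costs the eleventh
  \<open>L\<^sup>2 * h\<close>.\<close>

lemma avg_form_smooth_error:
  fixes u v v' :: "real \<Rightarrow> complex"
  assumes v: "\<And>x. x \<in> {0..1} \<Longrightarrow> (v has_vector_derivative v' x) (at x within {0..1})"
    and lip: "\<And>x y. x \<in> {0..1} \<Longrightarrow> y \<in> {0..1} \<Longrightarrow> cmod (u x - u y) \<le> L * \<bar>x - y\<bar>"
      "\<And>x y. x \<in> {0..1} \<Longrightarrow> y \<in> {0..1} \<Longrightarrow> cmod (v' x - v' y) \<le> L * \<bar>x - y\<bar>"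
    and bd: "\<And>x. x \<in> {0..1} \<Longrightarrow> cmod (u x) \<le> L" "\<And>x. x \<in> {0..1} \<Longrightarrow> cmod (v' x) \<le> L"
    and cont: "continuous_on {0..1} u" "continuous_on {0..1} v'"
  shows "cmod (avg_form n u v - avg 0 0 (\<lambda>x. u x * v' x)) \<le> 11 * L\<^sup>2 / 2 ^ n"
proof -
  define h :: real where "h = 1 / 2 ^ n"
  have h: "0 < h" "h \<le> 1" by (simp_all add: h_def)
  have L: "0 \<le> L" using order_trans[OF norm_ge_zero bd(1)[of 0]] by simp
  have cv: "continuous_on {0..1} v"
    by (rule continuous_on_vector_derivative[OF v])
  have iu: "set_integrable lborel {0..1} u" and iv: "set_integrable lborel {0..1} v"
    and iw: "set_integrable lborel {0..1} (\<lambda>x. u x * v' x)"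
    by (intro borel_integrable_atLeastAtMost' continuous_intros cont cv)+
  define W where "W k = avg n k (\<lambda>x. u x * v' x)" for k
  define x where "x k = real k * h" for k
  have cell: "\<bar>y - x k\<bar> \<le> h \<and> y \<in> {0..1} \<and> x k \<in> {0..1}" if "k < 2 ^ n" "y \<in> dyadic_cell n k" for k y
  proof -
    have "x k \<in> dyadic_cell n k" by (simp add: x_def h_def dyadic_cell_def divide_strict_right_mono)
    then show ?thesis using that dyadic_cell_subset[OF that(1)]
      by (auto simp: x_def h_def dyadic_cell_def add_divide_distrib)
  qed
  have mid: "x k \<in> {0..1}" if "k < 2 ^ n" for k
    using cell[OF that, of "x k"] by (simp add: x_def h_def dyadic_cell_def divide_strict_right_mono)
  have Wk: "cmod (W k - u (x k) * v' (x k)) \<le> 2 * L\<^sup>2 * h" if k: "k < 2 ^ n" for k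
    unfolding W_def
  proof (rule avg_near[OF set_integrable_dyadic_cell[OF iw k]])
    fix y assume "y \<in> dyadic_cell n k"
    from cell[OF k this] have y: "\<bar>y - x k\<bar> \<le> h" "y \<in> {0..1}" "x k \<in> {0..1}" by auto
    have "u y * v' y - u (x k) * v' (x k) = (u y - u (x k)) * v' y + u (x k) * (v' y - v' (x k))"
      by (simp add: algebra_simps)
    also have "cmod \<dots> \<le> (L * h) * L + L * (L * h)"
      using lip(1)[OF y(2,3)] lip(2)[OF y(2,3)] bd y L h mult_left_mono[OF y(1) L]
      by (intro norm_triangle_le add_mono; unfold norm_mult; intro mult_mono) (auto intro: order_trans)
    finally show "cmod (u y * v' y - u (x k) * v' (x k)) \<le> 2 * L\<^sup>2 * h" by (simp add: power2_eq_square algebra_simps)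
  qed (use h in auto)
  have uk: "cmod (avg n k u - u (x j)) \<le> 2 * L * h" if k: "k < 2 ^ n" and j: "k = j \<or> k = Suc j" for k j
  proof (rule avg_near[OF set_integrable_dyadic_cell[OF iu k]])
    fix y assume y: "y \<in> dyadic_cell n k"
    have "\<bar>y - x j\<bar> \<le> 2 * h" using j cell[OF k y] h by (auto simp: x_def algebra_simps abs_le_iff)
    moreover have "x j \<in> {0..1}" using mid[of j] k j by auto
    ultimately show "cmod (u y - u (x j)) \<le> 2 * L * h"
      using lip(1)[of y "x j"] cell[OF k y] mult_left_mono[of "\<bar>y - x j\<bar>" "2 * h" L] L by auto
  qed (use h L in auto)
  have vk: "cmod (avg n (Suc k) v - avg n k v - h * v' (x k)) \<le> 2 * L * h\<^sup>2" if k: "Suc k < 2 ^ n" for k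
  proof -
    have k': "k < 2 ^ n" using k by simp
    have "real (Suc (Suc k)) \<le> 2 ^ n" by (rule real_Suc_le_two_power[OF k])
    then have x2: "x k + 2 * h \<le> 1" by (simp add: x_def h_def field_simps)
    have x0: "0 \<le> x k" using h by (simp add: x_def)
    have sub: "dyadic_cell n k \<subseteq> {x k..x k + h}"
      by (auto simp: dyadic_cell_def x_def h_def add_divide_distrib)
    have "continuous_on {x k..x k + h} (\<lambda>y. v (y + h))"
      by (rule continuous_on_compose2[OF cv]) (use x0 x2 h in \<open>auto intro!: continuous_intros\<close>)
    then have ish: "set_integrable lborel (dyadic_cell n k) (\<lambda>y. v (y + h))"
      by (intro set_integrable_subset[OF borel_integrable_atLeastAtMost' _ sub]) auto
    note iv' = set_integrable_dyadic_cell[OF iv k']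
    have "avg n (Suc k) v - avg n k v = avg n k (\<lambda>y. v (y + h) - v y)"
      unfolding avg_shift h_def[symmetric] unfolding avg_def
      by (subst set_integral_diff(2)[OF ish iv']) (simp add: right_diff_distrib)
    moreover have "cmod (avg n k (\<lambda>y. v (y + h) - v y) - h * v' (x k)) \<le> 2 * L * h\<^sup>2"
    proof (rule avg_near)
      show "set_integrable lborel (dyadic_cell n k) (\<lambda>y. v (y + h) - v y)" by (rule set_integral_diff(1)[OF ish iv'])
      fix y assume "y \<in> dyadic_cell n k"
      then have y: "x k \<le> y" "y \<le> x k + h" using sub by auto
      \<comment> \<open>Without the linear part of slope \<open>v' (x k)\<close> the derivative is
        of order \<open>h\<close>, so an increment over a step \<open>h\<close> is of order
        \<open>h\<^sup>2\<close>.\<close>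
      define w where "w z = v z - z *\<^sub>R v' (x k)" for z
      have "cmod (w (y + h) - w y) \<le> (2 * L * h) * \<bar>(y + h) - y\<bar>"
      proof (rule vector_derivative_lipschitz[of "x k" "x k + 2 * h"])
        fix z assume z: "z \<in> {x k..x k + 2 * h}"
        then have z1: "z \<in> {0..1}" "x k \<in> {0..1}" using x0 x2 h by auto
        have "(v has_vector_derivative v' z) (at z within {x k..x k + 2 * h})"
          using v[OF z1(1)] by (rule has_vector_derivative_within_subset) (use x0 x2 in auto)
        then show "(w has_vector_derivative (v' z - v' (x k))) (at z within {x k..x k + 2 * h})"
          unfolding w_def by (auto intro!: derivative_eq_intros)
        have "L * \<bar>z - x k\<bar> \<le> L * (2 * h)" using z L by (intro mult_left_mono) auto
        then show "cmod (v' z - v' (x k)) \<le> 2 * L * h" using lip(2)[OF z1] by simp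
      qed (use y h in auto)
      also have "w (y + h) - w y = v (y + h) - v y - h * v' (x k)" by (simp add: w_def scaleR_conv_of_real algebra_simps)
      finally show "cmod (v (y + h) - v y - h * v' (x k)) \<le> 2 * L * h\<^sup>2" using h by (simp add: power2_eq_square)
    qed (use h L in auto)
    ultimately show ?thesis by simp
  qed
  have summand: "cmod ((avg n k u + avg n (Suc k) u) / 2 * (avg n (Suc k) v - avg n k v) - h * W k) \<le> 10 * L\<^sup>2 * h\<^sup>2"
    if "k < 2 ^ n - 1" for k
  proof -
    have k: "k < 2 ^ n" "Suc k < 2 ^ n" using that by auto
    define P where "P = (avg n k u + avg n (Suc k) u) / 2"
    define d where "d = avg n (Suc k) v - avg n k v"
    define U V where "U = u (x k)" and "V = v' (x k)"
    have UV: "cmod U \<le> L" "cmod V \<le> L" using bd mid[OF k(1)] by (simp_all add: U_def V_def)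
    have "P - U = (avg n k u - U) / 2 + (avg n (Suc k) u - U) / 2" by (simp add: P_def field_simps)
    also have "cmod \<dots> \<le> (2 * L * h) / 2 + (2 * L * h) / 2"
      using uk[OF k(1), of k] uk[OF k(2), of k] by (intro norm_triangle_le add_mono) (auto simp: norm_divide U_def)
    finally have PU: "cmod (P - U) \<le> 2 * L * h" by simp
    have dV: "cmod (d - h * V) \<le> 2 * L * h\<^sup>2" using vk[OF k(2)] by (simp add: d_def V_def)
    have "cmod d \<le> cmod (d - h * V) + cmod (h * V)" using norm_triangle_ineq[of "d - h * V" "h * V"] by simp
    also have "cmod (h * V) \<le> h * L" using UV h by (simp add: norm_mult)
    also have "cmod (d - h * V) \<le> 2 * L * h"
    proof -
      have "2 * L * h * h \<le> 2 * L * h * 1" using h L by (intro mult_left_mono) auto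
      then show ?thesis using dV by (simp add: power2_eq_square)
    qed
    finally have d: "cmod d \<le> 3 * L * h" by simp
    \<comment> \<open>The three products contribute 6, 2 and 2 times
      \<open>L\<^sup>2 * h\<^sup>2\<close>.\<close>
    have "P * d - h * W k = (P - U) * d + (U * (d - h * V) + h * (U * V - W k))" by (simp add: algebra_simps)
    also have "cmod \<dots> \<le> (2 * L * h) * (3 * L * h) + (L * (2 * L * h\<^sup>2) + h * (2 * L\<^sup>2 * h))"
      using PU d dV UV h L Wk[OF k(1)]
      by (intro norm_triangle_le add_mono; unfold norm_mult; intro mult_mono)
        (auto simp: U_def V_def norm_minus_commute)
    also have "\<dots> = 10 * L\<^sup>2 * h\<^sup>2" by (simp add: power2_eq_square algebra_simps)
    finally show ?thesis by (simp add: P_def d_def)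
  qed
  have "avg 0 0 (\<lambda>x. u x * v' x) = h * (\<Sum>k<2 ^ n. W k)"
    unfolding W_def sum_avg[OF iw] by (simp add: h_def)
  also have "\<dots> = (\<Sum>k<2 ^ n - 1. h * W k) + h * W (2 ^ n - 1)"
  proof -
    have "{..<2 ^ n} = insert (2 ^ n - 1) {..<2 ^ n - 1 :: nat}"
      by (auto simp: less_Suc_eq_le[symmetric] not_less le_antisym)
    then show ?thesis by (simp add: sum_distrib_left distrib_left)
  qed
  finally have "avg_form n u v - avg 0 0 (\<lambda>x. u x * v' x) =
      (\<Sum>k<2 ^ n - 1. (avg n k u + avg n (Suc k) u) / 2 * (avg n (Suc k) v - avg n k v) - h * W k) - h * W (2 ^ n - 1)"
    by (simp add: avg_form_def sum_subtractf)
  also have "cmod \<dots> \<le> (\<Sum>k<2 ^ n - 1 :: nat. 10 * L\<^sup>2 * h\<^sup>2) + h * L\<^sup>2"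
  proof (rule order_trans[OF norm_triangle_ineq4 add_mono])
    show "cmod (\<Sum>k<2 ^ n - 1. (avg n k u + avg n (Suc k) u) / 2 * (avg n (Suc k) v - avg n k v) - h * W k)
        \<le> (\<Sum>k<2 ^ n - 1 :: nat. 10 * L\<^sup>2 * h\<^sup>2)"
      by (rule sum_norm_le) (use summand in auto)
    have "cmod (W (2 ^ n - 1) - 0) \<le> L\<^sup>2" unfolding W_def
    proof (rule avg_near)
      have k: "2 ^ n - 1 < (2::nat) ^ n" by simp
      show "set_integrable lborel (dyadic_cell n (2 ^ n - 1)) (\<lambda>x. u x * v' x)" by (rule set_integrable_dyadic_cell[OF iw k])
      fix y assume "y \<in> dyadic_cell n (2 ^ n - 1)"
      then have "y \<in> {0..1}" using cell[OF k] by blast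
      then show "cmod (u y * v' y - 0) \<le> L\<^sup>2" using bd L by (auto simp: norm_mult power2_eq_square intro!: mult_mono)
    qed simp
    then show "cmod (h * W (2 ^ n - 1)) \<le> h * L\<^sup>2" using h by (simp add: norm_mult)
  qed
  also have "\<dots> \<le> 2 ^ n * (10 * L\<^sup>2 * h\<^sup>2) + h * L\<^sup>2"
    by (intro add_mono) (simp_all add: mult_right_mono of_nat_diff)
  also have "\<dots> = 11 * L\<^sup>2 / 2 ^ n" by (simp add: h_def power2_eq_square)
  finally show ?thesis .
qed

lemma smooth_unitE:
  assumes "smooth_unit u"
  obtains D where "\<And>x. x \<in> {0..1} \<Longrightarrow> D 0 x = u x"
    "\<And>k x. x \<in> {0..1} \<Longrightarrow> (D k has_vector_derivative D (Suc k) x) (at x within {0..1})"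
    "\<And>k. continuous_on {0..1} (D k)"
    "\<And>x. x \<in> {0..1} \<Longrightarrow> (u has_vector_derivative D 1 x) (at x within {0..1})"
    "continuous_on {0..1} u"
    "\<And>x. x \<in> {0..1} \<Longrightarrow> vector_derivative u (at x within {0..1}) = D 1 x"
proof -
  obtain D where D: "\<And>x. x \<in> {0..1} \<Longrightarrow> D 0 x = u x"
    "\<And>k x. x \<in> {0..1} \<Longrightarrow> (D k has_vector_derivative D (Suc k) x) (at x within {0..1})"
    using assms unfolding smooth_unit_def by blast
  have c: "continuous_on {0..1} (D k)" for k by (rule continuous_on_vector_derivative[OF D(2)])
  have d: "(u has_vector_derivative D 1 x) (at x within {0..1})" if "x \<in> {0..1}" for x
    using has_vector_derivative_transform[OF that, of u "D 0" "D 1 x"] D(1) D(2)[OF that, of 0] by simp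
  show thesis
    using that[of D, OF D c d continuous_on_vector_derivative[OF d]] d vector_derivative_within_closed_interval[of 0 1]
    by auto
qed

lemma continuous_on_bounded_01:
  fixes f :: "real \<Rightarrow> complex"
  assumes "continuous_on {0..1} f" obtains M where "0 \<le> M" "\<And>x. x \<in> {0..1} \<Longrightarrow> cmod (f x) \<le> M"
proof -
  have "bounded (f ` {0..1})" by (intro compact_imp_bounded compact_continuous_image assms) auto
  then obtain M where "\<forall>x\<in>f ` {0..1}. cmod x \<le> M" unfolding bounded_iff by blast
  then show thesis by (intro that[of "\<bar>M\<bar>"]) (auto intro: order_trans[OF _ abs_ge_self])
qed

lemma avg_0_eq_integral:
  assumes "continuous_on {0..1} w" shows "avg 0 0 w = integral {0..1} w"
proof -
  have "set_integrable lborel {0..1} w" by (rule borel_integrable_atLeastAtMost'[OF assms])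
  then have "set_integrable lborel {0..<1} w" by (rule set_integrable_subset) auto
  then have "(LINT x:{0..<1}|lborel. w x) = integral {0..<1} w" by (rule set_borel_integral_eq_integral)
  also have "\<dots> = integral {0..1} w"
    by (rule integral_subset_negligible) (auto intro: negligible_subset[of "{1}"])
  finally show ?thesis by (simp add: avg_def dyadic_cell_def)
qed

lemma weak_form_smooth:
  assumes "smooth_unit u" "smooth_unit v"
  shows "weak_form u v = integral {0..1} (\<lambda>x. u x * vector_derivative v (at x within {0..1}))"
proof -
  obtain D where D: "\<And>x. x \<in> {0..1} \<Longrightarrow> (u has_vector_derivative D 1 x) (at x within {0..1})"
    "\<And>k. continuous_on {0..1} (D k)" "continuous_on {0..1} u"
    using assms(1) by (rule smooth_unitE) (rule that)
  obtain E where E: "\<And>k x. x \<in> {0..1} \<Longrightarrow> (E k has_vector_derivative E (Suc k) x) (at x within {0..1})"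
    "\<And>k. continuous_on {0..1} (E k)" "\<And>x. x \<in> {0..1} \<Longrightarrow> (v has_vector_derivative E 1 x) (at x within {0..1})"
    "\<And>x. x \<in> {0..1} \<Longrightarrow> vector_derivative v (at x within {0..1}) = E 1 x"
    using assms(2) by (rule smooth_unitE) (rule that)
  obtain M0 where M0: "0 \<le> M0" "\<And>x. x \<in> {0..1} \<Longrightarrow> cmod (u x) \<le> M0" using continuous_on_bounded_01[OF D(3)] by blast
  obtain M1 where M1: "0 \<le> M1" "\<And>x. x \<in> {0..1} \<Longrightarrow> cmod (D 1 x) \<le> M1" using continuous_on_bounded_01[OF D(2)] by blast
  obtain M2 where M2: "0 \<le> M2" "\<And>x. x \<in> {0..1} \<Longrightarrow> cmod (E 1 x) \<le> M2" using continuous_on_bounded_01[OF E(2)] by blast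
  obtain M3 where M3: "0 \<le> M3" "\<And>x. x \<in> {0..1} \<Longrightarrow> cmod (E (Suc 1) x) \<le> M3" using continuous_on_bounded_01[OF E(2)] by blast
  \<comment> \<open>One constant bounds \<open>u\<close>, its derivative and the first two
    derivatives of \<open>v\<close>, and so also gives Lipschitz constants for \<open>u\<close> and
    the derivative of \<open>v\<close>.\<close>
  define L where "L = M0 + M1 + M2 + M3"
  have L: "M0 \<le> L" "M1 \<le> L" "M2 \<le> L" "M3 \<le> L" using M0 M1 M2 M3 by (simp_all add: L_def)
  have err: "cmod (avg_form n u v - avg 0 0 (\<lambda>x. u x * E 1 x)) \<le> 11 * L\<^sup>2 / 2 ^ n" for n
  proof (rule avg_form_smooth_error[OF E(3) _ _ _ _ D(3) E(2)])
    show "cmod (u x) \<le> L" "cmod (E 1 x) \<le> L" if "x \<in> {0..1}" for x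
      using M0(2)[OF that] M2(2)[OF that] L by linarith+
    show "cmod (u x - u y) \<le> L * \<bar>x - y\<bar>" if "x \<in> {0..1}" "y \<in> {0..1}" for x y
      using vector_derivative_lipschitz[OF D(1) order_trans[OF M1(2) L(2)] that] by blast
    show "cmod (E 1 x - E 1 y) \<le> L * \<bar>x - y\<bar>" if "x \<in> {0..1}" "y \<in> {0..1}" for x y
      using vector_derivative_lipschitz[OF E(1) order_trans[OF M3(2) L(4)] that] by blast
  qed
  have "(\<lambda>n. avg_form n u v) \<longlonglongrightarrow> avg 0 0 (\<lambda>x. u x * E 1 x)"
  proof (rule LIM_zero_cancel, rule Lim_null_comparison)
    show "\<forall>\<^sub>F n in sequentially. norm (avg_form n u v - avg 0 0 (\<lambda>x. u x * E 1 x)) \<le> 11 * L\<^sup>2 * (1/2) ^ n"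
      using err by (simp add: power_one_over field_simps)
    show "(\<lambda>n. 11 * L\<^sup>2 * (1/2) ^ n) \<longlonglongrightarrow> 0" by (intro tendsto_mult_right_zero LIMSEQ_power_zero) simp
  qed
  then have "weak_form u v = avg 0 0 (\<lambda>x. u x * E 1 x)" unfolding weak_form_def by (rule limI)
  also have "\<dots> = integral {0..1} (\<lambda>x. u x * E 1 x)"
    by (intro avg_0_eq_integral continuous_intros D(3) E(2))
  also have "\<dots> = integral {0..1} (\<lambda>x. u x * vector_derivative v (at x within {0..1}))"
    by (rule integral_cong) (simp add: E(4))
  finally show ?thesis .
qed

lemma bounded_extension_weak_form:
  assumes \<alpha>: "1/2 < \<alpha>" shows "bounded_extension \<alpha> weak_form"
  unfolding bounded_extension_def
proof (intro conjI ballI allI impI)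
  note lim = weak_form_limit(1)[OF _ _ \<alpha>]
  fix u v w assume u: "u \<in> sobolev \<alpha>" and v: "v \<in> sobolev \<alpha>" and w: "w \<in> sobolev \<alpha>"
  note i = sobolevD(5)[OF u] sobolevD(5)[OF v]
  show "weak_form (\<lambda>x. u x + v x) w = weak_form u w + weak_form v w"
    unfolding weak_form_def[of "\<lambda>x. u x + v x"] avg_form_add[OF i]
    by (intro limI tendsto_add lim u v w)
  show "weak_form w (\<lambda>x. u x + v x) = weak_form w u + weak_form w v"
    unfolding weak_form_def[of w "\<lambda>x. u x + v x"] avg_form_add[OF i]
    by (intro limI tendsto_add lim u v w)
next
  note lim = weak_form_limit(1)[OF _ _ \<alpha>]
  fix c u v assume u: "u \<in> sobolev \<alpha>" and v: "v \<in> sobolev \<alpha>"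
  show "weak_form (\<lambda>x. c * u x) v = c * weak_form u v"
    unfolding weak_form_def[of "\<lambda>x. c * u x"] avg_form_scale by (intro limI tendsto_mult tendsto_const lim u v)
  show "weak_form u (\<lambda>x. c * v x) = c * weak_form u v"
    unfolding weak_form_def[of u "\<lambda>x. c * v x"] avg_form_scale by (intro limI tendsto_mult tendsto_const lim u v)
next
  show "\<exists>C. \<forall>u\<in>sobolev \<alpha>. \<forall>v\<in>sobolev \<alpha>. cmod (weak_form u v) \<le> C * sobolev_norm \<alpha> u * sobolev_norm \<alpha> v"
    using weak_form_limit(2)[OF _ _ \<alpha>] by blast
next
  fix u v assume "smooth_unit u" "smooth_unit v"
  then show "weak_form u v = integral {0..1} (\<lambda>x. u x * vector_derivative v (at x within {0..1}))"
    by (rule weak_form_smooth)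
qed

section \<open>Uniqueness of the extension on traces\<close>

lemma sobolev_of_dyadic:
  assumes u: "continuous_on {0..1} u" and M: "\<And>x. x \<in> {0..1} \<Longrightarrow> cmod (u x) \<le> M" and \<alpha>: "1/2 \<le> \<alpha>"
    and S: "summable (\<lambda>n. (2 powr (2 * \<alpha> - 1)) ^ n * dyadic_sq n u)"
  shows "u \<in> sobolev \<alpha>"
    "(sobolev_norm \<alpha> u)\<^sup>2 \<le> M\<^sup>2 + 480 * 4 powr \<alpha> * suminf (\<lambda>n. (2 powr (2 * \<alpha> - 1)) ^ n * dyadic_sq n u)"
proof -
  let ?s = "480 * 4 powr \<alpha> * suminf (\<lambda>n. (2 powr (2 * \<alpha> - 1)) ^ n * dyadic_sq n u)"
  have s0: "0 \<le> ?s" using S by (intro mult_nonneg_nonneg suminf_nonneg) (auto simp: dyadic_sq_nonneg)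
  have "(\<integral>\<^sup>+x\<in>{0..1}. ennreal ((cmod (u x))\<^sup>2) \<partial>lborel) \<le> (\<integral>\<^sup>+x. ennreal (M\<^sup>2) * indicator {0..1::real} x \<partial>lborel)"
    by (intro nn_integral_mono) (auto simp: indicator_def intro!: ennreal_leI power_mono M)
  also have "\<dots> = ennreal (M\<^sup>2)" by (simp add: nn_integral_cmult_indicator)
  finally have "sobolev_sq \<alpha> u \<le> ennreal (M\<^sup>2) + ennreal ?s"
    unfolding sobolev_sq_def gagliardo_def[symmetric] by (intro add_mono gagliardo_le u \<alpha> S)
  also have "\<dots> = ennreal (M\<^sup>2 + ?s)" using s0 by (intro ennreal_plus[symmetric]) auto
  finally have le: "sobolev_sq \<alpha> u \<le> ennreal (M\<^sup>2 + ?s)" .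
  then have "sobolev_sq \<alpha> u < \<infinity>" by (rule order.strict_trans1) simp
  then show u_in: "u \<in> sobolev \<alpha>"
    unfolding sobolev_def set_borel_measurable_def
    using borel_measurable_continuous_on_indicator[OF _ u] by simp
  have "ennreal ((sobolev_norm \<alpha> u)\<^sup>2) \<le> ennreal (M\<^sup>2 + ?s)" using le sobolevD(2)[OF u_in] by simp
  then show "(sobolev_norm \<alpha> u)\<^sup>2 \<le> M\<^sup>2 + ?s" using s0 by (subst (asm) ennreal_le_iff) auto
qed

definition lip_const :: "real \<Rightarrow> real"
  where "lip_const \<alpha> = 1 + 480 * 4 powr \<alpha> * suminf (\<lambda>n. (2 powr (2 * \<alpha> - 2)) ^ n)"

text \<open>A Lipschitz bound makes \<open>dyadic_sq n u\<close> at most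
  \<open>L\<^sup>2 / 2 ^ n\<close>, and \<open>2 powr (2 * \<alpha> - 1)\<close> is less than 2
  exactly for \<open>\<alpha> < 1\<close>. Hence approximation in the Lipschitz sense is
  approximation in the Sobolev norm.\<close>

lemma sobolev_lipschitz:
  assumes lip: "\<And>x y. x \<in> {0..1} \<Longrightarrow> y \<in> {0..1} \<Longrightarrow> cmod (u x - u y) \<le> L * \<bar>x - y\<bar>"
    and M: "\<And>x. x \<in> {0..1} \<Longrightarrow> cmod (u x) \<le> L" and \<alpha>: "1/2 \<le> \<alpha>" "\<alpha> < 1"
  shows "u \<in> sobolev \<alpha>" "(sobolev_norm \<alpha> u)\<^sup>2 \<le> lip_const \<alpha> * L\<^sup>2"
proof -
  define q where "q = (2::real) powr (2 * \<alpha> - 1)"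
  define r where "r = (2::real) powr (2 * \<alpha> - 2)"
  have L: "0 \<le> L" using order_trans[OF norm_ge_zero M[of 0]] by simp
  have qr: "q = 2 * r" unfolding q_def r_def using powr_add[of 2 1 "2 * \<alpha> - 2"] by simp
  have "r < 2 powr 0" unfolding r_def using \<alpha> by (intro powr_less_mono) auto
  then have r: "0 < r" "r < 1" by (simp_all add: r_def)
  have cont: "continuous_on {0..1} u"
  proof (rule continuous_onI)
    fix x e :: real assume x: "x \<in> {0..1}" and e: "0 < e"
    have "dist (u y) (u x) \<le> e" if "y \<in> {0..1}" "dist y x < e / (L + 1)" for y
    proof -
      have "cmod (u y - u x) \<le> L * \<bar>y - x\<bar>" by (rule lip[OF that(1) x])
      also have "\<dots> \<le> (L + 1) * (e / (L + 1))" using that(2) L by (intro mult_mono) (auto simp: dist_real_def)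
      finally show ?thesis using L by (simp add: dist_norm)
    qed
    then show "\<exists>d>0. \<forall>y\<in>{0..1}. dist y x < d \<longrightarrow> dist (u y) (u x) \<le> e"
      using e L by (intro exI[of _ "e / (L + 1)"]) auto
  qed
  have D: "dyadic_sq n u \<le> L\<^sup>2 / 2 ^ n" for n
  proof -
    have "dyadic_sq n u \<le> (\<Sum>k<2 ^ n :: nat. (L * (1 / 2 ^ n))\<^sup>2)"
      unfolding dyadic_sq_def
    proof (intro sum_mono power_mono)
      fix k :: nat assume "k \<in> {..<2 ^ n}"
      then have "real (Suc k) \<le> 2 ^ n" by (intro real_Suc_le_two_power) simp
      then have "real (Suc k) / 2 ^ n \<in> {0..1}" "real k / 2 ^ n \<in> {0..1}"
        using \<open>k \<in> {..<2 ^ n}\<close> by auto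
      from lip[OF this] show "cmod (u (real (Suc k) / 2 ^ n) - u (real k / 2 ^ n)) \<le> L * (1 / 2 ^ n)"
        by (simp add: diff_divide_distrib[symmetric])
    qed simp
    also have "\<dots> = L\<^sup>2 / 2 ^ n" by (simp add: power_mult_distrib power_divide power2_eq_square)
    finally show ?thesis .
  qed
  have le: "q ^ n * dyadic_sq n u \<le> L\<^sup>2 * r ^ n" for n
  proof -
    have "q ^ n * dyadic_sq n u \<le> q ^ n * (L\<^sup>2 / 2 ^ n)" by (intro mult_left_mono D) (simp add: q_def)
    also have "\<dots> = L\<^sup>2 * r ^ n" by (simp add: qr power_mult_distrib)
    finally show ?thesis .
  qed
  have sr: "summable (\<lambda>n. r ^ n)" using r by (intro summable_geometric) simp
  have S: "summable (\<lambda>n. q ^ n * dyadic_sq n u)"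
    by (rule summable_comparison_test'[OF summable_mult[OF sr, of "L\<^sup>2"]])
      (use le in \<open>auto simp: dyadic_sq_nonneg q_def\<close>)
  note res = sobolev_of_dyadic[OF cont M \<alpha>(1), folded q_def, OF _ S]
  show "u \<in> sobolev \<alpha>" by (rule res(1)) simp
  have "(sobolev_norm \<alpha> u)\<^sup>2 \<le> L\<^sup>2 + 480 * 4 powr \<alpha> * suminf (\<lambda>n. q ^ n * dyadic_sq n u)" by (rule res(2)) simp
  also have "suminf (\<lambda>n. q ^ n * dyadic_sq n u) \<le> suminf (\<lambda>n. L\<^sup>2 * r ^ n)"
    by (intro suminf_le le S summable_mult sr)
  also have "\<dots> = L\<^sup>2 * suminf (\<lambda>n. r ^ n)" by (rule suminf_mult[OF sr])
  finally show "(sobolev_norm \<alpha> u)\<^sup>2 \<le> lip_const \<alpha> * L\<^sup>2"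
    by (simp add: lip_const_def r_def algebra_simps)
qed

lemma sobolev_norm_nonneg: "0 \<le> sobolev_norm \<alpha> u"
  by (simp add: sobolev_norm_def)

lemma bounded_extension_tendsto:
  assumes B: "bounded_extension \<alpha> B" and u: "u \<in> sobolev \<alpha>" and v: "v \<in> sobolev \<alpha>"
    and s: "\<And>n. s n \<in> sobolev \<alpha>" "\<And>n. (\<lambda>x. u x - s n x) \<in> sobolev \<alpha>"
    and t: "\<And>n. t n \<in> sobolev \<alpha>" "\<And>n. (\<lambda>x. v x - t n x) \<in> sobolev \<alpha>"
    and su: "(\<lambda>n. sobolev_norm \<alpha> (\<lambda>x. u x - s n x)) \<longlonglongrightarrow> 0"
    and tv: "(\<lambda>n. sobolev_norm \<alpha> (\<lambda>x. v x - t n x)) \<longlonglongrightarrow> 0"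
  shows "(\<lambda>n. B (s n) (t n)) \<longlonglongrightarrow> B u v"
proof -
  obtain C where C: "\<And>u v. u \<in> sobolev \<alpha> \<Longrightarrow> v \<in> sobolev \<alpha> \<Longrightarrow> cmod (B u v) \<le> C * sobolev_norm \<alpha> u * sobolev_norm \<alpha> v"
    using B unfolding bounded_extension_def by blast
  have add: "B (\<lambda>x. u x + v x) w = B u w + B v w" "B w (\<lambda>x. u x + v x) = B w u + B w v"
    if "u \<in> sobolev \<alpha>" "v \<in> sobolev \<alpha>" "w \<in> sobolev \<alpha>" for u v w
    using B that unfolding bounded_extension_def by blast+
  let ?N = "sobolev_norm \<alpha>"
  define d e where "d n = (\<lambda>x. u x - s n x)" and "e n = (\<lambda>x. v x - t n x)" for n
  \<comment> \<open>Expansion around the fixed pair \<open>(u, v)\<close>: only its norms and those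
    of the differences enter the error.\<close>
  have eq: "B u v - B (s n) (t n) = B (d n) v + B u (e n) - B (d n) (e n)" for n
  proof -
    have "u = (\<lambda>x. s n x + d n x)" "v = (\<lambda>x. t n x + e n x)" by (auto simp: d_def e_def)
    then have "B u v = B (s n) v + B (d n) v" "B u v = B u (t n) + B u (e n)" "B (d n) v = B (d n) (t n) + B (d n) (e n)"
      "B u (t n) = B (s n) (t n) + B (d n) (t n)"
      using add(1)[OF s(1) s(2) v, of n n] add(2)[OF t(1) t(2) u, of n n] add(2)[OF t(1) t(2) s(2), of n n n]
        add(1)[OF s(1) s(2) t(1), of n n n] unfolding d_def e_def by simp_all
    then show ?thesis by (simp add: algebra_simps)
  qed
  have "(\<lambda>n. B u v - B (s n) (t n)) \<longlonglongrightarrow> 0"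
  proof (rule Lim_null_comparison)
    show "\<forall>\<^sub>F n in sequentially. norm (B u v - B (s n) (t n)) \<le>
        C * ?N (d n) * ?N v + C * ?N u * ?N (e n) + C * ?N (d n) * ?N (e n)"
    proof (rule always_eventually, rule allI)
      fix n
      have "norm (B u v - B (s n) (t n)) \<le> norm (B (d n) v) + norm (B u (e n)) + norm (B (d n) (e n))"
        unfolding eq by (intro norm_triangle_le_diff norm_triangle_le add_mono order_refl)
      also have "\<dots> \<le> C * ?N (d n) * ?N v + C * ?N u * ?N (e n) + C * ?N (d n) * ?N (e n)"
        unfolding d_def e_def by (intro add_mono C u v s t)
      finally show "norm (B u v - B (s n) (t n)) \<le> C * ?N (d n) * ?N v + C * ?N u * ?N (e n) + C * ?N (d n) * ?N (e n)" .
    qed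
    show "(\<lambda>n. C * ?N (d n) * ?N v + C * ?N u * ?N (e n) + C * ?N (d n) * ?N (e n)) \<longlonglongrightarrow> 0"
      unfolding d_def e_def by (rule tendsto_eq_intros su tv refl)+ simp
  qed
  then have "(\<lambda>n. B u v - (B u v - B (s n) (t n))) \<longlonglongrightarrow> B u v - 0" by (intro tendsto_intros)
  then show ?thesis by simp
qed

section \<open>From smooth functions to C^1 functions\<close>

lemma smooth_unit_antiderivative:
  fixes g :: "real \<Rightarrow> complex"
  assumes g: "polynomial_function g"
  shows "smooth_unit (\<lambda>x. c + integral {0..x} g)"
    "x \<in> {0..1} \<Longrightarrow> ((\<lambda>x. c + integral {0..x} g) has_vector_derivative g x) (at x within {0..1})"
proof -
  have d0: "((\<lambda>x. c + integral {0..x} g) has_vector_derivative g x) (at x within {0..1})" if "x \<in> {0..1}" for x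
    using integral_has_vector_derivative[OF continuous_on_polymonial_function[OF g] that]
    by (auto intro!: derivative_eq_intros)
  then show "x \<in> {0..1} \<Longrightarrow> ((\<lambda>x. c + integral {0..x} g) has_vector_derivative g x) (at x within {0..1})" .
  have "\<exists>p'. polynomial_function p' \<and> (\<forall>x. (p has_vector_derivative p' x) (at x))"
    if "polynomial_function p" for p :: "real \<Rightarrow> complex"
    using has_vector_derivative_polynomial_function[OF that] by metis
  then obtain P :: "(real \<Rightarrow> complex) \<Rightarrow> real \<Rightarrow> complex" where
    P: "\<And>p. polynomial_function p \<Longrightarrow> polynomial_function (P p) \<and> (\<forall>x. (p has_vector_derivative P p x) (at x))"
    by metis
  have it: "polynomial_function ((P ^^ n) g)" for n by (induction n) (auto simp: g P)
  define D where "D n = (case n of 0 \<Rightarrow> (\<lambda>x. c + integral {0..x} g) | Suc m \<Rightarrow> (P ^^ m) g)" for n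
  have "(D k has_vector_derivative D (Suc k) x) (at x within {0..1})" if "x \<in> {0..1}" for k x
  proof (cases k)
    case 0
    then show ?thesis using d0[OF that] by (simp add: D_def)
  next
    case (Suc m)
    then show ?thesis using P[OF it[of m]] by (auto simp: D_def intro: has_vector_derivative_at_within)
  qed
  then show "smooth_unit (\<lambda>x. c + integral {0..x} g)"
    unfolding smooth_unit_def by (intro exI[of _ D]) (auto simp: D_def)
qed

text \<open>Weierstrass is applied to the derivative and the polynomial is integrated from 0.
  Approximating the function itself would give uniform smallness only, which does not control the
  Sobolev norm.\<close>

lemma smooth_approximation:
  fixes u u' :: "real \<Rightarrow> complex"
  assumes u: "\<And>x. x \<in> {0..1} \<Longrightarrow> (u has_vector_derivative u' x) (at x within {0..1})"
    and cont: "continuous_on {0..1} u'" and e: "0 < \<epsilon>"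
  obtains p g where "smooth_unit p" "\<And>x. x \<in> {0..1} \<Longrightarrow> (p has_vector_derivative g x) (at x within {0..1})"
    "continuous_on {0..1} g" "\<And>x. x \<in> {0..1} \<Longrightarrow> cmod (u' x - g x) \<le> \<epsilon>"
    "\<And>x. x \<in> {0..1} \<Longrightarrow> cmod (u x - p x) \<le> \<epsilon>"
    "\<And>x y. x \<in> {0..1} \<Longrightarrow> y \<in> {0..1} \<Longrightarrow> cmod ((u x - p x) - (u y - p y)) \<le> \<epsilon> * \<bar>x - y\<bar>"
proof -
  obtain g where g: "polynomial_function g" "\<And>x. x \<in> {0..1} \<Longrightarrow> cmod (u' x - g x) < \<epsilon>"
    using Stone_Weierstrass_polynomial_function[OF _ cont e] by auto
  define p where "p x = u 0 + integral {0..x} g" for x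
  note p = smooth_unit_antiderivative[OF g(1), where c = "u 0", folded p_def]
  have lip: "cmod ((u x - p x) - (u y - p y)) \<le> \<epsilon> * \<bar>x - y\<bar>" if "x \<in> {0..1}" "y \<in> {0..1}" for x y
  proof (rule vector_derivative_lipschitz[OF _ _ that])
    show "((\<lambda>x. u x - p x) has_vector_derivative (u' x - g x)) (at x within {0..1})" if "x \<in> {0..1}" for x
      by (intro derivative_intros u p that)
    show "cmod (u' x - g x) \<le> \<epsilon>" if "x \<in> {0..1}" for x using g(2)[OF that] by simp
  qed
  have "cmod (u x - p x) \<le> \<epsilon>" if "x \<in> {0..1}" for x
  proof -
    have "cmod (u x - p x) \<le> \<epsilon> * \<bar>x - 0\<bar>" using lip[OF that, of 0] by (simp add: p_def)
    also have "\<dots> \<le> \<epsilon> * 1" using that e by (intro mult_left_mono) auto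
    finally show ?thesis by simp
  qed
  then show thesis
    using that[of p g, OF p(1) p(2) continuous_on_polymonial_function[OF g(1)]] g(2) lip by (simp add: less_imp_le)
qed

lemma C1_in_sobolev:
  fixes u u' :: "real \<Rightarrow> complex"
  assumes u: "\<And>x. x \<in> {0..1} \<Longrightarrow> (u has_vector_derivative u' x) (at x within {0..1})"
    and cont: "continuous_on {0..1} u'" and \<alpha>: "1/2 \<le> \<alpha>" "\<alpha> < 1"
  shows "u \<in> sobolev \<alpha>"
proof -
  have b: "bounded (f ` {0..1})" if "continuous_on {0..1} f" for f :: "real \<Rightarrow> complex"
    using that by (intro compact_imp_bounded compact_continuous_image) auto
  have "bounded (u ` {0..1} \<union> u' ` {0..1})"
    using b[OF cont] b[OF continuous_on_vector_derivative[OF u]] by simp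
  then obtain L where L: "\<forall>z\<in>u ` {0..1} \<union> u' ` {0..1}. cmod z \<le> L" unfolding bounded_iff by blast
  then have "cmod (u x) \<le> L" "cmod (u' x) \<le> L" if "x \<in> {0..1}" for x using that by auto
  then show ?thesis
    using vector_derivative_lipschitz[OF u] by (intro sobolev_lipschitz(1)[OF _ _ \<alpha>, of u L]) blast+
qed

text \<open>\<open>B\<close> is prescribed on smooth functions only, whereas the spline interpolants
  below are merely C^1. Approximants with small Lipschitz error converge in the Sobolev norm, and
  their derivatives converge uniformly, so both sides pass to the limit.\<close>

lemma bounded_extension_C1:
  fixes u u' v v' :: "real \<Rightarrow> complex"
  assumes B: "bounded_extension \<alpha> B" and \<alpha>: "1/2 < \<alpha>" "\<alpha> < 1"
    and u: "\<And>x. x \<in> {0..1} \<Longrightarrow> (u has_vector_derivative u' x) (at x within {0..1})" "continuous_on {0..1} u'"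
    and v: "\<And>x. x \<in> {0..1} \<Longrightarrow> (v has_vector_derivative v' x) (at x within {0..1})" "continuous_on {0..1} v'"
  shows "B u v = integral {0..1} (\<lambda>x. u x * v' x)"
proof -
  define \<epsilon> where "\<epsilon> n = 1 / real (Suc n)" for n
  have \<epsilon>: "0 < \<epsilon> n" for n by (simp add: \<epsilon>_def)
  have \<epsilon>0: "\<epsilon> \<longlonglongrightarrow> 0" unfolding \<epsilon>_def by (rule LIMSEQ_Suc[OF lim_1_over_n])
  have "\<forall>n. \<exists>p. smooth_unit p \<and> (\<forall>x\<in>{0..1}. cmod (u x - p x) \<le> \<epsilon> n) \<and>
      (\<forall>x\<in>{0..1}. \<forall>y\<in>{0..1}. cmod ((u x - p x) - (u y - p y)) \<le> \<epsilon> n * \<bar>x - y\<bar>)"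
    by (metis smooth_approximation[OF u \<epsilon>])
  then obtain p where p: "\<And>n. smooth_unit (p n)" "\<And>n x. x \<in> {0..1} \<Longrightarrow> cmod (u x - p n x) \<le> \<epsilon> n"
    "\<And>n x y. x \<in> {0..1} \<Longrightarrow> y \<in> {0..1} \<Longrightarrow> cmod ((u x - p n x) - (u y - p n y)) \<le> \<epsilon> n * \<bar>x - y\<bar>"
    by metis
  have "\<forall>n. \<exists>q g. smooth_unit q \<and> (\<forall>x\<in>{0..1}. (q has_vector_derivative g x) (at x within {0..1})) \<and>
      continuous_on {0..1} g \<and> (\<forall>x\<in>{0..1}. cmod (v' x - g x) \<le> \<epsilon> n) \<and> (\<forall>x\<in>{0..1}. cmod (v x - q x) \<le> \<epsilon> n) \<and>
      (\<forall>x\<in>{0..1}. \<forall>y\<in>{0..1}. cmod ((v x - q x) - (v y - q y)) \<le> \<epsilon> n * \<bar>x - y\<bar>)"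
    by (metis smooth_approximation[OF v \<epsilon>])
  then obtain q g where q: "\<And>n. smooth_unit (q n)"
    "\<And>n x. x \<in> {0..1} \<Longrightarrow> (q n has_vector_derivative g n x) (at x within {0..1})"
    "\<And>n. continuous_on {0..1} (g n)" "\<And>n x. x \<in> {0..1} \<Longrightarrow> cmod (v' x - g n x) \<le> \<epsilon> n"
    "\<And>n x. x \<in> {0..1} \<Longrightarrow> cmod (v x - q n x) \<le> \<epsilon> n"
    "\<And>n x y. x \<in> {0..1} \<Longrightarrow> y \<in> {0..1} \<Longrightarrow> cmod ((v x - q n x) - (v y - q n y)) \<le> \<epsilon> n * \<bar>x - y\<bar>"
    by metis
  note \<alpha>' = less_imp_le[OF \<alpha>(1)] \<alpha>(2)
  have norm0: "(\<lambda>n. sobolev_norm \<alpha> (f n)) \<longlonglongrightarrow> 0" if "\<And>n. (sobolev_norm \<alpha> (f n))\<^sup>2 \<le> lip_const \<alpha> * (\<epsilon> n)\<^sup>2" for f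
  proof -
    have "(\<lambda>n. (sobolev_norm \<alpha> (f n))\<^sup>2) \<longlonglongrightarrow> 0"
    proof (rule tendsto_sandwich[OF _ _ tendsto_const])
      show "(\<lambda>n. lip_const \<alpha> * (\<epsilon> n)\<^sup>2) \<longlonglongrightarrow> 0" by (rule tendsto_eq_intros \<epsilon>0 refl)+ simp
    qed (use that in auto)
    then have "(\<lambda>n. sqrt ((sobolev_norm \<alpha> (f n))\<^sup>2)) \<longlonglongrightarrow> sqrt 0" by (rule tendsto_real_sqrt)
    then show ?thesis by (simp add: sobolev_norm_nonneg)
  qed
  have us: "u \<in> sobolev \<alpha>" "v \<in> sobolev \<alpha>" using C1_in_sobolev[OF u \<alpha>'] C1_in_sobolev[OF v \<alpha>'] by auto
  have smooth_in: "w \<in> sobolev \<alpha>" if "smooth_unit w" for w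
    using that by (rule smooth_unitE) (rule C1_in_sobolev[OF _ _ \<alpha>'])
  have lim: "(\<lambda>n. B (p n) (q n)) \<longlonglongrightarrow> B u v"
    by (rule bounded_extension_tendsto[OF B us smooth_in[OF p(1)] _ smooth_in[OF q(1)]])
      (intro sobolev_lipschitz[OF _ _ \<alpha>'] norm0; use p q in blast)+
  have cu: "continuous_on {0..1} u" by (rule continuous_on_vector_derivative[OF u(1)])
  have cp: "continuous_on {0..1} (p n)" for n using p(1)[of n] by (rule smooth_unitE)
  have Bpq: "B (p n) (q n) = integral {0..1} (\<lambda>x. p n x * g n x)" for n
  proof -
    have "B (p n) (q n) = integral {0..1} (\<lambda>x. p n x * vector_derivative (q n) (at x within {0..1}))"
      using B p(1) q(1) unfolding bounded_extension_def by blast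
    also have "\<dots> = integral {0..1} (\<lambda>x. p n x * g n x)"
      by (rule integral_cong) (simp add: vector_derivative_within_closed_interval[OF zero_less_one _ q(2)])
    finally show ?thesis .
  qed
  obtain M where M: "0 \<le> M" "\<And>x. x \<in> {0..1} \<Longrightarrow> cmod (u x) \<le> M" using continuous_on_bounded_01[OF cu] by blast
  obtain M' where M': "0 \<le> M'" "\<And>x. x \<in> {0..1} \<Longrightarrow> cmod (v' x) \<le> M'" using continuous_on_bounded_01[OF v(2)] by blast
  have "(\<lambda>n. integral {0..1} (\<lambda>x. p n x * g n x)) \<longlonglongrightarrow> integral {0..1} (\<lambda>x. u x * v' x)"
  proof (rule LIM_zero_cancel, rule Lim_null_comparison)
    show "\<forall>\<^sub>F n in sequentially. norm (integral {0..1} (\<lambda>x. p n x * g n x) - integral {0..1} (\<lambda>x. u x * v' x))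
        \<le> \<epsilon> n * (M' + \<epsilon> n) + M * \<epsilon> n"
    proof (rule always_eventually, rule allI)
      fix n
      have "integral {0..1} (\<lambda>x. p n x * g n x) - integral {0..1} (\<lambda>x. u x * v' x) =
          integral {0..1} (\<lambda>x. p n x * g n x - u x * v' x)"
        by (intro integral_diff[symmetric] integrable_continuous_real continuous_intros cp cu q v)
      also have "norm \<dots> \<le> (\<epsilon> n * (M' + \<epsilon> n) + M * \<epsilon> n) * (1 - 0)"
      proof (rule integral_bound)
        show "continuous_on {0..1} (\<lambda>x. p n x * g n x - u x * v' x)" by (intro continuous_intros cp cu q v)
        fix x :: real assume x: "x \<in> {0..1}"
        have "cmod (g n x) \<le> cmod (v' x) + cmod (v' x - g n x)" using norm_triangle_ineq4[of "v' x" "v' x - g n x"] by simp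
        then have gx: "cmod (g n x) \<le> M' + \<epsilon> n" using M'(2)[OF x] q(4)[OF x, of n] by linarith
        have "p n x * g n x - u x * v' x = - ((u x - p n x) * g n x) + - (u x * (v' x - g n x))"
          by (simp add: algebra_simps)
        also have "cmod \<dots> \<le> \<epsilon> n * (M' + \<epsilon> n) + M * \<epsilon> n"
          using p(2)[OF x] gx M(2)[OF x] q(4)[OF x] \<epsilon>[of n] M
          by (intro norm_triangle_le add_mono; unfold norm_minus_cancel norm_mult; intro mult_mono) auto
        finally show "cmod (p n x * g n x - u x * v' x) \<le> \<epsilon> n * (M' + \<epsilon> n) + M * \<epsilon> n" .
      qed simp
      finally show "norm (integral {0..1} (\<lambda>x. p n x * g n x) - integral {0..1} (\<lambda>x. u x * v' x))
        \<le> \<epsilon> n * (M' + \<epsilon> n) + M * \<epsilon> n" by simp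
    qed
    show "(\<lambda>n. \<epsilon> n * (M' + \<epsilon> n) + M * \<epsilon> n) \<longlonglongrightarrow> 0" by (rule tendsto_eq_intros \<epsilon>0 refl)+ simp
  qed
  with lim show ?thesis unfolding Bpq by (rule LIMSEQ_unique)
qed

section \<open>Quadratic spline interpolation at dyadic points\<close>

lemma DERIV_max_sq: "((\<lambda>t::real. (max 0 t)\<^sup>2) has_real_derivative 2 * max 0 t) (at t)"
proof -
  consider "t > 0" | "t < 0" | "t = 0" by linarith
  then show ?thesis
  proof cases
    case 1
    have "((\<lambda>t::real. t\<^sup>2) has_real_derivative 2 * t) (at t)" by (auto intro!: derivative_eq_intros)
    then have "((\<lambda>t::real. (max 0 t)\<^sup>2) has_real_derivative 2 * t) (at t)"
      by (rule has_field_derivative_transform_within_open[where S = "{0<..}"]) (use 1 in auto)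
    then show ?thesis using 1 by simp
  next
    case 2
    have "((\<lambda>t::real. 0) has_real_derivative 0) (at t)" by (rule DERIV_const)
    then have "((\<lambda>t::real. (max 0 t)\<^sup>2) has_real_derivative 0) (at t)"
      by (rule has_field_derivative_transform_within_open[where S = "{..<0}"]) (use 2 in auto)
    then show ?thesis using 2 by simp
  next
    case 3
    have "(\<lambda>h::real. (max 0 h)\<^sup>2 / h) \<midarrow>0\<rightarrow> 0"
    proof (rule Lim_null_comparison)
      have "norm ((max 0 h)\<^sup>2 / h) \<le> \<bar>h\<bar>" for h :: real
        by (cases "h = 0") (auto simp: max_def power2_eq_square)
      then show "\<forall>\<^sub>F h::real in at 0. norm ((max 0 h)\<^sup>2 / h) \<le> \<bar>h\<bar>" by simp
      show "(\<lambda>h::real. \<bar>h\<bar>) \<midarrow>0\<rightarrow> 0" by (rule tendsto_eq_intros refl)+ simp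
    qed
    then show ?thesis using 3 by (simp add: DERIV_def)
  qed
qed

text \<open>A C^1 transition from 0 to 1 across the unit interval, equal to \<open>2 * t ^ 2\<close>
  up to 1/2 and to \<open>1 - 2 * (1 - t) ^ 2\<close> afterwards. Truncated powers express it by one
  formula on the whole line; the derivative \<open>hat\<close> is a tent of height 2 and area
  1.\<close>

definition ramp :: "real \<Rightarrow> real"
  where "ramp t = 2 * ((max 0 t)\<^sup>2 - 2 * (max 0 (t - 1/2))\<^sup>2 + (max 0 (t - 1))\<^sup>2)"

definition hat :: "real \<Rightarrow> real"
  where "hat t = 4 * (max 0 t - 2 * max 0 (t - 1/2) + max 0 (t - 1))"

lemma DERIV_ramp: "(ramp has_real_derivative hat t) (at t within S)"
proof -
  have s: "((\<lambda>t::real. (max 0 (t - c))\<^sup>2) has_real_derivative 2 * max 0 (t - c)) (at t)" for c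
  proof -
    have "((\<lambda>t. t - c) has_real_derivative 1) (at t)" by (auto intro!: derivative_eq_intros)
    from DERIV_chain2[OF DERIV_max_sq this] show ?thesis by simp
  qed
  have "(ramp has_real_derivative hat t) (at t)"
    unfolding ramp_def[abs_def] hat_def by (rule derivative_eq_intros DERIV_max_sq s refl)+ simp
  then show ?thesis by (rule has_field_derivative_at_within)
qed

lemma ramp_0: "t \<le> 0 \<Longrightarrow> ramp t = 0" and ramp_1: "1 \<le> t \<Longrightarrow> ramp t = 1"
  and hat_outside: "t \<le> 0 \<or> 1 \<le> t \<Longrightarrow> hat t = 0" and hat_bound: "\<bar>hat t\<bar> \<le> 2"
  by (auto simp: ramp_def hat_def max_def power2_eq_square algebra_simps)

lemma ramp_lipschitz: "\<bar>ramp s - ramp t\<bar> \<le> 2 * \<bar>s - t\<bar>"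
proof -
  have "norm (ramp s - ramp t) \<le> 2 * norm (s - t)"
    by (rule field_differentiable_bound[of UNIV ramp hat]) (auto intro: DERIV_ramp hat_bound)
  then show ?thesis by simp
qed

lemma ramp_unit: "0 \<le> t \<Longrightarrow> t \<le> 1 \<Longrightarrow> \<bar>ramp t\<bar> \<le> 1"
proof -
  assume t: "0 \<le> t" "t \<le> 1"
  have "\<bar>ramp t\<bar> \<le> 2 * \<bar>t\<bar>" "\<bar>1 - ramp t\<bar> \<le> 2 * \<bar>1 - t\<bar>"
    using ramp_lipschitz[of t 0] ramp_lipschitz[of 1 t] by (simp_all add: ramp_0 ramp_1)
  have "0 \<le> ramp t \<and> ramp t \<le> 1"
  proof (cases "t \<le> 1/2")
    case True
    then have "t * t \<le> 1/2 * (1/2)" using t by (intro mult_mono) auto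
    moreover have "max 0 t = t" "max 0 (t - 1/2) = 0" "max 0 (t - 1) = 0" using t True by auto
    ultimately show ?thesis by (simp add: ramp_def power2_eq_square)
  next
    case False
    then have "ramp t = 1 - 2 * (1 - t)\<^sup>2" using t by (simp add: ramp_def max_def power2_eq_square algebra_simps)
    moreover have "(1 - t) * (1 - t) \<le> 1/2 * (1/2)" using t False by (intro mult_mono) auto
    ultimately show ?thesis by (simp add: power2_eq_square)
  qed
  then show ?thesis by simp
qed

definition dyadic_step :: "nat \<Rightarrow> (real \<Rightarrow> complex) \<Rightarrow> nat \<Rightarrow> complex"
  where "dyadic_step N u k = u (real (Suc k) / 2 ^ N) - u (real k / 2 ^ N)"

lemma dyadic_sq_step: "dyadic_sq N u = (\<Sum>k<2 ^ N. (cmod (dyadic_step N u k))\<^sup>2)"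
  by (simp add: dyadic_sq_def dyadic_step_def)

text \<open>Since \<open>ramp\<close> is flat at both ends, joining the node values by rescaled
  copies gives a C^1 function; the copies are summed over all cells, so differentiation is
  termwise.\<close>

definition interp :: "nat \<Rightarrow> (real \<Rightarrow> complex) \<Rightarrow> real \<Rightarrow> complex"
  where "interp N u x = u 0 + (\<Sum>k<2 ^ N. ramp (2 ^ N * x - real k) *\<^sub>R dyadic_step N u k)"

definition interp_deriv :: "nat \<Rightarrow> (real \<Rightarrow> complex) \<Rightarrow> real \<Rightarrow> complex"
  where "interp_deriv N u x = (\<Sum>k<2 ^ N. (2 ^ N * hat (2 ^ N * x - real k)) *\<^sub>R dyadic_step N u k)"

lemma DERIV_ramp_affine:
  "((\<lambda>x. ramp (c * x - d)) has_real_derivative c * hat (c * x - d)) (at x within S)"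
proof -
  have "((\<lambda>x. c * x - d) has_real_derivative c) (at x within S)" by (auto intro!: derivative_eq_intros)
  from DERIV_chain2[OF DERIV_ramp this] show ?thesis by (simp add: mult.commute)
qed

lemma interp_has_derivative: "(interp N u has_vector_derivative interp_deriv N u x) (at x within S)"
proof -
  have "((\<lambda>x. ramp (2 ^ N * x - real k) *\<^sub>R dyadic_step N u k) has_vector_derivative
      (2 ^ N * hat (2 ^ N * x - real k)) *\<^sub>R dyadic_step N u k) (at x within S)" for k
    using has_vector_derivative_scaleR[OF DERIV_ramp_affine has_vector_derivative_const] by simp
  then have "(interp N u has_vector_derivative 0 + interp_deriv N u x) (at x within S)"
    unfolding interp_def[abs_def] interp_deriv_def
    by (intro has_vector_derivative_add has_vector_derivative_const has_vector_derivative_sum)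
  then show ?thesis by simp
qed

lemma continuous_on_hat: "continuous_on S hat"
  unfolding hat_def by (intro continuous_intros)

lemma continuous_on_interp_deriv: "continuous_on S (interp_deriv N u)"
  unfolding interp_deriv_def by (intro continuous_intros continuous_on_compose2[OF continuous_on_hat]) auto

text \<open>Ramps of later cells have not started, and those of earlier cells are complete, so their
  steps telescope to the value at the left node.\<close>

lemma interp_cell:
  assumes k: "k < 2 ^ N" and x: "real k \<le> 2 ^ N * x" "2 ^ N * x \<le> real (Suc k)"
  shows "interp N u x = u (real k / 2 ^ N) + ramp (2 ^ N * x - real k) *\<^sub>R dyadic_step N u k"
proof -
  let ?f = "\<lambda>l. ramp (2 ^ N * x - real l) *\<^sub>R dyadic_step N u l"
  have "(\<Sum>l<2 ^ N. ?f l) = (\<Sum>l\<in>{..<Suc k}. ?f l)"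
    using k x by (intro sum.mono_neutral_right) (auto simp: ramp_0 not_less_eq)
  also have "\<dots> = (\<Sum>l<k. dyadic_step N u l) + ?f k"
    using x by (auto simp: ramp_1 intro!: sum.cong)
  also have "(\<Sum>l<k. dyadic_step N u l) = u (real k / 2 ^ N) - u 0"
    unfolding dyadic_step_def using sum_lessThan_telescope[of "\<lambda>l. u (real l / 2 ^ N)" k] by simp
  finally show ?thesis by (simp add: interp_def)
qed

lemma interp_node:
  assumes "i \<le> 2 ^ N" shows "interp N u (real i / 2 ^ N) = u (real i / 2 ^ N)"
proof (cases "i < 2 ^ N")
  case True
  show ?thesis by (subst interp_cell[OF True]) (auto simp: ramp_0)
next
  case False
  define k where "k = (2::nat) ^ N - 1"
  have i: "i = Suc k" and k: "k < 2 ^ N" using False assms by (simp_all add: k_def)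
  show ?thesis unfolding i by (subst interp_cell[OF k]) (auto simp: ramp_1 dyadic_step_def)
qed

lemma dyadic_cover:
  assumes "0 \<le> x" "x \<le> 1"
  obtains k where "k < 2 ^ N" "real k \<le> 2 ^ N * x" "2 ^ N * x \<le> real (Suc k)"
proof (cases "x < 1")
  case True
  show thesis
    using that[OF dyadic_index_less[OF assms(1) True]] dyadic_index_bounds[OF assms(1), of N] by (simp add: field_simps)
next
  case False
  then have "x = 1" using assms by simp
  then show thesis using that[of "2 ^ N - 1"] by (simp add: of_nat_diff)
qed

lemma interp_uniform:
  assumes u: "continuous_on {0..1} u" and e: "0 < \<epsilon>"
  shows "\<exists>N0. \<forall>N\<ge>N0. \<forall>x\<in>{0..1}. cmod (u x - interp N u x) \<le> \<epsilon>"
proof -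
  have "uniformly_continuous_on {0..1} u" using u by (intro compact_uniformly_continuous) auto
  then obtain d where d: "d > 0" "\<And>x y. x \<in> {0..1} \<Longrightarrow> y \<in> {0..1} \<Longrightarrow> dist x y < d \<Longrightarrow> dist (u x) (u y) < \<epsilon> / 2"
    using e unfolding uniformly_continuous_on_def by (metis half_gt_zero)
  obtain N0 where N0: "(1/2) ^ N0 < d" using real_arch_pow_inv[OF d(1), of "1/2"] by auto
  have "cmod (u x - interp N u x) \<le> \<epsilon>" if N: "N \<ge> N0" and x: "x \<in> {0..1}" for N x
  proof -
    obtain k where k: "k < 2 ^ N" "real k \<le> 2 ^ N * x" "2 ^ N * x \<le> real (Suc k)"
      using dyadic_cover[of x N] x by auto
    have h: "1 / 2 ^ N < d"
      using N0 power_decreasing[OF N, of "1/2::real"] by (simp add: power_one_over)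
    have "real (Suc k) \<le> 2 ^ N" by (rule real_Suc_le_two_power[OF k(1)])
    then have in01: "real k / 2 ^ N \<in> {0..1}" "real (Suc k) / 2 ^ N \<in> {0..1}" using k(1) by auto
    have "real k / 2 ^ N \<le> x" "x \<le> real (Suc k) / 2 ^ N"
      using k by (simp_all add: divide_le_eq le_divide_eq mult.commute del: of_nat_Suc)
    moreover have "real (Suc k) / 2 ^ N = real k / 2 ^ N + 1 / 2 ^ N" by (simp add: add_divide_distrib)
    ultimately have "\<bar>x - real k / 2 ^ N\<bar> \<le> 1 / 2 ^ N" by linarith
    then have 1: "cmod (u x - u (real k / 2 ^ N)) < \<epsilon> / 2"
      using d(2)[OF x in01(1)] h by (simp add: dist_norm)
    have "\<bar>real (Suc k) / 2 ^ N - real k / 2 ^ N\<bar> \<le> 1 / 2 ^ N" by (simp add: diff_divide_distrib[symmetric])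
    then have 2: "cmod (dyadic_step N u k) < \<epsilon> / 2"
      using d(2)[OF in01(2,1)] h by (simp add: dist_norm dyadic_step_def)
    have "cmod (ramp (2 ^ N * x - real k) *\<^sub>R dyadic_step N u k) \<le> 1 * cmod (dyadic_step N u k)"
      unfolding norm_scaleR using k by (intro mult_right_mono ramp_unit) auto
    moreover have eq: "u x - interp N u x = (u x - u (real k / 2 ^ N)) - ramp (2 ^ N * x - real k) *\<^sub>R dyadic_step N u k"
      by (simp add: interp_cell[OF k])
    ultimately show ?thesis unfolding eq
      using 1 2 norm_triangle_ineq4[of "u x - u (real k / 2 ^ N)" "ramp (2 ^ N * x - real k) *\<^sub>R dyadic_step N u k"]
      by linarith
  qed
  then show ?thesis by blast
qed

lemma dyadic_sq_interp_coarse: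
  assumes "n \<le> N" shows "dyadic_sq n (\<lambda>x. u x - interp N u x) = 0"
proof -
  have "u (real i / 2 ^ n) - interp N u (real i / 2 ^ n) = 0" if "i \<le> 2 ^ n" for i
  proof -
    have "(2::real) ^ N = 2 ^ n * 2 ^ (N - n)" using assms by (simp add: power_add[symmetric])
    then have eq: "real i / 2 ^ n = real (i * 2 ^ (N - n)) / 2 ^ N" by simp
    have "i * 2 ^ (N - n) \<le> 2 ^ n * 2 ^ (N - n)" using that by (rule mult_right_mono) simp
    then have "i * 2 ^ (N - n) \<le> 2 ^ N" using assms by (simp add: power_add[symmetric])
    from interp_node[OF this] show ?thesis unfolding eq by simp
  qed
  then show ?thesis unfolding dyadic_sq_def by (intro sum.neutral ballI) (simp add: Suc_leI less_imp_le del: of_nat_Suc)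
qed

text \<open>Each step of level \<open>N\<close> is spread over \<open>2 ^ m\<close> pieces, and as
  \<open>ramp\<close> is 2-Lipschitz a piece carries at most the fraction \<open>2 / 2 ^ m\<close>
  of it. Squaring and summing leaves \<open>4 / 4 ^ m * 2 ^ m\<close>.\<close>

lemma dyadic_sq_interp_fine: "dyadic_sq (N + m) (interp N u) \<le> 4 / 2 ^ m * dyadic_sq N u"
proof -
  define f where "f k = (cmod (dyadic_step N u k))\<^sup>2" for k
  have "dyadic_sq (N + m) (interp N u) \<le> (\<Sum>j<2 ^ (N + m). 4 / 4 ^ m * f (j div 2 ^ m))"
    unfolding dyadic_sq_def
  proof (rule sum_mono)
    fix j :: nat assume "j \<in> {..<2 ^ (N + m)}"
    define k where "k = j div 2 ^ m"
    have k: "k < 2 ^ N" using \<open>j \<in> _\<close> by (simp add: k_def less_mult_imp_div_less power_add)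
    have b: "k * 2 ^ m \<le> j" "Suc j \<le> Suc k * 2 ^ m"
      by (simp_all add: k_def) (metis Suc_leI add.commute dividend_less_div_times mult.commute pos2 zero_less_power)
    have b': "real k * 2 ^ m \<le> real j" "real (Suc j) \<le> real (Suc k) * 2 ^ m"
      using of_nat_mono[OF b(1), where 'a = real] of_nat_mono[OF b(2), where 'a = real]
      by (simp_all only: of_nat_mult of_nat_power of_nat_numeral)
    let ?x = "real j / 2 ^ (N + m)" and ?y = "real (Suc j) / 2 ^ (N + m)"
    have xy: "2 ^ N * ?x = real j / 2 ^ m" "2 ^ N * ?y = real (Suc j) / 2 ^ m" by (simp_all add: power_add)
    have "real k \<le> real j / 2 ^ m" "real (Suc j) / 2 ^ m \<le> real (Suc k)"
      using b' by (simp_all add: le_divide_eq divide_le_eq)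
    moreover have "real j / 2 ^ m \<le> real (Suc j) / 2 ^ m" by (simp add: divide_right_mono)
    ultimately have "real k \<le> 2 ^ N * ?x" "2 ^ N * ?x \<le> real (Suc k)" "real k \<le> 2 ^ N * ?y" "2 ^ N * ?y \<le> real (Suc k)"
      unfolding xy by linarith+
    then have eq: "interp N u ?y - interp N u ?x = (ramp (2 ^ N * ?y - real k) - ramp (2 ^ N * ?x - real k)) *\<^sub>R dyadic_step N u k"
      by (simp only: interp_cell[OF k] scaleR_diff_left add_diff_cancel_left)
    have "(2 ^ N * ?y - real k) - (2 ^ N * ?x - real k) = 1 / 2 ^ m"
      unfolding xy by (simp add: diff_divide_distrib[symmetric])
    then have "\<bar>ramp (2 ^ N * ?y - real k) - ramp (2 ^ N * ?x - real k)\<bar> \<le> 2 / 2 ^ m"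
      using ramp_lipschitz[of "2 ^ N * ?y - real k" "2 ^ N * ?x - real k"] by (simp only:) simp
    then have "cmod (interp N u ?y - interp N u ?x) \<le> 2 / 2 ^ m * cmod (dyadic_step N u k)"
      unfolding eq norm_scaleR by (rule mult_right_mono) simp
    then have "(cmod (interp N u ?y - interp N u ?x))\<^sup>2 \<le> (2 / 2 ^ m * cmod (dyadic_step N u k))\<^sup>2"
      by (intro power_mono) auto
    also have "\<dots> = 4 / 4 ^ m * f (j div 2 ^ m)"
    proof -
      have "(4::real) ^ m = (2 ^ m)\<^sup>2" by (simp add: power2_eq_square flip: power_mult_distrib)
      then show ?thesis by (simp add: f_def k_def power_mult_distrib power_divide)
    qed
    finally show "(cmod (interp N u ?y - interp N u ?x))\<^sup>2 \<le> 4 / 4 ^ m * f (j div 2 ^ m)" .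
  qed
  also have "\<dots> = 4 / 4 ^ m * (\<Sum>j<2 ^ N * 2 ^ m. f (j div 2 ^ m))" by (simp add: sum_distrib_left power_add)
  also have "(\<Sum>j<2 ^ N * 2 ^ m. f (j div 2 ^ m)) = (\<Sum>k<2 ^ N. \<Sum>j = k * 2 ^ m..<k * 2 ^ m + 2 ^ m. f (j div 2 ^ m))"
    by (rule sum.nat_group[symmetric])
  also have "\<dots> = (\<Sum>k<2 ^ N. 2 ^ m * f k)"
  proof (rule sum.cong[OF refl])
    fix k :: nat
    have "(\<Sum>j = k * 2 ^ m..<k * 2 ^ m + 2 ^ m. f (j div 2 ^ m)) = (\<Sum>j = k * 2 ^ m..<k * 2 ^ m + 2 ^ m. f k)"
    proof (rule sum.cong[OF refl])
      fix j assume "j \<in> {k * 2 ^ m..<k * 2 ^ m + 2 ^ m}"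
      then have "j div 2 ^ m = k" by (intro div_nat_eqI) (auto simp: mult.commute)
      then show "f (j div 2 ^ m) = f k" by simp
    qed
    then show "(\<Sum>j = k * 2 ^ m..<k * 2 ^ m + 2 ^ m. f (j div 2 ^ m)) = 2 ^ m * f k" by simp
  qed
  also have "4 / 4 ^ m * \<dots> = 4 / 2 ^ m * dyadic_sq N u"
  proof -
    have "(4::real) ^ m = 2 ^ m * 2 ^ m" by (simp flip: power_mult_distrib)
    then show ?thesis by (simp add: dyadic_sq_step f_def sum_distrib_left[symmetric])
  qed
  finally show ?thesis .
qed

lemma dyadic_sq_diff_le: "dyadic_sq n (\<lambda>x. u x - v x) \<le> 2 * dyadic_sq n u + 2 * dyadic_sq n v"
  unfolding dyadic_sq_def sum_distrib_left sum.distrib[symmetric]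
proof (rule sum_mono)
  fix k
  let ?x = "real k / 2 ^ n" and ?y = "real (Suc k) / 2 ^ n"
  show "(cmod (u ?y - v ?y - (u ?x - v ?x)))\<^sup>2 \<le> 2 * (cmod (u ?y - u ?x))\<^sup>2 + 2 * (cmod (v ?y - v ?x))\<^sup>2"
    using norm_sum_squared_le[of "u ?y - u ?x" "- (v ?y - v ?x)"] by (simp add: algebra_simps norm_minus_commute)
qed

text \<open>The error vanishes at all nodes of level \<open>N\<close>, so coarser levels contribute
  nothing to its dyadic series. Beyond them \<open>u\<close> contributes a tail of a convergent
  series, and the interpolant a geometric series of ratio \<open>r\<close> times the single term
  \<open>a N\<close>. The L2 part is covered by uniform convergence.\<close>

lemma interp_tendsto_sobolev:
  assumes u: "continuous_on {0..1} u" and \<alpha>: "1/2 < \<alpha>" "\<alpha> < 1"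
    and S: "summable (\<lambda>n. (2 powr (2 * \<alpha> - 1)) ^ n * dyadic_sq n u)"
  shows "(\<lambda>x. u x - interp N u x) \<in> sobolev \<alpha>"
    and "(\<lambda>N. sobolev_norm \<alpha> (\<lambda>x. u x - interp N u x)) \<longlonglongrightarrow> 0"
proof -
  define q where "q = (2::real) powr (2 * \<alpha> - 1)"
  define r where "r = (2::real) powr (2 * \<alpha> - 2)"
  have qr: "q = 2 * r" unfolding q_def r_def using powr_add[of 2 1 "2 * \<alpha> - 2"] by simp
  have "r < 2 powr 0" unfolding r_def using \<alpha> by (intro powr_less_mono) auto
  then have r: "0 < r" "r < 1" by (simp_all add: r_def)
  then have q: "0 < q" using qr by simp
  define a where "a n = q ^ n * dyadic_sq n u" for n
  have a0: "0 \<le> a n" for n using q by (simp add: a_def dyadic_sq_nonneg)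
  have Sa: "summable a" using S by (simp add: a_def[abs_def] q_def)
  define w where "w N x = u x - interp N u x" for N x
  \<comment> \<open>\<open>8 = 2 * 4\<close>, with 2 from splitting the difference and 4 from
    \<open>dyadic_sq_interp_fine\<close>; the ratio is \<open>q / 2 = r\<close>.\<close>
  define b where "b N m = 2 * a (m + N) + 8 * a N * r ^ m" for N m
  have wb: "q ^ (m + N) * dyadic_sq (m + N) (w N) \<le> b N m" for N m
  proof -
    have "dyadic_sq (m + N) (w N) \<le> 2 * dyadic_sq (m + N) u + 2 * (4 / 2 ^ m * dyadic_sq N u)"
      using dyadic_sq_diff_le[of "m + N" u "interp N u"] dyadic_sq_interp_fine[of N m u]
      unfolding w_def by (simp add: add.commute)
    then have "q ^ (m + N) * dyadic_sq (m + N) (w N) \<le> q ^ (m + N) * (2 * dyadic_sq (m + N) u + 2 * (4 / 2 ^ m * dyadic_sq N u))"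
      using q by (intro mult_left_mono) auto
    also have "\<dots> = b N m" by (simp add: b_def a_def qr power_add power_mult_distrib algebra_simps)
    finally show ?thesis .
  qed
  have Sr: "summable (\<lambda>m. r ^ m)" using r by (intro summable_geometric) simp
  have Sb: "summable (b N)" for N unfolding b_def[abs_def]
    using Sa Sr by (intro summable_add summable_mult) (simp_all add: summable_iff_shift)
  have Sw': "summable (\<lambda>m. q ^ (m + N) * dyadic_sq (m + N) (w N))" for N
    by (rule summable_comparison_test'[OF Sb]) (use wb q in \<open>auto simp: dyadic_sq_nonneg\<close>)
  then have Sw: "summable (\<lambda>n. q ^ n * dyadic_sq n (w N))" for N
    using summable_iff_shift[of "\<lambda>n. q ^ n * dyadic_sq n (w N)" N] by simp
  have cw: "continuous_on {0..1} (w N)" for N unfolding w_def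
    by (intro continuous_intros u continuous_on_vector_derivative[OF interp_has_derivative])
  have bound: "w N \<in> sobolev \<alpha>" "(sobolev_norm \<alpha> (w N))\<^sup>2 \<le> M\<^sup>2 + 480 * 4 powr \<alpha> * suminf (b N)"
    if "\<And>x. x \<in> {0..1} \<Longrightarrow> cmod (w N x) \<le> M" for N M
  proof -
    note res = sobolev_of_dyadic[OF cw that less_imp_le[OF \<alpha>(1)], folded q_def, OF _ Sw]
    show "w N \<in> sobolev \<alpha>" by (rule res(1)) simp
    have "(sobolev_norm \<alpha> (w N))\<^sup>2 \<le> M\<^sup>2 + 480 * 4 powr \<alpha> * suminf (\<lambda>n. q ^ n * dyadic_sq n (w N))" by (rule res(2)) simp
    also have "suminf (\<lambda>n. q ^ n * dyadic_sq n (w N)) = suminf (\<lambda>m. q ^ (m + N) * dyadic_sq (m + N) (w N))"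
    proof -
      have "(\<Sum>n<N. q ^ n * dyadic_sq n (w N)) = 0"
        using dyadic_sq_interp_coarse unfolding w_def by (intro sum.neutral) auto
      then show ?thesis using suminf_split_initial_segment[OF Sw, of N N] by simp
    qed
    also have "\<dots> \<le> suminf (b N)" by (intro suminf_le wb Sw' Sb)
    finally show "(sobolev_norm \<alpha> (w N))\<^sup>2 \<le> M\<^sup>2 + 480 * 4 powr \<alpha> * suminf (b N)" by simp
  qed
  show "(\<lambda>x. u x - interp N u x) \<in> sobolev \<alpha>" for N
    using continuous_on_bounded_01[OF cw[of N]] bound(1) by (metis (no_types, lifting) ext w_def)
  have bN: "suminf (b N) = 2 * (suminf a - sum a {..<N}) + 8 * a N * suminf (\<lambda>m. r ^ m)" for N
  proof -
    have "suminf (b N) = suminf (\<lambda>m. 2 * a (m + N)) + suminf (\<lambda>m. 8 * a N * r ^ m)"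
      unfolding b_def[abs_def] using Sa Sr
      by (intro suminf_add[symmetric] summable_mult) (simp_all add: summable_iff_shift)
    also have "suminf (\<lambda>m. 2 * a (m + N)) = 2 * suminf (\<lambda>m. a (m + N))"
      using Sa by (intro suminf_mult) (simp add: summable_iff_shift)
    also have "suminf (\<lambda>m. 8 * a N * r ^ m) = 8 * a N * suminf (\<lambda>m. r ^ m)" by (rule suminf_mult[OF Sr])
    finally show ?thesis using suminf_minus_initial_segment[OF Sa, of N] by simp
  qed
  have "(\<lambda>N. 480 * 4 powr \<alpha> * suminf (b N)) \<longlonglongrightarrow> 480 * 4 powr \<alpha> * (2 * (suminf a - suminf a) + 8 * 0 * suminf (\<lambda>m. r ^ m))"
    unfolding bN by (intro tendsto_intros summable_LIMSEQ Sa summable_LIMSEQ_zero)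
  then have b0: "(\<lambda>N. 480 * 4 powr \<alpha> * suminf (b N)) \<longlonglongrightarrow> 0" by simp
  have "(\<lambda>N. (sobolev_norm \<alpha> (w N))\<^sup>2) \<longlonglongrightarrow> 0"
  proof (rule LIMSEQ_I)
    fix e :: real assume e: "0 < e"
    have "0 < sqrt (e / 2)" using e by simp
    from interp_uniform[OF u this] obtain N0
      where N0: "\<And>N x. N \<ge> N0 \<Longrightarrow> x \<in> {0..1} \<Longrightarrow> cmod (w N x) \<le> sqrt (e / 2)"
      unfolding w_def by blast
    obtain N1 where N1: "\<And>N. N \<ge> N1 \<Longrightarrow> norm (480 * 4 powr \<alpha> * suminf (b N) - 0) < e / 2"
      using LIMSEQ_D[OF b0, of "e / 2"] e by auto
    have "norm ((sobolev_norm \<alpha> (w N))\<^sup>2 - 0) < e" if "N \<ge> max N0 N1" for N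
    proof -
      have "(sobolev_norm \<alpha> (w N))\<^sup>2 \<le> (sqrt (e / 2))\<^sup>2 + 480 * 4 powr \<alpha> * suminf (b N)"
        using that by (intro bound(2) N0) auto
      also have "\<dots> < e / 2 + e / 2"
        using N1[of N] that e by (intro add_le_less_mono) auto
      finally show ?thesis by simp
    qed
    then show "\<exists>no. \<forall>N\<ge>no. norm ((sobolev_norm \<alpha> (w N))\<^sup>2 - 0) < e" by blast
  qed
  then have "(\<lambda>N. sqrt ((sobolev_norm \<alpha> (w N))\<^sup>2)) \<longlonglongrightarrow> sqrt 0" by (rule tendsto_real_sqrt)
  then show "(\<lambda>N. sobolev_norm \<alpha> (\<lambda>x. u x - interp N u x)) \<longlonglongrightarrow> 0"
    by (simp add: sobolev_norm_nonneg w_def[abs_def])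
qed

text \<open>On a cell the integrand is \<open>(c + ramp * s)\<close> times a multiple of the
  derivative of \<open>ramp\<close>. As \<open>ramp\<close> runs from 0 to 1, the first part
  integrates to \<open>c\<close> and the second to \<open>s / 2\<close>: both nodes get equal
  weight, which is the trapezoid rule without error.\<close>

lemma integral_interp:
  "integral {0..1} (\<lambda>x. interp N u x * interp_deriv N v x) =
    (\<Sum>k<2 ^ N. (u (real k / 2 ^ N) + u (real (Suc k) / 2 ^ N)) / 2 * dyadic_step N v k)"
proof (rule integral_unique)
  let ?r = "\<lambda>l x. ramp (2 ^ N * x - real l)" and ?h = "\<lambda>l x. 2 ^ N * hat (2 ^ N * x - real l)"
  have 1: "((\<lambda>x. ?h l x *\<^sub>R interp N u x) has_integral (u (real l / 2 ^ N) + u (real (Suc l) / 2 ^ N)) / 2) {0..1}"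
    if l: "l < 2 ^ N" for l
  proof -
    define F where "F x = ?r l x *\<^sub>R u (real l / 2 ^ N) + ((?r l x)\<^sup>2 / 2) *\<^sub>R dyadic_step N u l" for x
    have "(F has_vector_derivative ?h l x *\<^sub>R interp N u x) (at x within {0..1})" for x
    proof -
      have "(F has_vector_derivative ?h l x *\<^sub>R u (real l / 2 ^ N) + (?r l x * ?h l x) *\<^sub>R dyadic_step N u l) (at x within {0..1})"
      proof -
        have d: "((\<lambda>x. (?r l x)\<^sup>2 / 2) has_real_derivative ?r l x * ?h l x) (at x within {0..1})"
          using DERIV_cdivide[OF DERIV_mult[OF DERIV_ramp_affine[of "2 ^ N" "real l" x "{0..1}"]
            DERIV_ramp_affine[of "2 ^ N" "real l" x "{0..1}"]], of 2]
          by (simp add: power2_eq_square mult_ac)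
        show ?thesis unfolding F_def
          using has_vector_derivative_add[OF has_vector_derivative_scaleR[OF DERIV_ramp_affine has_vector_derivative_const]
            has_vector_derivative_scaleR[OF d has_vector_derivative_const]] by simp
      qed
      also have "?h l x *\<^sub>R u (real l / 2 ^ N) + (?r l x * ?h l x) *\<^sub>R dyadic_step N u l = ?h l x *\<^sub>R interp N u x"
      proof (cases "real l \<le> 2 ^ N * x \<and> 2 ^ N * x \<le> real (Suc l)")
        case True
        then show ?thesis using interp_cell[OF l, of x u] by (simp add: scaleR_add_right mult.commute)
      next
        case False
        \<comment> \<open>The derivative vanishes off the cell, so the local formula for
          \<open>interp\<close> serves on all of \<open>[0,1]\<close>.\<close>
        then have "hat (2 ^ N * x - real l) = 0" by (intro hat_outside) auto
        then show ?thesis by simp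
      qed
      finally show ?thesis .
    qed
    then have "((\<lambda>x. ?h l x *\<^sub>R interp N u x) has_integral (F 1 - F 0)) {0..1}"
      by (intro fundamental_theorem_of_calculus) auto
    moreover have "F 1 - F 0 = (u (real l / 2 ^ N) + u (real (Suc l) / 2 ^ N)) / 2"
    proof -
      have "real (Suc l) \<le> 2 ^ N" by (rule real_Suc_le_two_power[OF l])
      then have "?r l 1 = 1" "?r l 0 = 0" by (auto intro: ramp_1 ramp_0)
      then show ?thesis by (simp add: F_def dyadic_step_def scaleR_conv_of_real field_simps)
    qed
    ultimately show ?thesis by simp
  qed
  have "((\<lambda>x. \<Sum>l<2 ^ N. (?h l x *\<^sub>R interp N u x) * dyadic_step N v l) has_integral
      (\<Sum>l<2 ^ N. (u (real l / 2 ^ N) + u (real (Suc l) / 2 ^ N)) / 2 * dyadic_step N v l)) {0..1}"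
    by (intro has_integral_sum has_integral_mult_left 1) auto
  moreover have "(\<Sum>l<2 ^ N. (?h l x *\<^sub>R interp N u x) * dyadic_step N v l) = interp N u x * interp_deriv N v x" for x
    by (simp add: interp_deriv_def sum_distrib_left scaleR_conv_of_real mult_ac)
  ultimately show "((\<lambda>x. interp N u x * interp_deriv N v x) has_integral
    (\<Sum>k<2 ^ N. (u (real k / 2 ^ N) + u (real (Suc k) / 2 ^ N)) / 2 * dyadic_step N v k)) {0..1}" by simp
qed

text \<open>The right-hand side does not depend on the choice of \<open>B\<close> except through its
  limit, so any two bounded extensions agree on \<open>u\<close> and \<open>v\<close>.\<close>

lemma bounded_extension_trapezoid:
  assumes B: "bounded_extension \<alpha> B" and \<alpha>: "1/2 < \<alpha>" "\<alpha> < 1"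
    and u: "continuous_on {0..1} u" "summable (\<lambda>n. (2 powr (2 * \<alpha> - 1)) ^ n * dyadic_sq n u)"
    and v: "continuous_on {0..1} v" "summable (\<lambda>n. (2 powr (2 * \<alpha> - 1)) ^ n * dyadic_sq n v)"
  shows "(\<lambda>N. \<Sum>k<2 ^ N. (u (real k / 2 ^ N) + u (real (Suc k) / 2 ^ N)) / 2 * dyadic_step N v k) \<longlonglongrightarrow> B u v"
proof -
  have in_sob: "w \<in> sobolev \<alpha>" if "continuous_on {0..1} w" "summable (\<lambda>n. (2 powr (2 * \<alpha> - 1)) ^ n * dyadic_sq n w)" for w
    using continuous_on_bounded_01[OF that(1)] sobolev_of_dyadic(1)[OF that(1) _ less_imp_le[OF \<alpha>(1)] that(2)] by metis
  have i: "interp N w \<in> sobolev \<alpha>" for N w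
    by (rule C1_in_sobolev[where u' = "interp_deriv N w"])
      (use \<alpha> in \<open>auto intro: interp_has_derivative continuous_on_interp_deriv\<close>)
  have "(\<lambda>N. B (interp N u) (interp N v)) \<longlonglongrightarrow> B u v"
    by (intro bounded_extension_tendsto[OF B] in_sob i interp_tendsto_sobolev \<alpha> u v)
  moreover have "B (interp N u) (interp N v) = integral {0..1} (\<lambda>x. interp N u x * interp_deriv N v x)" for N
    by (rule bounded_extension_C1[OF B \<alpha>, where u' = "interp_deriv N u"])
      (auto intro: interp_has_derivative continuous_on_interp_deriv)
  ultimately show ?thesis by (simp add: integral_interp)
qed

section \<open>The critical order and the value of the form on traces\<close>

lemma alpha0_less_1: "alpha0 < 1"
  by (simp add: alpha0_def)

text \<open>\<open>4 powr alpha0\<close> is 10/3, so at the critical order the weight equals the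
  renormalisation factor 5/3, and the summability along edges reaches \<open>alpha0\<close>
  itself.\<close>

lemma alpha0_power: assumes "\<alpha> \<le> alpha0" shows "2 powr (2 * \<alpha> - 1) \<le> (5/3::real)"
proof -
  have "(2::real) powr (2 * \<alpha> - 1) \<le> 2 powr (2 * alpha0 - 1)" using assms by (intro powr_mono) auto
  also have "\<dots> = 2 powr (2 * alpha0) / 2" by (simp add: powr_diff)
  also have "2 powr (2 * alpha0) = (4::real) powr alpha0" using powr_powr[of 2 2 alpha0] by simp
  also have "\<dots> = exp (alpha0 * ln 4)" by (simp add: powr_def)
  also have "alpha0 * ln 4 = ln (10/3)" by (simp add: alpha0_def)
  also have "exp (ln (10/3)) = (10/3 :: real)" by simp
  finally show ?thesis by simp
qed

lemma summable_edge_trace: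
  assumes "e \<in> all_oriented_edges" "\<alpha> \<le> alpha0"
  shows "summable (\<lambda>n. (2 powr (2 * \<alpha> - 1)) ^ n * dyadic_sq n (edge_trace e f))"
proof (rule summable_comparison_test'[OF summable_dyadic_sq_edge_trace[OF assms(1), of f]])
  fix n
  show "norm ((2 powr (2 * \<alpha> - 1)) ^ n * dyadic_sq n (edge_trace e f)) \<le> (5/3) ^ n * dyadic_sq n (edge_trace e f)"
    using alpha0_power[OF assms(2)] by (simp add: dyadic_sq_nonneg mult_right_mono power_mono)
qed

lemma edge_trace_in_sobolev:
  assumes e: "e \<in> all_oriented_edges" and \<alpha>: "1/2 < \<alpha>" "\<alpha> \<le> alpha0"
  shows "edge_trace e f \<in> sobolev \<alpha>"
  using continuous_on_bounded_01[OF continuous_on_edge_trace[OF e, of f]]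
    sobolev_of_dyadic(1)[OF continuous_on_edge_trace[OF e] _ less_imp_le[OF \<alpha>(1)] summable_edge_trace[OF e \<alpha>(2)]]
  by metis

lemma edge_riemann_sum:
  assumes e: "e \<in> oriented_edges m"
  shows "riemann_sum (m + n) [e] (f \<cdot>\<^sub>L der g) =
    (\<Sum>k<2 ^ n. edge_trace e f (real (Suc k) / 2 ^ n) * dyadic_step n (edge_trace e g) k)"
proof -
  have "riemann_sum (m + n) [e] (f \<cdot>\<^sub>L der g) = (\<Sum>k<2 ^ n. pairing (f \<cdot>\<^sub>L der g) (subedge e n k))"
    using riemann_sum_edge[OF e] sum_subedges[OF oriented_edges_lattice(7)[OF e]] by metis
  also have "\<dots> = (\<Sum>k<2 ^ n. edge_trace e f (real (Suc k) / 2 ^ n) * dyadic_step n (edge_trace e g) k)"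
  proof (rule sum.cong[OF refl])
    fix k :: nat assume "k \<in> {..<2 ^ n}"
    then have "source (subedge e n k) \<in> gasket"
      using oriented_edges_lattice(5)[OF subedge_oriented[OF e]] by simp
    then show "pairing (f \<cdot>\<^sub>L der g) (subedge e n k) =
        edge_trace e f (real (Suc k) / 2 ^ n) * dyadic_step n (edge_trace e g) k"
      by (simp add: pairing_form edge_trace_def dyadic_step_def source_subedge target_subedge)
  qed
  finally show ?thesis .
qed

text \<open>The pairing evaluates \<open>f\<close> at the target, so the path integral is a limit of
  sums with right end values. These differ from trapezoid sums by half the products of increments,
  which vanish with \<open>dyadic_sq\<close>.\<close>

lemma path_integral_eq_extension:
  assumes B: "bounded_extension \<alpha> B" and e: "e \<in> all_oriented_edges" and \<alpha>: "1/2 < \<alpha>" "\<alpha> \<le> alpha0"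
  shows "B (edge_trace e f) (edge_trace e g) = path_integral [e] (f \<cdot>\<^sub>L der g)"
proof -
  obtain m where m: "e \<in> oriented_edges m" using e by (auto simp: all_oriented_edges_def)
  define u v where "u = edge_trace e f" and "v = edge_trace e g"
  let ?x = "\<lambda>n k. real k / 2 ^ n"
  have D0: "(\<lambda>n. dyadic_sq n (edge_trace e h)) \<longlonglongrightarrow> 0" for h
  proof (rule tendsto_sandwich[OF _ _ tendsto_const summable_LIMSEQ_zero[OF summable_dyadic_sq_edge_trace[OF e, of h]]])
    have "1 * dyadic_sq n (edge_trace e h) \<le> (5/3) ^ n * dyadic_sq n (edge_trace e h)" for n
      by (intro mult_right_mono) (auto simp: dyadic_sq_nonneg)
    then show "\<forall>\<^sub>F n in sequentially. dyadic_sq n (edge_trace e h) \<le> (5/3) ^ n * dyadic_sq n (edge_trace e h)" by simp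
  qed (auto simp: dyadic_sq_nonneg)
  have "(\<lambda>n. \<Sum>k<2 ^ n. (u (?x n k) + u (?x n (Suc k))) / 2 * dyadic_step n v k) \<longlonglongrightarrow> B u v"
    unfolding u_def v_def using \<alpha> alpha0_less_1 e
    by (intro bounded_extension_trapezoid[OF B] continuous_on_edge_trace summable_edge_trace) auto
  moreover have "(\<lambda>n. (\<Sum>k<2 ^ n. u (?x n (Suc k)) * dyadic_step n v k) -
      (\<Sum>k<2 ^ n. (u (?x n k) + u (?x n (Suc k))) / 2 * dyadic_step n v k)) \<longlonglongrightarrow> 0"
  proof (rule Lim_null_comparison)
    show "(\<lambda>n. (dyadic_sq n u + dyadic_sq n v) / 4) \<longlonglongrightarrow> 0"
      using tendsto_divide[OF tendsto_add[OF D0[of f] D0[of g]] tendsto_const, of 4] by (simp add: u_def v_def)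
    show "\<forall>\<^sub>F n in sequentially. norm ((\<Sum>k<2 ^ n. u (?x n (Suc k)) * dyadic_step n v k) -
        (\<Sum>k<2 ^ n. (u (?x n k) + u (?x n (Suc k))) / 2 * dyadic_step n v k)) \<le> (dyadic_sq n u + dyadic_sq n v) / 4"
    proof (rule always_eventually, rule allI)
      fix n
      have "(\<Sum>k<2 ^ n. u (?x n (Suc k)) * dyadic_step n v k) - (\<Sum>k<2 ^ n. (u (?x n k) + u (?x n (Suc k))) / 2 * dyadic_step n v k)
          = (\<Sum>k<2 ^ n. dyadic_step n u k * dyadic_step n v k / 2)"
        unfolding sum_subtractf[symmetric] by (intro sum.cong refl) (simp add: dyadic_step_def field_simps)
      also have "norm \<dots> \<le> (\<Sum>k<2 ^ n. ((cmod (dyadic_step n u k))\<^sup>2 + (cmod (dyadic_step n v k))\<^sup>2) / 4)"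
      proof (rule sum_norm_le)
        fix k
        show "norm (dyadic_step n u k * dyadic_step n v k / 2) \<le> ((cmod (dyadic_step n u k))\<^sup>2 + (cmod (dyadic_step n v k))\<^sup>2) / 4"
          using mult_le_half_squares[of "cmod (dyadic_step n u k)" "cmod (dyadic_step n v k)"]
          by (simp add: norm_mult norm_divide)
      qed
      also have "\<dots> = (dyadic_sq n u + dyadic_sq n v) / 4"
        by (simp add: dyadic_sq_step sum.distrib sum_divide_distrib[symmetric])
      finally show "norm ((\<Sum>k<2 ^ n. u (?x n (Suc k)) * dyadic_step n v k) -
        (\<Sum>k<2 ^ n. (u (?x n k) + u (?x n (Suc k))) / 2 * dyadic_step n v k)) \<le> (dyadic_sq n u + dyadic_sq n v) / 4" .
    qed
  qed
  ultimately have "(\<lambda>n. \<Sum>k<2 ^ n. u (?x n (Suc k)) * dyadic_step n v k) \<longlonglongrightarrow> B u v"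
    using tendsto_add by fastforce
  then have "(\<lambda>n. riemann_sum (m + n) [e] (f \<cdot>\<^sub>L der g)) \<longlonglongrightarrow> B u v"
    unfolding edge_riemann_sum[OF m] u_def v_def .
  moreover have "(\<lambda>n. riemann_sum (m + n) [e] (f \<cdot>\<^sub>L der g)) \<longlonglongrightarrow> path_integral [e] (f \<cdot>\<^sub>L der g)"
    unfolding riemann_sum_edge[OF m] by (rule riemann_sum_edge_tendsto[OF Omega1.form m])
  ultimately show ?thesis unfolding u_def v_def by (rule LIMSEQ_unique)
qed

theorem theorem2p5:
  fixes \<omega> :: tensor and \<gamma> :: "oedge list"
  assumes "\<omega> \<in> Omega1" and "elementary_path \<gamma>"
  shows "convergent (\<lambda>n. riemann_sum n \<gamma> \<omega>) \<and>
    (\<forall>h. path_integral \<gamma> (h \<cdot>\<^sub>L \<omega>) = path_integral \<gamma> (\<omega> \<cdot>\<^sub>R h)) \<and>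
    (\<forall>h. (\<lambda>n. \<Sum>e\<in>path_edges n \<gamma>. fe_apply h (target e) * path_integral [e] \<omega>)
      \<longlonglongrightarrow> path_integral \<gamma> (h \<cdot>\<^sub>L \<omega>)) \<and>
    (\<forall>e f g. e \<in> all_oriented_edges \<longrightarrow>
      (\<forall>\<alpha>. 1/2 < \<alpha> \<and> \<alpha> \<le> alpha0 \<longrightarrow>
        edge_trace e f \<in> sobolev \<alpha> \<and> edge_trace e g \<in> sobolev \<alpha> \<and>
        (\<exists>B. bounded_extension \<alpha> B) \<and>
        path_integral [e] (f \<cdot>\<^sub>L der g) = edge_form \<alpha> e f g))"
proof (intro conjI allI impI; (elim conjE)?)
  show "convergent (\<lambda>n. riemann_sum n \<gamma> \<omega>)" by (rule riemann_sum_convergent[OF assms])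
  show "path_integral \<gamma> (h \<cdot>\<^sub>L \<omega>) = path_integral \<gamma> (\<omega> \<cdot>\<^sub>R h)" for h by (rule path_integral_trace[OF assms])
  show "(\<lambda>n. \<Sum>e\<in>path_edges n \<gamma>. fe_apply h (target e) * path_integral [e] \<omega>)
      \<longlonglongrightarrow> path_integral \<gamma> (h \<cdot>\<^sub>L \<omega>)" for h by (rule path_integral_lmult_limit[OF assms])
next
  fix e f g and \<alpha> :: real
  assume e: "e \<in> all_oriented_edges" and \<alpha>: "1/2 < \<alpha>" "\<alpha> \<le> alpha0"
  show "edge_trace e f \<in> sobolev \<alpha>" "edge_trace e g \<in> sobolev \<alpha>" by (rule edge_trace_in_sobolev[OF e \<alpha>])+
  show "\<exists>B. bounded_extension \<alpha> B" using bounded_extension_weak_form[OF \<alpha>(1)] by blast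
  \<comment> \<open>The description operator asks for one extension with this value, which is
    \<open>weak_form\<close>, and for the same value from every other;
    \<open>path_integral_eq_extension\<close> holds for an arbitrary \<open>B\<close> and gives
    both.\<close>
  show "path_integral [e] (f \<cdot>\<^sub>L der g) = edge_form \<alpha> e f g"
    unfolding edge_form_def
    by (rule the_equality[symmetric])
      (use bounded_extension_weak_form[OF \<alpha>(1)] path_integral_eq_extension[OF _ e \<alpha>] in \<open>metis, metis\<close>)
qed

end
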